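(* Let $\chi(S^2,4)$ be the traceless $SU(2)$ character variety of the 2-sphere with four marked points, with smooth top stratum $\chi(S^2,4)^*$ and Atiyah-Bott-Goldman form $\widehat\omega_{(S^2,4)}$, and let $\mathbb{P}$ be the pillowcase, with smooth part $\mathbb{P}^*$. The two half Dehn twists $H_1,H_2$ of $(S^2,4)$ (in a twice-punctured disk containing the punctures $c,d$ and in a twice-punctured disk containing the punctures $b,d$, respectively) generate a $PSL(2,\mathbb{Z})$ action on $\chi(S^2,4)$ which preserves the symplectic form $\widehat\omega_{(S^2,4)}$. Moreover, for some non-zero constant $c$, the map $$\hat\rho:(\mathbb{P}^*,\,c\,dx\wedge dy)\to(\chi(S^2,4)^*,\widehat\omega_{(S^2,4)}),\qquad [e^{\mathbf{i}x},e^{\mathbf{i}y}]\mapsto\big[a\mapsto\mathbf{j},\ b\mapsto e^{\mathbf{i}x}\mathbf{j},\ c\mapsto e^{\mathbf{i}y}\mathbf{j}\big]$$ is a $PSL(2,\mathbb{Z})$-equivariant symplectomorphism.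
   Context: $SU(2)$ is identified with the unit quaternions, $su(2)$ with the purely imaginary quaternions, $\{v,w\}=-\tfrac12\mathrm{Tr}(vw)=-\mathrm{Re}(vw)$; $J\subset SU(2)$ is the conjugacy class of purely imaginary (traceless) unit quaternions. Pillowcase: $\mathbb{T}=U(1)\times U(1)$ with symplectic form $dx\wedge dy$ in coordinates $(e^{\mathbf{i}x},e^{\mathbf{i}y})$. $SL(2,\mathbb{Z})$ acts on $\mathbb{T}$ by $\begin{pmatrix} p & r \\ q & s \end{pmatrix}\cdot(e^{x\mathbf{i}},e^{y\mathbf{i}})=(e^{(px+ry)\mathbf{i}},e^{(qx+sy)\mathbf{i}})$, preserving $dx\wedge dy$. The element $-1$ acts by the elliptic involution $\iota(e^{\mathbf{i}x},e^{\mathbf{i}y})=(e^{-\mathbf{i}x},e^{-\mathbf{i}y})$, with fixed points $(\pm1,\pm1)$. $\mathbb{T}^*$ is the complement of these four points, $\mathbb{P}=\mathbb{T}/\iota$, $\mathbb{P}^*=\mathbb{T}^*/\iota$. Then $PSL(2,\mathbb{Z})=SL(2,\mathbb{Z})/\{\pm1\}$ acts on $\mathbb{P}$ and $\mathbb{P}^*$, and $dx\wedge dy$ descends to an invariant symplectic form on $\mathbb{P}^*$. Character variety: $F=S^2\setminus 4D^2$ is the sphere minus four disjoint open disks, $\pi_1(F)=\langle a,b,c,d\mid abcd=1\rangle$ with $a,b,c,d$ represented by the boundary circles (so it is free on $a,b,c$). $\chi(S^2,4)$ is the set of conjugacy classes of homomorphisms $\pi_1(F)\to SU(2)$ sending each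 of $a,b,c,d$ into $J$; $\chi(S^2,4)^*$ is its smooth top stratum. The tangent space of $\chi(S^2,4)^*$ at $[\rho]$ is $\widehat H^1(F;su(2)_{\mathrm{ad}\rho})=\mathrm{Image}\big(H^1(F,\partial F;su(2)_{\mathrm{ad}\rho})\to H^1(F;su(2)_{\mathrm{ad}\rho})\big)$, and $\widehat\omega_{(S^2,4)}$ is the nondegenerate skew form on it induced by $(x,y)\mapsto\{x\cup y\}\cap[F,\partial F]$ on $H^1(F,\partial F;su(2)_{\mathrm{ad}\rho})$, where the coefficients are paired by $\{\ ,\ \}$. Half Dehn twists: with base point outside their supports, the two half Dehn twists induce the automorphisms of $\pi_1(F)$ $$H_1:\ a\mapsto a,\ b\mapsto b,\ c\mapsto d=c^{-1}b^{-1}a^{-1};\qquad H_2:\ a\mapsto a,\ b\mapsto cdc^{-1}=b^{-1}a^{-1}c^{-1},\ c\mapsto c,$$ and they act on $\chi(S^2,4)$ by the homeomorphisms $H_i^*[\rho]=[\rho\circ H_i]$. "Equivariant" means that, under $\hat\rho$, the group of transformations generated by $H_1^*,H_2^*$ corresponds to the $PSL(2,\mathbb{Z})$ action on the pillowcase. *)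

theory Defs
  imports "HOL-Analysis.Analysis" "HOL-Algebra.Group_Action" "HOL-Algebra.Generated_Groups"
begin

section \<open>Quaternions\<close>

datatype quat = Quat (qre: real) (qi: real) (qj: real) (qk: real)

lemma quat_eq_iff: "p = q \<longleftrightarrow> qre p = qre q \<and> qi p = qi q \<and> qj p = qj q \<and> qk p = qk q"
  by (cases p; cases q) auto

instantiation quat :: ring_1
begin

definition "0 = Quat 0 0 0 0"
definition "1 = Quat 1 0 0 0"
definition "p + q = Quat (qre p + qre q) (qi p + qi q) (qj p + qj q) (qk p + qk q)"
definition "p - q = Quat (qre p - qre q) (qi p - qi q) (qj p - qj q) (qk p - qk q)"
definition "- p = Quat (- qre p) (- qi p) (- qj p) (- qk p)"
definition "p * q = Quat
   (qre p * qre q - qi p * qi q - qj p * qj q - qk p * qk q)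
   (qre p * qi q + qi p * qre q + qj p * qk q - qk p * qj q)
   (qre p * qj q - qi p * qk q + qj p * qre q + qk p * qi q)
   (qre p * qk q + qi p * qj q - qj p * qi q + qk p * qre q)"

instance
  by standard
    (simp_all add: quat_eq_iff zero_quat_def one_quat_def plus_quat_def minus_quat_def
      uminus_quat_def times_quat_def algebra_simps)

end

instantiation quat :: real_algebra_1
begin

definition "r *\<^sub>R q = Quat (r * qre q) (r * qi q) (r * qj q) (r * qk q)" for r :: real

instance
  by standard
    (simp_all add: quat_eq_iff plus_quat_def times_quat_def scaleR_quat_def algebra_simps)

end

lemma quat_sel [simp]:
  "qre 0 = 0" "qi 0 = 0" "qj 0 = 0" "qk 0 = 0"
  "qre 1 = 1" "qi 1 = 0" "qj 1 = 0" "qk 1 = 0"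
  "qre (p + q) = qre p + qre q" "qi (p + q) = qi p + qi q"
  "qj (p + q) = qj p + qj q" "qk (p + q) = qk p + qk q"
  "qre (p - q) = qre p - qre q" "qi (p - q) = qi p - qi q"
  "qj (p - q) = qj p - qj q" "qk (p - q) = qk p - qk q"
  "qre (- p) = - qre p" "qi (- p) = - qi p" "qj (- p) = - qj p" "qk (- p) = - qk p"
  "qre (r *\<^sub>R p) = r * qre p" "qi (r *\<^sub>R p) = r * qi p"
  "qj (r *\<^sub>R p) = r * qj p" "qk (r *\<^sub>R p) = r * qk p"
  "qre (p * q) = qre p * qre q - qi p * qi q - qj p * qj q - qk p * qk q"
  "qi (p * q) = qre p * qi q + qi p * qre q + qj p * qk q - qk p * qj q"
  "qj (p * q) = qre p * qj q - qi p * qk q + qj p * qre q + qk p * qi q"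
  "qk (p * q) = qre p * qk q + qi p * qj q - qj p * qi q + qk p * qre q"
  by (simp_all add: zero_quat_def one_quat_def plus_quat_def minus_quat_def
      uminus_quat_def times_quat_def scaleR_quat_def)

definition qcnj :: "quat \<Rightarrow> quat" where
  "qcnj q = Quat (qre q) (- qi q) (- qj q) (- qk q)"

lemma qcnj_sel [simp]:
  "qre (qcnj q) = qre q" "qi (qcnj q) = - qi q" "qj (qcnj q) = - qj q" "qk (qcnj q) = - qk q"
  by (simp_all add: qcnj_def)

instantiation quat :: real_inner
begin

definition "inner p q = qre p * qre q + qi p * qi q + qj p * qj q + qk p * qk q" for p q :: quat
definition "norm q = sqrt ((qre q)\<^sup>2 + (qi q)\<^sup>2 + (qj q)\<^sup>2 + (qk q)\<^sup>2)" for q :: quat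
definition "sgn q = q /\<^sub>R norm q" for q :: quat
definition "dist p q = norm (p - q)" for p q :: quat
definition [code del]:
  "(uniformity :: (quat \<times> quat) filter) = (INF e\<in>{0 <..}. principal {(x, y). dist x y < e})"
definition [code del]:
  "open U \<longleftrightarrow> (\<forall>x\<in>U. \<forall>\<^sub>F (x', y) in uniformity. x' = x \<longrightarrow> y \<in> U)" for U :: "quat set"

instance
proof
  fix p q r :: quat and t :: real
  show "inner p q = inner q p"
    by (simp add: inner_quat_def algebra_simps)
  show "inner (p + q) r = inner p r + inner q r"
    by (simp add: inner_quat_def algebra_simps)
  show "inner (t *\<^sub>R p) q = t * inner p q"
    by (simp add: inner_quat_def algebra_simps)
  show "0 \<le> inner p p"
    by (simp add: inner_quat_def)
  show "inner p p = 0 \<longleftrightarrow> p = 0"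
  proof
    assume "inner p p = 0"
    then have "(qre p)\<^sup>2 + (qi p)\<^sup>2 + (qj p)\<^sup>2 + (qk p)\<^sup>2 = 0"
      by (simp add: inner_quat_def power2_eq_square)
    then show "p = 0"
      by (simp add: quat_eq_iff add_nonneg_eq_0_iff)
  qed (simp add: inner_quat_def)
  show "norm p = sqrt (inner p p)"
    by (simp add: norm_quat_def inner_quat_def power2_eq_square)
qed (simp_all add: sgn_quat_def dist_quat_def uniformity_quat_def open_quat_def)

end

instantiation quat :: real_normed_div_algebra
begin

definition "inverse q = qcnj q /\<^sub>R (norm q)\<^sup>2" for q :: quat
definition "p div q = p * inverse q" for p q :: quat

instance
proof
  fix p q :: quat
  have n2: "(norm x)\<^sup>2 = (qre x)\<^sup>2 + (qi x)\<^sup>2 + (qj x)\<^sup>2 + (qk x)\<^sup>2" for x :: quat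
    by (simp add: norm_quat_def)
  have c: "x * qcnj x = (norm x)\<^sup>2 *\<^sub>R 1" "qcnj x * x = (norm x)\<^sup>2 *\<^sub>R 1" for x :: quat
    by (simp_all add: quat_eq_iff n2) (simp_all add: power2_eq_square algebra_simps)
  show "p \<noteq> 0 \<Longrightarrow> inverse p * p = 1"
    by (simp add: inverse_quat_def c)
  show "p \<noteq> 0 \<Longrightarrow> p * inverse p = 1"
    by (simp add: inverse_quat_def c)
  show "p div q = p * inverse q"
    by (fact divide_quat_def)
  show "inverse 0 = (0 :: quat)"
    by (simp add: inverse_quat_def quat_eq_iff)
  have "(norm (p * q))\<^sup>2 = (norm p * norm q)\<^sup>2"
    unfolding power_mult_distrib n2 by (simp add: power2_eq_square algebra_simps)
  then show "norm (p * q) = norm p * norm q"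
    by (rule power2_eq_imp_eq) auto
qed

end

definition quat_i :: quat where "quat_i = Quat 0 1 0 0"
definition quat_j :: quat where "quat_j = Quat 0 0 1 0"
definition quat_k :: quat where "quat_k = Quat 0 0 0 1"

instantiation quat :: euclidean_space
begin

definition "Basis = {1, quat_i, quat_j, quat_k}"

instance
proof
  show "(Basis :: quat set) \<noteq> {}" "finite (Basis :: quat set)"
    by (simp_all add: Basis_quat_def)
  fix u v :: quat
  show "u \<in> Basis \<Longrightarrow> v \<in> Basis \<Longrightarrow> inner u v = (if u = v then 1 else 0)"
    by (auto simp: Basis_quat_def quat_i_def quat_j_def quat_k_def inner_quat_def quat_eq_iff)
  show "(\<forall>u\<in>Basis. inner v u = 0) \<longleftrightarrow> v = 0"
    by (simp add: Basis_quat_def quat_i_def quat_j_def quat_k_def inner_quat_def) (auto simp: quat_eq_iff)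
qed

end

definition quat_of_complex :: "complex \<Rightarrow> quat" where
  "quat_of_complex z = Quat (Re z) (Im z) 0 0"

definition SU2 :: "quat monoid" where
  "SU2 = \<lparr>carrier = {q. norm q = 1}, mult = (*), one = 1\<rparr>"

definition su2 :: "quat set" where
  "su2 = {q. qre q = 0}"

definition su2_pair :: "quat \<Rightarrow> quat \<Rightarrow> real" where
  "su2_pair v w = - qre (v * w)"

definition J :: "quat set" where
  "J = {q. norm q = 1 \<and> qre q = 0}"

lemma group_SU2: "group SU2"
proof (rule groupI)
  fix x assume "x \<in> carrier SU2"
  then show "\<exists>y\<in>carrier SU2. y \<otimes>\<^bsub>SU2\<^esub> x = \<one>\<^bsub>SU2\<^esub>"
    by (intro bexI[of _ "inverse x"]) (auto simp: SU2_def norm_inverse intro!: left_inverse)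
qed (auto simp: SU2_def norm_mult mult.assoc)


section \<open>The fundamental group of the four-holed sphere\<close>

datatype bdry = Ba | Bb | Bc | Bd

instance bdry :: finite
proof
  have "(UNIV :: bdry set) = {Ba, Bb, Bc, Bd}"
    using bdry.exhaust by blast
  then show "finite (UNIV :: bdry set)"
    by (metis finite.emptyI finite_insert)
qed

text \<open>A letter \<open>(s, True)\<close> stands for the generator \<open>s\<close>, and \<open>(s, False)\<close> for its inverse.\<close>

type_synonym word = "(bdry \<times> bool) list"

inductive word_eq :: "word \<Rightarrow> word \<Rightarrow> bool" where
  refl: "word_eq u u"
| sym: "word_eq u v \<Longrightarrow> word_eq v u"
| trans: "word_eq u v \<Longrightarrow> word_eq v w \<Longrightarrow> word_eq u w"
| cancel: "word_eq (u @ [(s, b), (s, \<not> b)] @ v) (u @ v)"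
| relator: "word_eq (u @ [(Ba, True), (Bb, True), (Bc, True), (Bd, True)] @ v) (u @ v)"

lemma word_eq_append: "word_eq u u' \<Longrightarrow> word_eq v v' \<Longrightarrow> word_eq (u @ v) (u' @ v')"
proof -
  have l: "word_eq (p @ x) (p @ y)" if "word_eq x y" for p x y
    using that
  proof induction
    case (cancel u s b v)
    show ?case using word_eq.cancel[of "p @ u"] by simp
  next
    case (relator u v)
    show ?case using word_eq.relator[of "p @ u"] by simp
  qed (auto intro: word_eq.refl word_eq.sym word_eq.trans)
  have r: "word_eq (x @ p) (y @ p)" if "word_eq x y" for p x y
    using that
  proof induction
    case (cancel u s b v)
    show ?case using word_eq.cancel[of u s b "v @ p"] by simp
  next
    case (relator u v)
    show ?case using word_eq.relator[of u "v @ p"] by simp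
  qed (auto intro: word_eq.refl word_eq.sym word_eq.trans)
  assume "word_eq u u'" "word_eq v v'"
  then show ?thesis
    by (meson l r word_eq.trans)
qed

quotient_type surface_group = word / word_eq
  by (rule equivpI) (auto intro: reflpI sympI transpI word_eq.intros)

lift_definition sg_mult :: "surface_group \<Rightarrow> surface_group \<Rightarrow> surface_group" is append
  by (rule word_eq_append)

lift_definition sg_one :: surface_group is "[]" .

lift_definition loop :: "bdry \<Rightarrow> surface_group" is "\<lambda>s. [(s, True)]" .

definition pi1F :: "surface_group monoid" where
  "pi1F = \<lparr>carrier = UNIV, mult = sg_mult, one = sg_one\<rparr>"

lemma group_pi1F: "group pi1F"
proof (rule groupI)
  fix x y z :: surface_group
  show "x \<otimes>\<^bsub>pi1F\<^esub> y \<otimes>\<^bsub>pi1F\<^esub> z = x \<otimes>\<^bsub>pi1F\<^esub> (y \<otimes>\<^bsub>pi1F\<^esub> z)"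
    by (simp add: pi1F_def) (transfer, simp add: word_eq.refl)
  show "\<one>\<^bsub>pi1F\<^esub> \<otimes>\<^bsub>pi1F\<^esub> x = x"
    by (simp add: pi1F_def) (transfer, simp add: word_eq.refl)
  have *: "\<exists>v. word_eq (v @ u) []" for u
  proof (induction u)
    case Nil
    show ?case by (auto intro: word_eq.refl exI[of _ "[]"])
  next
    case (Cons a u)
    then obtain v where v: "word_eq (v @ u) []" by blast
    obtain s b where a: "a = (s, b)" by force
    have "word_eq (v @ [(s, \<not> b), (s, \<not> \<not> b)] @ u) (v @ u)"
      by (rule word_eq.cancel)
    then have "word_eq ((v @ [(s, \<not> b)]) @ a # u) []"
      using v a by (auto intro: word_eq.trans)
    then show ?case by blast
  qed
  have "\<exists>y. sg_mult y x = sg_one"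
    by transfer (rule *)
  then show "\<exists>y\<in>carrier pi1F. y \<otimes>\<^bsub>pi1F\<^esub> x = \<one>\<^bsub>pi1F\<^esub>"
    by (simp add: pi1F_def)
qed (auto simp: pi1F_def)

text \<open>The homomorphism with prescribed values on the free generators \<open>a\<close>, \<open>b\<close>, \<open>c\<close>.\<close>

definition hom_of :: "('g, 'r) monoid_scheme \<Rightarrow> 'g \<Rightarrow> 'g \<Rightarrow> 'g \<Rightarrow> surface_group \<Rightarrow> 'g" where
  "hom_of G x y z = (THE h. h \<in> hom pi1F G \<and> h (loop Ba) = x \<and> h (loop Bb) = y \<and> h (loop Bc) = z)"

primrec word_val :: "('g, 'r) monoid_scheme \<Rightarrow> (bdry \<Rightarrow> 'g) \<Rightarrow> word \<Rightarrow> 'g" where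
  "word_val G f [] = \<one>\<^bsub>G\<^esub>"
| "word_val G f (a # w) = (if snd a then f (fst a) else inv\<^bsub>G\<^esub> f (fst a)) \<otimes>\<^bsub>G\<^esub> word_val G f w"

lemma loop_relation:
  "loop Ba \<otimes>\<^bsub>pi1F\<^esub> loop Bb \<otimes>\<^bsub>pi1F\<^esub> loop Bc \<otimes>\<^bsub>pi1F\<^esub> loop Bd = \<one>\<^bsub>pi1F\<^esub>"
  unfolding pi1F_def using word_eq.relator[of "[]" "[]"]
  by simp (transfer, simp)

lemma hom_of_ex1:
  assumes "group G" "x \<in> carrier G" "y \<in> carrier G" "z \<in> carrier G"
  shows "\<exists>!h. h \<in> hom pi1F G \<and> h (loop Ba) = x \<and> h (loop Bb) = y \<and> h (loop Bc) = z"
proof -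
  interpret G: group G by fact
  interpret P: group pi1F by (rule group_pi1F)
  define f where "f = case_bdry x y z (inv\<^bsub>G\<^esub> (x \<otimes>\<^bsub>G\<^esub> y \<otimes>\<^bsub>G\<^esub> z))"
  have f: "f s \<in> carrier G" for s
    using assms by (cases s) (auto simp: f_def)
  have vc: "word_val G f w \<in> carrier G" for w
    by (induction w) (auto simp: f)
  have va: "word_val G f (u @ v) = word_val G f u \<otimes>\<^bsub>G\<^esub> word_val G f v" for u v
    by (induction u) (auto simp: vc f G.m_assoc)
  have ve: "word_val G f u = word_val G f v" if "word_eq u v" for u v
    using that
  proof induction
    case (cancel u s b v)
    have "word_val G f [(s, b), (s, \<not> b)] = \<one>\<^bsub>G\<^esub>"
      by (cases b) (auto simp: f)
    then show ?case by (simp only: va) (simp add: vc)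
  next
    case (relator u v)
    have "f Ba \<otimes>\<^bsub>G\<^esub> (f Bb \<otimes>\<^bsub>G\<^esub> (f Bc \<otimes>\<^bsub>G\<^esub> f Bd)) = (f Ba \<otimes>\<^bsub>G\<^esub> f Bb \<otimes>\<^bsub>G\<^esub> f Bc) \<otimes>\<^bsub>G\<^esub> f Bd"
      by (simp add: f G.m_assoc)
    also have "\<dots> = \<one>\<^bsub>G\<^esub>"
      using assms(2-4) by (simp add: f_def G.r_inv del: G.inv_mult_group)
    finally have "word_val G f [(Ba, True), (Bb, True), (Bc, True), (Bd, True)] = \<one>\<^bsub>G\<^esub>"
      by (simp add: f)
    then show ?case by (simp only: va) (simp add: vc)
  qed auto
  define h where "h = (\<lambda>p. word_val G f (rep_surface_group p))"
  have h_abs: "h (abs_surface_group w) = word_val G f w" for w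
    unfolding h_def
    by (rule ve) (metis Quotient3_surface_group rep_abs_rsp_left word_eq.refl)
  have h_mult: "h (sg_mult p q) = h p \<otimes>\<^bsub>G\<^esub> h q" for p q
  proof -
    have "sg_mult p q = abs_surface_group (rep_surface_group p @ rep_surface_group q)"
      by (simp add: sg_mult_def)
    then show ?thesis
      by (simp add: h_abs va) (simp add: h_def)
  qed
  have "h \<in> hom pi1F G"
    by (auto simp: hom_def pi1F_def h_mult) (simp add: h_def vc)
  moreover have "h (loop s) = f s" for s
    by (simp add: loop_def h_abs f)
  ultimately have ex: "h \<in> hom pi1F G \<and> h (loop Ba) = x \<and> h (loop Bb) = y \<and> h (loop Bc) = z"
    by (simp add: f_def)
  moreover have "g = g'" if g: "g \<in> hom pi1F G" "g (loop Ba) = x" "g (loop Bb) = y" "g (loop Bc) = z"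
    and g': "g' \<in> hom pi1F G" "g' (loop Ba) = x" "g' (loop Bb) = y" "g' (loop Bc) = z" for g g'
  proof -
    interpret g: group_hom pi1F G g by unfold_locales fact
    interpret g': group_hom pi1F G g' by unfold_locales fact
    have UN [simp]: "p \<in> carrier pi1F" for p by (simp add: pi1F_def)
    have "loop Bd = inv\<^bsub>pi1F\<^esub> (loop Ba \<otimes>\<^bsub>pi1F\<^esub> loop Bb \<otimes>\<^bsub>pi1F\<^esub> loop Bc)"
      using loop_relation by (metis P.inv_equality P.inv_inv UN P.inv_unique' )
    then have eq: "g (loop s) = g' (loop s)" for s
      using g g' by (cases s) (simp_all add: g.hom_inv g'.hom_inv g.hom_mult g'.hom_mult)
    have inv_loop: "abs_surface_group [(s, False)] = inv\<^bsub>pi1F\<^esub> (loop s)" for s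
    proof (rule P.inv_equality[symmetric])
      show "abs_surface_group [(s, False)] \<otimes>\<^bsub>pi1F\<^esub> loop s = \<one>\<^bsub>pi1F\<^esub>"
        using word_eq.cancel[of "[]" s False "[]"]
        by (simp add: pi1F_def loop_def sg_mult.abs_eq sg_one_def surface_group.abs_eq_iff)
    qed auto
    have "g (abs_surface_group w) = g' (abs_surface_group w)" for w
    proof (induction w)
      case Nil
      have "abs_surface_group [] = \<one>\<^bsub>pi1F\<^esub>" by (simp add: pi1F_def sg_one_def)
      then show ?case by (simp add: g.hom_one g'.hom_one)
    next
      case (Cons a w)
      obtain s b where a: "a = (s, b)" by force
      have l: "g (abs_surface_group [a]) = g' (abs_surface_group [a])"
        using eq[of s] a
        by (cases b) (simp_all add: inv_loop g.hom_inv g'.hom_inv loop_def[symmetric] loop.abs_eq[symmetric])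
      have "abs_surface_group (a # w) = abs_surface_group [a] \<otimes>\<^bsub>pi1F\<^esub> abs_surface_group w"
        by (simp add: pi1F_def sg_mult.abs_eq)
      then show ?case
        using l Cons by (simp add: g.hom_mult g'.hom_mult)
    qed
    then show ?thesis
      by (metis Quotient3_abs_rep Quotient3_surface_group ext)
  qed
  ultimately show ?thesis by blast
qed

lemma hom_of_props:
  assumes "group G" "x \<in> carrier G" "y \<in> carrier G" "z \<in> carrier G"
  shows "hom_of G x y z \<in> hom pi1F G"
    and "hom_of G x y z (loop Ba) = x"
    and "hom_of G x y z (loop Bb) = y"
    and "hom_of G x y z (loop Bc) = z"
  using theI'[OF hom_of_ex1[OF assms]] unfolding hom_of_def by auto

definition half_twist1 :: "surface_group \<Rightarrow> surface_group" where
  "half_twist1 = hom_of pi1F (loop Ba) (loop Bb) (loop Bd)"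

definition half_twist2 :: "surface_group \<Rightarrow> surface_group" where
  "half_twist2 = hom_of pi1F (loop Ba) (loop Bc \<otimes>\<^bsub>pi1F\<^esub> loop Bd \<otimes>\<^bsub>pi1F\<^esub> inv\<^bsub>pi1F\<^esub> loop Bc) (loop Bc)"


section \<open>The traceless character variety\<close>

definition traceless_homs :: "(surface_group \<Rightarrow> quat) set" where
  "traceless_homs = {\<rho> \<in> hom pi1F SU2. \<forall>s. \<rho> (loop s) \<in> J}"

definition conj_class :: "(surface_group \<Rightarrow> quat) \<Rightarrow> (surface_group \<Rightarrow> quat) set" where
  "conj_class \<rho> = {(\<lambda>\<gamma>. g * \<rho> \<gamma> * inverse g) |g. g \<in> carrier SU2}"

definition chi :: "(surface_group \<Rightarrow> quat) set set" where
  "chi = conj_class ` traceless_homs"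

text \<open>The quotient topology; \<open>traceless_homs\<close> carries the topology of pointwise convergence,
  and \<open>\<Union>U\<close> is the preimage of \<open>U\<close>.\<close>

definition chi_top :: "(surface_group \<Rightarrow> quat) set topology" where
  "chi_top = topology (\<lambda>U. U \<subseteq> chi \<and> openin (top_of_set traceless_homs) (\<Union>U))"

definition pullback :: "(surface_group \<Rightarrow> surface_group)
    \<Rightarrow> (surface_group \<Rightarrow> quat) set \<Rightarrow> (surface_group \<Rightarrow> quat) set" where
  "pullback h = restrict (\<lambda>X. (\<lambda>\<rho>. \<rho> \<circ> h) ` X) chi"

text \<open>The top stratum of the stratification by orbit type: the stabilizer of \<open>\<rho>\<close> under conjugation
  is the centre of \<open>SU(2)\<close>, equivalently, the image of \<open>\<rho>\<close> is not abelian.\<close>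

definition traceless_homs_star :: "(surface_group \<Rightarrow> quat) set" where
  "traceless_homs_star = {\<rho> \<in> traceless_homs.
     {g \<in> carrier SU2. \<forall>\<gamma>. g * \<rho> \<gamma> * inverse g = \<rho> \<gamma>} = {1, -1}}"


section \<open>Twisted cohomology and the Atiyah-Bott-Goldman form\<close>

text \<open>
  \<open>F\<close> is aspherical and its boundary circles represent elements of infinite order, so the
  cohomology of \<open>(F, \<partial>F)\<close> with coefficients in \<open>su(2)\<^sub>a\<^sub>d\<^sub>\<rho>\<close> is that of the group \<open>\<pi>\<^sub>1(F)\<close> relative
  to the cyclic subgroups generated by \<open>a\<close>, \<open>b\<close>, \<open>c\<close>, \<open>d\<close>. Absolute cochains are
  inhomogeneous group cochains; relative cochains are those of the mapping cone of restriction: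
  \<open>C\<^sup>n(F, \<partial>F) = C\<^sup>n(\<pi>\<^sub>1) \<oplus> (\<Oplus>\<^sub>s C\<^sup>n\<^sup>-\<^sup>1(\<langle>s\<rangle>))\<close> with \<open>\<delta>(z, v) = (\<delta>z, z| - \<delta>v)\<close>.
\<close>

definition Ad :: "(surface_group \<Rightarrow> quat) \<Rightarrow> surface_group \<Rightarrow> quat \<Rightarrow> quat" where
  "Ad \<rho> \<gamma> v = \<rho> \<gamma> * v * inverse (\<rho> \<gamma>)"

definition cobdry0 :: "(surface_group \<Rightarrow> quat) \<Rightarrow> quat \<Rightarrow> surface_group \<Rightarrow> quat" where
  "cobdry0 \<rho> v \<gamma> = Ad \<rho> \<gamma> v - v"

definition cobdry1 ::
    "(surface_group \<Rightarrow> quat) \<Rightarrow> (surface_group \<Rightarrow> quat) \<Rightarrow> surface_group \<Rightarrow> surface_group \<Rightarrow> quat" where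
  "cobdry1 \<rho> z \<gamma> \<mu> = Ad \<rho> \<gamma> (z \<mu>) - z (\<gamma> \<otimes>\<^bsub>pi1F\<^esub> \<mu>) + z \<gamma>"

definition Z1 :: "(surface_group \<Rightarrow> quat) \<Rightarrow> (surface_group \<Rightarrow> quat) set" where
  "Z1 \<rho> = {z. range z \<subseteq> su2 \<and> (\<forall>\<gamma> \<mu>. cobdry1 \<rho> z \<gamma> \<mu> = 0)}"

definition cohomologous :: "(surface_group \<Rightarrow> quat) \<Rightarrow> (surface_group \<Rightarrow> quat) rel" where
  "cohomologous \<rho> = {(z, z'). z \<in> Z1 \<rho> \<and> z' \<in> Z1 \<rho> \<and>
     (\<exists>u\<in>su2. \<forall>\<gamma>. z' \<gamma> - z \<gamma> = cobdry0 \<rho> u \<gamma>)}"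

definition H1 :: "(surface_group \<Rightarrow> quat) \<Rightarrow> (surface_group \<Rightarrow> quat) set set" where
  "H1 \<rho> = Z1 \<rho> // cohomologous \<rho>"

definition H1_class ::
    "(surface_group \<Rightarrow> quat) \<Rightarrow> (surface_group \<Rightarrow> quat) \<Rightarrow> (surface_group \<Rightarrow> quat) set" where
  "H1_class \<rho> z = cohomologous \<rho> `` {z}"

type_synonym rel_cochain = "(surface_group \<Rightarrow> quat) \<times> (bdry \<Rightarrow> quat)"

definition Z1_rel :: "(surface_group \<Rightarrow> quat) \<Rightarrow> rel_cochain set" where
  "Z1_rel \<rho> = {(z, v). z \<in> Z1 \<rho> \<and>
     (\<forall>s. v s \<in> su2 \<and> (\<forall>\<gamma> \<in> generate pi1F {loop s}. z \<gamma> = cobdry0 \<rho> (v s) \<gamma>))}"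

definition cohomologous_rel :: "(surface_group \<Rightarrow> quat) \<Rightarrow> rel_cochain rel" where
  "cohomologous_rel \<rho> = {((z, v), (z', v')). (z, v) \<in> Z1_rel \<rho> \<and> (z', v') \<in> Z1_rel \<rho> \<and>
     (\<exists>u\<in>su2. (\<forall>\<gamma>. z' \<gamma> - z \<gamma> = cobdry0 \<rho> u \<gamma>) \<and> (\<forall>s. v' s - v s = u))}"

definition H1_rel :: "(surface_group \<Rightarrow> quat) \<Rightarrow> rel_cochain set set" where
  "H1_rel \<rho> = Z1_rel \<rho> // cohomologous_rel \<rho>"

text \<open>The natural map \<open>H\<^sup>1(F, \<partial>F) \<rightarrow> H\<^sup>1(F)\<close>; all sets in the union are equal.\<close>

definition rel_to_abs ::
    "(surface_group \<Rightarrow> quat) \<Rightarrow> rel_cochain set \<Rightarrow> (surface_group \<Rightarrow> quat) set" where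
  "rel_to_abs \<rho> X = (\<Union>(z, v)\<in>X. H1_class \<rho> z)"

definition H1_hat :: "(surface_group \<Rightarrow> quat) \<Rightarrow> (surface_group \<Rightarrow> quat) set set" where
  "H1_hat \<rho> = rel_to_abs \<rho> ` H1_rel \<rho>"

definition cup :: "(surface_group \<Rightarrow> quat) \<Rightarrow> (surface_group \<Rightarrow> quat) \<Rightarrow> (surface_group \<Rightarrow> quat)
    \<Rightarrow> surface_group \<times> surface_group \<Rightarrow> real" where
  "cup \<rho> z w = (\<lambda>(\<gamma>, \<mu>). su2_pair (z \<gamma>) (Ad \<rho> \<gamma> (w \<mu>)))"

text \<open>
  With \<open>\<partial>[\<gamma>|\<mu>] = [\<mu>] - [\<gamma>\<mu>] + [\<gamma>]\<close>, the chain \<open>e = [a|b] + [ab|c] + [abc|d] + [1|1]\<close> has boundary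
  \<open>[a] + [b] + [c] + [d]\<close>, because \<open>abcd = 1\<close>; so \<open>(e, [a], [b], [c], [d])\<close> represents \<open>[F, \<partial>F]\<close>.
\<close>

definition fundamental_chain :: "(surface_group \<times> surface_group) list" where
  "fundamental_chain =
     [(loop Ba, loop Bb),
      (loop Ba \<otimes>\<^bsub>pi1F\<^esub> loop Bb, loop Bc),
      (loop Ba \<otimes>\<^bsub>pi1F\<^esub> loop Bb \<otimes>\<^bsub>pi1F\<^esub> loop Bc, loop Bd),
      (\<one>\<^bsub>pi1F\<^esub>, \<one>\<^bsub>pi1F\<^esub>)]"

text \<open>
  The cup product of relative cochains is \<open>(z, v) \<union> (w, v') = (z \<union> w, v \<union> w|)\<close>, where
  \<open>(v \<union> w|)(\<gamma>) = {v, w(\<gamma>)}\<close>. The minus sign makes evaluation on the fundamental cycle vanish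
  on coboundaries \<open>(\<delta>x, x| - \<delta>y)\<close>.
\<close>

definition rel_form :: "(surface_group \<Rightarrow> quat) \<Rightarrow> rel_cochain \<Rightarrow> rel_cochain \<Rightarrow> real" where
  "rel_form \<rho> = (\<lambda>(z, v) (w, v').
     (\<Sum>x\<leftarrow>fundamental_chain. cup \<rho> z w x) - (\<Sum>s\<in>UNIV. su2_pair (v s) (w (loop s))))"

definition omega_hat :: "(surface_group \<Rightarrow> quat) \<Rightarrow> (surface_group \<Rightarrow> quat) set
    \<Rightarrow> (surface_group \<Rightarrow> quat) set \<Rightarrow> real" where
  "omega_hat \<rho> X Y = (THE r. \<forall>X'\<in>H1_rel \<rho>. \<forall>Y'\<in>H1_rel \<rho>.
     rel_to_abs \<rho> X' = X \<and> rel_to_abs \<rho> Y' = Y \<longrightarrow> (\<forall>x\<in>X'. \<forall>y\<in>Y'. rel_form \<rho> x y = r))"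


section \<open>Smooth quotients and symplectomorphisms\<close>

fun Ck_on :: "nat \<Rightarrow> 'a set \<Rightarrow> ('a::real_normed_vector \<Rightarrow> 'b::real_normed_vector) \<Rightarrow> bool" where
  "Ck_on 0 U f = continuous_on U f"
| "Ck_on (Suc k) U f \<longleftrightarrow> (\<forall>x\<in>U. f differentiable (at x)) \<and>
     (\<forall>v. Ck_on k U (\<lambda>x. frechet_derivative f (at x) v))"

definition smooth_on :: "'a set \<Rightarrow> ('a::real_normed_vector \<Rightarrow> 'b::real_normed_vector) \<Rightarrow> bool" where
  "smooth_on U f \<longleftrightarrow> (\<forall>k. Ck_on k U f)"

text \<open>
  A manifold presented as the quotient of a submanifold of a Euclidean space (the set of \<open>lifts\<close>,
  embedded by \<open>coords\<close>) by a free action of a compact Lie group. \<open>tangent s\<close> is the tangent space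
  of the quotient at the image of \<open>s\<close>, \<open>velocity R\<close> is the tangent vector at time \<open>0\<close> of the
  projection of the curve \<open>R\<close>, and \<open>form\<close> is a 2-form on the quotient.
\<close>

record ('s, 'm, 'e, 'v) quotient_manifold =
  lifts :: "'s set"
  proj :: "'s \<Rightarrow> 'm"
  coords :: "'s \<Rightarrow> 'e"
  tangent :: "'s \<Rightarrow> 'v set"
  velocity :: "(real \<Rightarrow> 's) \<Rightarrow> 'v"
  form :: "'s \<Rightarrow> 'v \<Rightarrow> 'v \<Rightarrow> real"

definition points :: "('s, 'm, 'e, 'v) quotient_manifold \<Rightarrow> 'm set" where
  "points M = proj M ` lifts M"

text \<open>Smooth maps are those which lift locally to maps that extend smoothly to an open subset of the
  ambient Euclidean space.\<close>

definition smooth_map :: "('s, 'm, 'e::euclidean_space, 'v) quotient_manifold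
    \<Rightarrow> ('s', 'm', 'e'::euclidean_space, 'v') quotient_manifold \<Rightarrow> ('m \<Rightarrow> 'm') \<Rightarrow> bool" where
  "smooth_map M N f \<longleftrightarrow> (\<forall>s\<in>lifts M. \<exists>W h. open W \<and> coords M s \<in> W \<and> smooth_on W h \<and>
     (\<forall>r\<in>lifts M. coords M r \<in> W \<longrightarrow>
        (\<exists>r'\<in>lifts N. coords N r' = h (coords M r) \<and> proj N r' = f (proj M r))))"

definition smooth_curve ::
    "('s, 'm, 'e::euclidean_space, 'v) quotient_manifold \<Rightarrow> (real \<Rightarrow> 's) \<Rightarrow> bool" where
  "smooth_curve M R \<longleftrightarrow> range R \<subseteq> lifts M \<and> smooth_on UNIV (\<lambda>t. coords M (R t))"

text \<open>\<open>L\<close> is the differential of \<open>f\<close> at the image of \<open>s\<close>, with respect to the description of the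
  tangent spaces given by the lifts \<open>s\<close> and \<open>s'\<close> of the point and its image.\<close>

definition is_differential :: "('s, 'm, 'e::euclidean_space, 'v) quotient_manifold
    \<Rightarrow> ('s', 'm', 'e'::euclidean_space, 'v') quotient_manifold
    \<Rightarrow> ('m \<Rightarrow> 'm') \<Rightarrow> 's \<Rightarrow> 's' \<Rightarrow> ('v \<Rightarrow> 'v') \<Rightarrow> bool" where
  "is_differential M N f s s' L \<longleftrightarrow> (\<forall>R. smooth_curve M R \<and> R 0 = s \<longrightarrow>
     (\<exists>R'. smooth_curve N R' \<and> R' 0 = s' \<and> (\<forall>t. proj N (R' t) = f (proj M (R t))) \<and>
        velocity N R' = L (velocity M R)))"

definition symplectomorphism :: "('s, 'm, 'e::euclidean_space, 'v) quotient_manifold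
    \<Rightarrow> ('s', 'm', 'e'::euclidean_space, 'v') quotient_manifold \<Rightarrow> ('m \<Rightarrow> 'm') \<Rightarrow> bool" where
  "symplectomorphism M N f \<longleftrightarrow>
     bij_betw f (points M) (points N) \<and>
     smooth_map M N f \<and> smooth_map N M (inv_into (points M) f) \<and>
     (\<forall>s\<in>lifts M. \<forall>s'\<in>lifts N. proj N s' = f (proj M s) \<longrightarrow>
        (\<exists>L. is_differential M N f s s' L \<and> bij_betw L (tangent M s) (tangent N s') \<and>
           (\<forall>X\<in>tangent M s. \<forall>Y\<in>tangent M s. form N s' (L X) (L Y) = form M s X Y)))"

text \<open>A path \<open>\<rho>\<^sub>t\<close> of representations has velocity \<open>\<gamma> \<mapsto> \<rho>'\<^sub>0(\<gamma>) \<rho>\<^sub>0(\<gamma>)\<^sup>-\<^sup>1\<close> in \<open>H\<^sup>1(F; su(2)\<^sub>a\<^sub>d\<^sub>\<rho>)\<close>.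
  Representations are embedded into a Euclidean space by their values on the free generators.\<close>

definition chi_star :: "(surface_group \<Rightarrow> quat, (surface_group \<Rightarrow> quat) set, quat \<times> quat \<times> quat,
    (surface_group \<Rightarrow> quat) set) quotient_manifold" where
  "chi_star = \<lparr>
     lifts = traceless_homs_star,
     proj = conj_class,
     coords = (\<lambda>\<rho>. (\<rho> (loop Ba), \<rho> (loop Bb), \<rho> (loop Bc))),
     tangent = H1_hat,
     velocity = (\<lambda>R. H1_class (R 0)
       (\<lambda>\<gamma>. vector_derivative (\<lambda>t. R t \<gamma>) (at 0) * inverse (R 0 \<gamma>))),
     form = omega_hat\<rparr>"


section \<open>The pillowcase\<close>

definition torus :: "(complex \<times> complex) set" where
  "torus = {(z, w). norm z = 1 \<and> norm w = 1}"

definition iota :: "complex \<times> complex \<Rightarrow> complex \<times> complex" where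
  "iota = (\<lambda>(z, w). (cnj z, cnj w))"

definition torus_star :: "(complex \<times> complex) set" where
  "torus_star = torus - {1, -1} \<times> {1, -1}"

definition iota_orbit :: "complex \<times> complex \<Rightarrow> (complex \<times> complex) set" where
  "iota_orbit p = {p, iota p}"

text \<open>The pillowcase \<open>\<bbbP>\<^sup>*\<close> with the form \<open>c dx \<and> dy\<close>. Tangent vectors are written in the coordinates
  \<open>(x, y)\<close> of \<open>(e\<^sup>i\<^sup>x, e\<^sup>i\<^sup>y)\<close>: if \<open>z(t) = e\<^sup>i\<^sup>x\<^sup>(\<^sup>t\<^sup>)\<close>, then \<open>x'(0) = Im (z'(0) / z(0))\<close>.\<close>

definition pillowcase_star :: "real \<Rightarrow> (complex \<times> complex, (complex \<times> complex) set,
    complex \<times> complex, real \<times> real) quotient_manifold" where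
  "pillowcase_star c = \<lparr>
     lifts = torus_star,
     proj = iota_orbit,
     coords = (\<lambda>p. p),
     tangent = (\<lambda>p. UNIV),
     velocity = (\<lambda>q.
       (Im (vector_derivative (\<lambda>t. fst (q t)) (at 0) / fst (q 0)),
        Im (vector_derivative (\<lambda>t. snd (q t)) (at 0) / snd (q 0)))),
     form = (\<lambda>p (u1, u2) (v1, v2). c * (u1 * v2 - u2 * v1))\<rparr>"

definition SL2Z :: "(int^2^2) monoid" where
  "SL2Z = \<lparr>carrier = {M. det M = 1}, mult = (**), one = mat 1\<rparr>"

definition PSL2Z :: "(int^2^2) set monoid" where
  "PSL2Z = SL2Z Mod {mat 1, - mat 1}"

definition SL2Z_act :: "int^2^2 \<Rightarrow> complex \<times> complex \<Rightarrow> complex \<times> complex" where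
  "SL2Z_act M = (\<lambda>(z, w). (z powi (M$1$1) * w powi (M$1$2), z powi (M$2$1) * w powi (M$2$2)))"

text \<open>The induced action of a coset \<open>g = {M, -M}\<close> on an orbit \<open>X\<close> of \<open>\<iota>\<close>; the set on the right is
  the orbit of \<open>SL2Z_act M p\<close> for any \<open>p \<in> X\<close>.\<close>

definition PSL2Z_act :: "(int^2^2) set \<Rightarrow> (complex \<times> complex) set \<Rightarrow> (complex \<times> complex) set" where
  "PSL2Z_act g X = {SL2Z_act M p |M p. M \<in> g \<and> p \<in> X}"

definition rho :: "complex \<times> complex \<Rightarrow> surface_group \<Rightarrow> quat" where
  "rho = (\<lambda>(z, w). hom_of SU2 quat_j (quat_of_complex z * quat_j) (quat_of_complex w * quat_j))"

text \<open>The two lifts of a point of the pillowcase give the same conjugacy class.\<close>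

definition rho_hat :: "(complex \<times> complex) set \<Rightarrow> (surface_group \<Rightarrow> quat) set" where
  "rho_hat X = (\<Union>p\<in>X. conj_class (rho p))"

end

theory Submission
  imports Defs
begin

text \<open>
  Tracelessness of the image of \<open>d = (abc)\<^sup>-\<^sup>1\<close> says that the unit vectors \<open>\<rho>(a), \<rho>(b), \<rho>(c)\<close> of \<open>su(2)\<close>
  are coplanar, so that \<open>\<rho>\<close> is determined up to conjugation by the signed angles \<open>x\<close>, \<open>y\<close> from \<open>\<rho>(a)\<close> to
  \<open>\<rho>(b)\<close> and \<open>\<rho>(c)\<close>, up to a common sign; this is the bijection with the pillowcase. Composition with
  the half twists sends the representation with angles \<open>(x, y)\<close> exactly to those with angles
  \<open>(x, y - x)\<close> and \<open>(x + y, y)\<close>, and these two matrices generate \<open>SL(2,\<int>)\<close>.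

  The class of a relative cocycle in \<open>H\<^sup>1(F)\<close> is that of a cocycle \<open>z\<close> with \<open>z(s)\<close> orthogonal to \<open>\<rho>(s)\<close> for each
  boundary loop \<open>s\<close>. Then \<open>Ad \<rho>(s)\<close> negates \<open>z(s)\<close>, a primitive of \<open>z\<close> on \<open>s\<close> is \<open>- z(s) / 2\<close>, and the form
  becomes \<open>\<Sum> z \<union> w + (1/2) \<Sum>\<^sub>s {z(s), w(s)}\<close>. Along the pillowcase the tangent cocycles are multiples
  of \<open>\<i>\<close> on all boundary loops, and the form evaluates to \<open>- (1/2) dx \<and> dy\<close>. The twists preserve it because
  \<open>SL(2,\<int>)\<close> preserves \<open>dx \<and> dy\<close>.
\<close>

section \<open>Calculus of smooth maps\<close>

text \<open>The action is defined on the pillowcase and carried over by \<open>rho_hat\<close>,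
  which makes the group laws and equivariance formal. Continuity, smoothness and the differential
  come from a second description: each matrix \<open>M\<close> is realised by an endomorphism
  \<open>h\<close> of \<open>pi1F\<close> with \<open>rho p \<circ> h = rho (SL2Z_act M p)\<close>.
  This is an equality of representations, not only of classes, so the action is composition with
  \<open>h\<close>, which is polynomial in the values on the generators. Tangent spaces and forms
  must be compared at every lift of a point, hence at all conjugates of \<open>rho p\<close>;
  invariance under conjugation reduces this to \<open>rho p\<close>. No dimension of a cohomology
  group is counted: surjectivity of the differential is an explicit subtraction of coboundaries, and
  injectivity follows from nondegeneracy of the area form. The inverse of \<open>rho_hat\<close> is
  smooth because a conjugation invariant formula recovers the angles. It needs a unit normal to the
  plane of the vectors, hence two charts: one where the image of b, one where that of c, is not
  parallel to that of a.\<close>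

lemma frechet_derivative_eq:
  assumes "(f has_derivative f') (at x)"
  shows "frechet_derivative f (at x) = f'"
  using frechet_derivative_at[OF assms] by simp

declare Ck_on.simps(2) [simp del]

lemma Ck_on_frechet_derivative: "Ck_on (Suc k) U f \<Longrightarrow> Ck_on k U (\<lambda>x. frechet_derivative f (at x) v)"
  by (simp add: Ck_on.simps(2))

lemma Ck_on_SucD:
  assumes "Ck_on (Suc k) U f" "x \<in> U"
  shows "(f has_derivative frechet_derivative f (at x)) (at x)"
  using assms by (simp add: frechet_derivative_works Ck_on.simps(2))

text \<open>The recursion passes to derivatives and records only differentiability at each stage;
  continuity of \<open>f\<close> itself is recovered at the bottom, from differentiability.\<close>

lemma Ck_on_Suc_imp: "Ck_on (Suc k) U f \<Longrightarrow> Ck_on k U f"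
proof (induction k arbitrary: f)
  case 0
  then show ?case
    by (auto simp: Ck_on.simps(2)
        intro!: continuous_at_imp_continuous_on differentiable_imp_continuous_within)
next
  case (Suc k)
  show ?case
    unfolding Ck_on.simps(2)[of k]
    using Suc.prems Suc.IH Ck_on_frechet_derivative unfolding Ck_on.simps(2)[of "Suc k" U f] by blast
qed

lemma Ck_on_cong:
  assumes "open U" "\<And>x. x \<in> U \<Longrightarrow> f x = g x" "Ck_on k U f"
  shows "Ck_on k U g"
  using assms(2,3)
proof (induction k arbitrary: f g)
  case 0
  then show ?case using continuous_on_cong by (metis Ck_on.simps(1))
next
  case (Suc k)
  have d: "(g has_derivative frechet_derivative f (at x)) (at x)" if "x \<in> U" for x
  proof (rule has_derivative_transform_within_open[OF _ assms(1) that])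
    show "(f has_derivative frechet_derivative f (at x)) (at x)"
      by (rule Ck_on_SucD[OF Suc.prems(2) that])
  qed (use Suc.prems in auto)
  have "Ck_on k U (\<lambda>x. frechet_derivative g (at x) v)" for v
  proof (rule Suc.IH)
    show "Ck_on k U (\<lambda>x. frechet_derivative f (at x) v)"
      by (rule Ck_on_frechet_derivative[OF Suc.prems(2)])
  qed (simp add: frechet_derivative_eq[OF d])
  with d show ?case
    by (auto simp: differentiable_def Ck_on.simps(2))
qed

text \<open>In inductions on \<open>k\<close> this allows any closed formula for the derivative in
  place of \<open>frechet_derivative\<close>, which is given by a choice operator.\<close>

lemma Ck_on_SucI:
  assumes "open U" "\<And>x. x \<in> U \<Longrightarrow> (f has_derivative f' x) (at x)"
    "\<And>v. Ck_on k U (\<lambda>x. f' x v)"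
  shows "Ck_on (Suc k) U f"
proof -
  have "Ck_on k U (\<lambda>x. frechet_derivative f (at x) v)" for v
    by (rule Ck_on_cong[OF assms(1) _ assms(3)]) (simp add: frechet_derivative_eq[OF assms(2)])
  with assms(2) show ?thesis
    by (auto simp: differentiable_def Ck_on.simps(2))
qed

section \<open>Closure properties of C^k and smooth maps\<close>

lemma Ck_on_const [intro!]: "open U \<Longrightarrow> Ck_on k U (\<lambda>x. c)"
  by (induction k arbitrary: c) (auto intro!: Ck_on_SucI[where f' = "\<lambda>x v. 0"])

lemma Ck_on_linear_compose:
  assumes "bounded_linear T" "open U" "Ck_on k U f"
  shows "Ck_on k U (\<lambda>x. T (f x))"
  using assms(3)
proof (induction k arbitrary: f)
  case 0
  then show ?case
    by (auto intro: bounded_linear.continuous_on[OF assms(1)])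
next
  case (Suc k)
  show ?case
  proof (rule Ck_on_SucI[OF assms(2)])
    show "((\<lambda>x. T (f x)) has_derivative (\<lambda>v. T (frechet_derivative f (at x) v))) (at x)" if "x \<in> U" for x
      by (rule bounded_linear.has_derivative[OF assms(1) Ck_on_SucD[OF Suc.prems that]])
    show "Ck_on k U (\<lambda>x. T (frechet_derivative f (at x) v))" for v
      by (rule Suc.IH[OF Ck_on_frechet_derivative[OF Suc.prems]])
  qed
qed

lemma Ck_on_id: "open U \<Longrightarrow> Ck_on k U (\<lambda>x. x)"
  by (cases k) (auto intro!: Ck_on_SucI[where f' = "\<lambda>x v. v"])

lemma Ck_on_add:
  assumes "open U" "Ck_on k U f" "Ck_on k U g"
  shows "Ck_on k U (\<lambda>x. f x + g x)"
  using assms(2,3)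
proof (induction k arbitrary: f g)
  case 0
  then show ?case by (auto intro: continuous_on_add)
next
  case (Suc k)
  show ?case
    by (rule Ck_on_SucI[OF assms(1) has_derivative_add[OF Ck_on_SucD[OF Suc.prems(1)] Ck_on_SucD[OF Suc.prems(2)]]])
       (use Suc in \<open>auto intro: Ck_on_frechet_derivative\<close>)
qed

lemma Ck_on_bilinear:
  assumes "bounded_bilinear B" "open U" "Ck_on k U f" "Ck_on k U g"
  shows "Ck_on k U (\<lambda>x. B (f x) (g x))"
  using assms(3,4)
proof (induction k arbitrary: f g)
  case 0
  then show ?case by (auto intro: bounded_bilinear.continuous_on[OF assms(1)])
next
  case (Suc k)
  show ?case
  proof (rule Ck_on_SucI[OF assms(2) bounded_bilinear.FDERIV[OF assms(1) Ck_on_SucD[OF Suc.prems(1)] Ck_on_SucD[OF Suc.prems(2)]]])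
    fix v
    show "Ck_on k U (\<lambda>x. B (f x) (frechet_derivative g (at x) v) + B (frechet_derivative f (at x) v) (g x))"
      using Suc.prems
      by (intro Ck_on_add assms(2) Suc.IH Ck_on_Suc_imp[of k U f] Ck_on_Suc_imp[of k U g]
          Ck_on_frechet_derivative)
  qed auto
qed

lemma Ck_on_sum:
  assumes "open U" "\<And>i. i \<in> I \<Longrightarrow> Ck_on k U (f i)"
  shows "Ck_on k U (\<lambda>x. \<Sum>i\<in>I. f i x)"
  using assms(2)
  by (induction I rule: infinite_finite_induct) (auto intro!: Ck_on_add assms(1) Ck_on_const)

text \<open>\<open>Ck_on\<close> controls derivatives in fixed directions, whereas the chain rule
  evaluates the derivative of \<open>f\<close> in a direction that moves with the point. Expanding
  this direction in \<open>Basis\<close> leaves fixed directions with C^k coefficients, which is why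
  the middle space is Euclidean.\<close>

lemma Ck_on_compose:
  fixes g :: "'a::real_normed_vector \<Rightarrow> 'b::euclidean_space"
    and f :: "'b \<Rightarrow> 'c::real_normed_vector"
  assumes "open U" "open V" "g ` U \<subseteq> V" "Ck_on k V f" "Ck_on k U g"
  shows "Ck_on k U (\<lambda>x. f (g x))"
  using assms(4,5)
proof (induction k arbitrary: f)
  case 0
  then show ?case using assms(3) by (auto intro: continuous_on_compose2)
next
  case (Suc k)
  let ?D = "\<lambda>x v. \<Sum>b\<in>Basis. (frechet_derivative g (at x) v \<bullet> b) *\<^sub>R frechet_derivative f (at (g x)) b"
  show ?case
  proof (rule Ck_on_SucI[OF assms(1)])
    fix x assume x: "x \<in> U"
    have df: "(f has_derivative frechet_derivative f (at (g x))) (at (g x))"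
      by (rule Ck_on_SucD[OF Suc.prems(1)]) (use x assms(3) in auto)
    have *: "frechet_derivative f (at (g x)) w = (\<Sum>b\<in>Basis. (w \<bullet> b) *\<^sub>R frechet_derivative f (at (g x)) b)" for w
    proof -
      interpret bounded_linear "frechet_derivative f (at (g x))"
        by (rule has_derivative_bounded_linear[OF df])
      show ?thesis
        by (subst euclidean_representation[of w, symmetric]) (simp add: sum scaleR)
    qed
    have "((\<lambda>x. f (g x)) has_derivative
        (\<lambda>v. frechet_derivative f (at (g x)) (frechet_derivative g (at x) v))) (at x)"
      using diff_chain_at[OF Ck_on_SucD[OF Suc.prems(2) x] df] by (simp add: o_def)
    also have "(\<lambda>v. frechet_derivative f (at (g x)) (frechet_derivative g (at x) v)) = ?D x"
      by (rule ext) (rule *)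
    finally show "((\<lambda>x. f (g x)) has_derivative ?D x) (at x)" .
  next
    fix v
    have g: "Ck_on k U g" by (rule Ck_on_Suc_imp[OF Suc.prems(2)])
    show "Ck_on k U (\<lambda>x. ?D x v)"
      using Suc.prems
      by (intro Ck_on_sum Ck_on_bilinear[OF bounded_bilinear_scaleR] assms(1) Suc.IH[OF _ g]
          Ck_on_linear_compose[OF bounded_linear_inner_left] Ck_on_frechet_derivative)
  qed
qed

text \<open>Differentiation lowers the exponent by one, so the induction treats all real exponents
  at once. The exponents 1/2 and -1/2 occur in \<open>angle_chart\<close>.\<close>

lemma Ck_on_powr: "Ck_on k {0<..} (\<lambda>x::real. x powr a)"
proof (induction k arbitrary: a)
  case 0
  then show ?case by (auto intro!: continuous_intros)
next
  case (Suc k)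
  show ?case
  proof (rule Ck_on_SucI)
    fix x :: real assume "x \<in> {0<..}"
    then show "((\<lambda>x. x powr a) has_derivative (\<lambda>v. (a * x powr (a - 1)) * v)) (at x)"
      using has_real_derivative_powr[of x a] by (simp add: has_field_derivative_def)
  next
    fix v
    have "Ck_on k {0<..} (\<lambda>x. (v * a) *\<^sub>R x powr (a - 1))"
      by (rule Ck_on_linear_compose[OF bounded_linear_scaleR_right _ Suc]) auto
    then show "Ck_on k {0<..} (\<lambda>x. (a * x powr (a - 1)) * v)"
      by (simp add: mult_ac)
  qed auto
qed

lemma smooth_on_const [intro!]: "open U \<Longrightarrow> smooth_on U (\<lambda>x. c)"
  and smooth_on_id [intro!]: "open U \<Longrightarrow> smooth_on U (\<lambda>x. x)"
  and smooth_on_linear: "bounded_linear T \<Longrightarrow> open U \<Longrightarrow> smooth_on U f \<Longrightarrow> smooth_on U (\<lambda>x. T (f x))"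
  and smooth_on_bilinear: "bounded_bilinear B \<Longrightarrow> open U \<Longrightarrow> smooth_on U f \<Longrightarrow> smooth_on U h
    \<Longrightarrow> smooth_on U (\<lambda>x. B (f x) (h x))"
  and smooth_on_add: "open U \<Longrightarrow> smooth_on U f \<Longrightarrow> smooth_on U g \<Longrightarrow> smooth_on U (\<lambda>x. f x + g x)"
  by (auto simp: smooth_on_def intro: Ck_on_const Ck_on_id Ck_on_linear_compose Ck_on_bilinear Ck_on_add)

lemma smooth_on_compose:
  fixes g :: "'a::real_normed_vector \<Rightarrow> 'b::euclidean_space"
  assumes "open U" "open V" "g ` U \<subseteq> V" "smooth_on V f" "smooth_on U g"
  shows "smooth_on U (\<lambda>x. f (g x))"
  using assms Ck_on_compose unfolding smooth_on_def by blast

lemma smooth_on_powr: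
  assumes "open U" "smooth_on U f" "\<And>x. x \<in> U \<Longrightarrow> f x > (0::real)"
  shows "smooth_on U (\<lambda>x. f x powr a)"
  by (rule smooth_on_compose[OF assms(1) _ _ _ assms(2), of "{0<..}"])
     (use assms(3) Ck_on_powr in \<open>auto simp: smooth_on_def\<close>)

lemmas smooth_on_mult = smooth_on_bilinear[OF bounded_bilinear_mult]

lemma smooth_on_diff:
  assumes "open U" "smooth_on U f" "smooth_on U g"
  shows "smooth_on U (\<lambda>x. f x - g x)"
  using smooth_on_add[OF assms(1,2) smooth_on_linear[OF bounded_linear_minus[OF bounded_linear_ident] assms(1,3)]]
  by simp

lemma smooth_on_Pair:
  assumes "open U" "smooth_on U f" "smooth_on U g"
  shows "smooth_on U (\<lambda>x. (f x, g x))"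
proof -
  have l: "bounded_linear (\<lambda>y::'b. (y, 0::'c))" and r: "bounded_linear (\<lambda>y::'c. (0::'b, y))"
    by (intro bounded_linear_Pair bounded_linear_ident bounded_linear_zero)+
  show ?thesis
    using smooth_on_add[OF assms(1) smooth_on_linear[OF l assms(1,2)] smooth_on_linear[OF r assms(1,3)]]
    by simp
qed

lemma smooth_on_fst: "open U \<Longrightarrow> smooth_on U f \<Longrightarrow> smooth_on U (\<lambda>x. fst (f x))"
  and smooth_on_snd: "open U \<Longrightarrow> smooth_on U f \<Longrightarrow> smooth_on U (\<lambda>x. snd (f x))"
  by (auto intro: smooth_on_linear[OF bounded_linear_fst] smooth_on_linear[OF bounded_linear_snd])

lemma smooth_on_differentiable: "smooth_on U f \<Longrightarrow> x \<in> U \<Longrightarrow> f differentiable at x"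
  unfolding smooth_on_def by (metis Ck_on.simps(2))

lemma smooth_on_continuous_on: "smooth_on U f \<Longrightarrow> continuous_on U f"
  unfolding smooth_on_def by (metis Ck_on.simps(1))

section \<open>Generators of the modular group\<close>

text \<open>Euclid's algorithm on the first column \<open>(p, q)\<close>. The row hypotheses are
  equivalences, so each operation can also be undone and both signs of a step are available.\<close>

lemma SL2_int_induct [consumes 1, case_names one row1 row2]:
  fixes p q r s :: int and P :: "int \<Rightarrow> int \<Rightarrow> int \<Rightarrow> int \<Rightarrow> bool"
  assumes det: "p * s - q * r = 1"
    and one: "P 1 0 0 1"
    and row1: "\<And>p q r s. P p q r s \<longleftrightarrow> P (p + q) q (r + s) s"
    and row2: "\<And>p q r s. P p q r s \<longleftrightarrow> P p (q - p) r (s - r)"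
  shows "P p q r s"
proof -
  have unipotent_nat: "P 1 0 (int n) 1" for n
    using one row1[of 1 0 "int k" 1 for k] by (induction n) (simp_all add: add.commute)
  have unipotent: "P 1 0 r 1" for r
  proof (cases "r \<ge> 0")
    case True
    then show ?thesis using unipotent_nat[of "nat r"] by simp
  next
    case False
    have "P 1 0 (- int n) 1" for n
    proof (induction n)
      case 0
      show ?case using one by simp
    next
      case (Suc n)
      then show ?case using row1[of 1 0 "- int (Suc n)" 1] by simp
    qed
    from this[of "nat (- r)"] False show ?thesis by simp
  qed
  have col10: "P 1 0 r s" if "s = 1" for r s
    using that unipotent by simp
  \<comment> \<open>The row operations 2, 1, 1, 2 turn the first column \<open>(- 1, 0)\<close> into
    \<open>(1, 0)\<close>.\<close>
  have neg: "P (- 1) 0 r s" if "s = - 1" for r s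
  proof -
    have "P (- 1) 0 r s \<longleftrightarrow> P (- 1) 1 r (s - r)"
      using row2[of "- 1" 0 r s] by simp
    also have "\<dots> \<longleftrightarrow> P 0 1 s (s - r)"
      using row1[of "- 1" 1 r "s - r"] by simp
    also have "\<dots> \<longleftrightarrow> P 1 1 (s + (s - r)) (s - r)"
      using row1[of 0 1 s "s - r"] by simp
    also have "\<dots> \<longleftrightarrow> P 1 0 (s + (s - r)) (- s)"
      using row2[of 1 1 "s + (s - r)" "s - r"] by (simp add: algebra_simps)
    finally show ?thesis using that unipotent by simp
  qed
  have zero2: "P p 0 r s" if "p * s = 1" for p r s
  proof -
    from that have "p = 1 \<and> s = 1 \<or> p = - 1 \<and> s = - 1"
      by (simp add: zmult_eq_1_iff)
    then show ?thesis using col10 neg by auto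
  qed
  \<comment> \<open>Adding or subtracting, according to the signs, the entry of smaller absolute
    value decreases the measure. If \<open>p = 0\<close>, two operations move \<open>q\<close> to
    the top instead.\<close>
  from det show ?thesis
  proof (induction "nat (\<bar>p\<bar> + \<bar>q\<bar>)" arbitrary: p q r s rule: less_induct)
    case less
    consider "q = 0" | "p = 0" "q \<noteq> 0" | "p \<noteq> 0" "q \<noteq> 0" by blast
    then show ?case
    proof cases
      case 1
      then show ?thesis using less.prems zero2 by simp
    next
      case 2
      have "P p q r s \<longleftrightarrow> P q 0 (r + s) (- r)"
        using row1[of p q r s] row2[of "p + q" q "r + s" s] 2 by (simp add: algebra_simps)
      moreover have "q * (- r) = 1" using less.prems 2 by simp
      ultimately show ?thesis using zero2 by blast
    next
      case 3
      show ?thesis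
      proof (cases "\<bar>p\<bar> \<ge> \<bar>q\<bar>")
        case True
        show ?thesis
        proof (cases "sgn p = sgn q")
          case True
          then have "nat (\<bar>p - q\<bar> + \<bar>q\<bar>) < nat (\<bar>p\<bar> + \<bar>q\<bar>)"
            using 3 \<open>\<bar>p\<bar> \<ge> \<bar>q\<bar>\<close> by (auto simp: sgn_if split: if_splits)
          moreover have "(p - q) * s - q * (r - s) = 1"
            using less.prems by (simp add: algebra_simps)
          ultimately have "P (p - q) q (r - s) s" by (rule less.hyps)
          then show ?thesis using row1[of "p - q" q "r - s" s] by simp
        next
          case False
          then have "nat (\<bar>p + q\<bar> + \<bar>q\<bar>) < nat (\<bar>p\<bar> + \<bar>q\<bar>)"
            using 3 \<open>\<bar>p\<bar> \<ge> \<bar>q\<bar>\<close> by (auto simp: sgn_if split: if_splits)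
          moreover have "(p + q) * s - q * (r + s) = 1"
            using less.prems by (simp add: algebra_simps)
          ultimately have "P (p + q) q (r + s) s" by (rule less.hyps)
          then show ?thesis using row1[of p q r s] by simp
        qed
      next
        case le: False
        show ?thesis
        proof (cases "sgn p = sgn q")
          case True
          then have "nat (\<bar>p\<bar> + \<bar>q - p\<bar>) < nat (\<bar>p\<bar> + \<bar>q\<bar>)"
            using 3 le by (auto simp: sgn_if split: if_splits)
          moreover have "p * (s - r) - (q - p) * r = 1"
            using less.prems by (simp add: algebra_simps)
          ultimately have "P p (q - p) r (s - r)" by (rule less.hyps)
          then show ?thesis using row2[of p q r s] by simp
        next
          case False
          then have "nat (\<bar>p\<bar> + \<bar>q + p\<bar>) < nat (\<bar>p\<bar> + \<bar>q\<bar>)"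
            using 3 le by (auto simp: sgn_if split: if_splits)
          moreover have "p * (s + r) - (q + p) * r = 1"
            using less.prems by (simp add: algebra_simps)
          ultimately have "P p (q + p) r (s + r)" by (rule less.hyps)
          then show ?thesis using row2[of p "q + p" r "s + r"] by simp
        qed
      qed
    qed
  qed
qed

text \<open>As in the action on the pillowcase, \<open>p, q\<close> is the first column.\<close>

definition mat2 :: "int \<Rightarrow> int \<Rightarrow> int \<Rightarrow> int \<Rightarrow> int^2^2" where
  "mat2 p q r s = vector [vector [p, r], vector [q, s]]"

lemma mat2_sel [simp]:
  "mat2 p q r s $ 1 $ 1 = p" "mat2 p q r s $ 2 $ 1 = q"
  "mat2 p q r s $ 1 $ 2 = r" "mat2 p q r s $ 2 $ 2 = s"
  by (simp_all add: mat2_def)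

lemma mat2_eq_iff:
  "M = N \<longleftrightarrow> M$1$1 = N$1$1 \<and> M$1$2 = N$1$2 \<and> M$2$1 = N$2$1 \<and> M$2$2 = (N$2$2 :: int)"
  for M N :: "int^2^2"
  by (auto simp: vec_eq_iff forall_2)

lemma mat2_mult_sel [simp]:
  "(M ** N) $ i $ j = M$i$1 * N$1$j + M$i$2 * (N$2$j :: int)" for M N :: "int^2^2"
  by (simp add: matrix_matrix_mult_def sum_2)

lemma mat_1_sel [simp]: "(mat 1 :: int^2^2) $ i $ j = (if i = j then 1 else 0)"
  by (simp add: mat_def)

lemma SL2Z_carrier: "M \<in> carrier SL2Z \<longleftrightarrow> M$1$1 * M$2$2 - M$2$1 * M$1$2 = 1"
  by (simp add: SL2Z_def det_2 mult.commute)

lemma SL2Z_simps [simp]: "M \<otimes>\<^bsub>SL2Z\<^esub> N = M ** N" "\<one>\<^bsub>SL2Z\<^esub> = mat 1"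
  by (simp_all add: SL2Z_def)

definition mat2_adj :: "int^2^2 \<Rightarrow> int^2^2" where
  "mat2_adj M = mat2 (M$2$2) (- (M$2$1)) (- (M$1$2)) (M$1$1)"

lemma mat2_adj:
  assumes "M \<in> carrier SL2Z"
  shows "mat2_adj M \<in> carrier SL2Z" "mat2_adj M ** M = mat 1" "M ** mat2_adj M = mat 1"
  using assms by (auto simp: SL2Z_carrier mat2_adj_def mat2_eq_iff algebra_simps)

lemma group_SL2Z: "group SL2Z"
proof (rule groupI)
  fix x y assume "x \<in> carrier SL2Z" "y \<in> carrier SL2Z"
  then show "x \<otimes>\<^bsub>SL2Z\<^esub> y \<in> carrier SL2Z"
    by (simp add: SL2Z_def det_mul)
next
  fix x assume "x \<in> carrier SL2Z"
  then show "\<exists>y\<in>carrier SL2Z. y \<otimes>\<^bsub>SL2Z\<^esub> x = \<one>\<^bsub>SL2Z\<^esub>"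
    using mat2_adj by auto
qed (auto simp: matrix_mul_assoc SL2Z_carrier)

lemma inv_SL2Z: "M \<in> carrier SL2Z \<Longrightarrow> inv\<^bsub>SL2Z\<^esub> M = mat2_adj M"
  using group.inv_equality[OF group_SL2Z, of "mat2_adj M" M] mat2_adj by simp

definition SL2Z_gen1 :: "int^2^2" where "SL2Z_gen1 = mat2 1 (- 1) 0 1"
definition SL2Z_gen2 :: "int^2^2" where "SL2Z_gen2 = mat2 1 0 1 1"

lemma SL2Z_gens: "{SL2Z_gen1, SL2Z_gen2} \<subseteq> carrier SL2Z"
  by (auto simp: SL2Z_carrier SL2Z_gen1_def SL2Z_gen2_def)

text \<open>Left multiplication by \<open>SL2Z_gen2\<close> adds the second row to the first, and by
  \<open>SL2Z_gen1\<close> subtracts the first from the second. These are the operations of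
  \<open>SL2_int_induct\<close>, applied to membership in the generated subgroup.\<close>

lemma SL2Z_generated: "generate SL2Z {SL2Z_gen1, SL2Z_gen2} = carrier SL2Z"
proof
  interpret group SL2Z by (rule group_SL2Z)
  let ?G = "generate SL2Z {SL2Z_gen1, SL2Z_gen2}"
  show "?G \<subseteq> carrier SL2Z" by (rule generate_incl[OF SL2Z_gens])
  have mult: "M \<in> ?G \<longleftrightarrow> g ** M \<in> ?G"
    if g: "g \<in> {SL2Z_gen1, SL2Z_gen2}" for g M
  proof
    assume "M \<in> ?G"
    then show "g ** M \<in> ?G" using generate.eng[where G = SL2Z, OF generate.incl[OF g], of M] by simp
  next
    assume "g ** M \<in> ?G"
    then have "inv\<^bsub>SL2Z\<^esub> g ** (g ** M) \<in> ?G" using generate.eng[where G = SL2Z, OF generate.inv[OF g]] by simp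
    moreover have "g \<in> carrier SL2Z" using g SL2Z_gens by auto
    ultimately show "M \<in> ?G" by (simp add: inv_SL2Z matrix_mul_assoc mat2_adj)
  qed
  show "carrier SL2Z \<subseteq> ?G"
  proof
    fix M assume "M \<in> carrier SL2Z"
    then have "M$1$1 * M$2$2 - M$2$1 * M$1$2 = 1" by (simp add: SL2Z_carrier)
    then have "mat2 (M$1$1) (M$2$1) (M$1$2) (M$2$2) \<in> ?G"
    proof (induction rule: SL2_int_induct)
      case one
      have "mat2 1 0 0 1 = mat 1" by (simp add: mat2_eq_iff)
      then show ?case using generate.one[of SL2Z "{SL2Z_gen1, SL2Z_gen2}"] by simp
    next
      case (row1 p q r s)
      have "mat2 (p + q) q (r + s) s = SL2Z_gen2 ** mat2 p q r s"
        by (simp add: mat2_eq_iff SL2Z_gen2_def)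
      then show ?case using mult by simp
    next
      case (row2 p q r s)
      have "mat2 p (q - p) r (s - r) = SL2Z_gen1 ** mat2 p q r s"
        by (simp add: mat2_eq_iff SL2Z_gen1_def)
      then show ?case using mult by simp
    qed
    moreover have "mat2 (M$1$1) (M$2$1) (M$1$2) (M$2$2) = M" by (simp add: mat2_eq_iff)
    ultimately show "M \<in> ?G" by simp
  qed
qed

section \<open>The subgroup of plus and minus the identity, and its quotient\<close>

lemma normal_pm1: "{mat 1, - mat 1} \<lhd> SL2Z"
proof -
  interpret group SL2Z by (rule group_SL2Z)
  have sub: "subgroup {mat 1, - mat 1} SL2Z"
    by (rule subgroupI) (auto simp: SL2Z_carrier inv_SL2Z mat2_adj_def mat2_eq_iff)
  have "g ** h ** inv\<^bsub>SL2Z\<^esub> g = h"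
    if "h \<in> {mat 1, - mat 1}" "g \<in> carrier SL2Z" for g h
    using that by (auto simp: SL2Z_carrier inv_SL2Z mat2_adj_def mat2_eq_iff algebra_simps)
  then show ?thesis
    using sub by (auto simp: normal_inv_iff)
qed

definition psl :: "int^2^2 \<Rightarrow> (int^2^2) set" where
  "psl M = {M, - M}"

lemma psl_r_coset: "{mat 1, - mat 1} #>\<^bsub>SL2Z\<^esub> M = psl M"
proof -
  have "(- mat 1) ** M = - M" by (simp add: mat2_eq_iff)
  then show ?thesis by (auto simp: r_coset_def psl_def)
qed

lemma PSL2Z_carrier: "carrier PSL2Z = psl ` carrier SL2Z"
  by (auto simp: PSL2Z_def FactGroup_def RCOSETS_def psl_r_coset)

lemma PSL2Z_mult:
  "M \<in> carrier SL2Z \<Longrightarrow> N \<in> carrier SL2Z \<Longrightarrow> psl M \<otimes>\<^bsub>PSL2Z\<^esub> psl N = psl (M ** N)"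
  using normal.rcos_sum[OF normal_pm1, of M N] by (simp add: PSL2Z_def psl_r_coset)

lemma group_PSL2Z: "group PSL2Z"
  unfolding PSL2Z_def by (rule normal.factorgroup_is_group[OF normal_pm1])

section \<open>Representations, cocycles and conjugation\<close>

abbreviation pi1_mult (infixl "\<cdot>" 70) where "\<gamma> \<cdot> \<mu> \<equiv> \<gamma> \<otimes>\<^bsub>pi1F\<^esub> \<mu>"
abbreviation pi1_inv where "pi1_inv \<gamma> \<equiv> inv\<^bsub>pi1F\<^esub> \<gamma>"
abbreviation pi1_one where "pi1_one \<equiv> \<one>\<^bsub>pi1F\<^esub>"

lemma pi1F_carrier [simp]: "\<gamma> \<in> carrier pi1F"
  by (simp add: pi1F_def)

lemma loop_Bd: "loop Bd = pi1_inv (loop Ba \<cdot> loop Bb \<cdot> loop Bc)"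
  using group.inv_equality[OF group_pi1F, of "loop Ba \<cdot> loop Bb \<cdot> loop Bc" "loop Bd"]
    group.inv_inv[OF group_pi1F, of "loop Bd"] loop_relation by simp

text \<open>Elements are words in four letters; the relation replaces d by
  \<open>c^-1 b^-1 a^-1\<close> and its inverse by \<open>abc\<close>, so only steps by the free
  generators and their inverses remain. This extends to the whole group what is known on a, b,
  c.\<close>

lemma pi1F_induct [case_names one mult inv]:
  assumes one: "P pi1_one"
    and mult: "\<And>s \<gamma>. s \<noteq> Bd \<Longrightarrow> P \<gamma> \<Longrightarrow> P (loop s \<cdot> \<gamma>)"
    and inv: "\<And>s \<gamma>. s \<noteq> Bd \<Longrightarrow> P \<gamma> \<Longrightarrow> P (pi1_inv (loop s) \<cdot> \<gamma>)"
  shows "P \<gamma>"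
proof -
  interpret group pi1F by (rule group_pi1F)
  have mult': "P (loop s \<cdot> \<gamma>)" if "P \<gamma>" for s \<gamma>
  proof (cases "s = Bd")
    case True
    have "loop s \<cdot> \<gamma> = pi1_inv (loop Bc) \<cdot> (pi1_inv (loop Bb) \<cdot> (pi1_inv (loop Ba) \<cdot> \<gamma>))"
      by (simp add: True loop_Bd inv_mult_group m_assoc)
    then show ?thesis using that inv by simp
  qed (use that mult in auto)
  have inv': "P (pi1_inv (loop s) \<cdot> \<gamma>)" if "P \<gamma>" for s \<gamma>
  proof (cases "s = Bd")
    case True
    have "pi1_inv (loop s) \<cdot> \<gamma> = loop Ba \<cdot> (loop Bb \<cdot> (loop Bc \<cdot> \<gamma>))"
      by (simp add: True loop_Bd m_assoc)
    then show ?thesis using that mult by simp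
  qed (use that inv in auto)
  have inv_loop: "abs_surface_group [(s, False)] = pi1_inv (loop s)" for s
  proof (rule inv_equality[symmetric])
    show "abs_surface_group [(s, False)] \<cdot> loop s = pi1_one"
      using word_eq.cancel[of "[]" s False "[]"]
      by (simp add: pi1F_def loop_def sg_mult.abs_eq sg_one_def surface_group.abs_eq_iff)
  qed auto
  have "P (abs_surface_group w)" for w
  proof (induction w)
    case Nil
    show ?case using one by (simp add: pi1F_def sg_one_def)
  next
    case (Cons a w)
    obtain s b where a: "a = (s, b)" by force
    have "abs_surface_group (a # w) = abs_surface_group [a] \<cdot> abs_surface_group w"
      by (simp add: pi1F_def sg_mult.abs_eq)
    moreover have "abs_surface_group [a] = (if b then loop s else pi1_inv (loop s))"
      by (simp add: a inv_loop loop_def)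
    ultimately show ?case using mult' inv' Cons by simp
  qed
  then show ?thesis
    by (metis Quotient3_abs_rep Quotient3_surface_group)
qed

section \<open>Homomorphisms into the unit quaternions\<close>

lemma SU2_simps [simp]:
  "q \<in> carrier SU2 \<longleftrightarrow> norm q = 1" "p \<otimes>\<^bsub>SU2\<^esub> q = p * q" "\<one>\<^bsub>SU2\<^esub> = 1"
  by (simp_all add: SU2_def)

lemma inv_SU2: "norm q = 1 \<Longrightarrow> inv\<^bsub>SU2\<^esub> q = inverse q"
proof -
  assume "norm q = 1"
  moreover from this have "q \<noteq> 0" by auto
  ultimately show ?thesis
    using group.inv_equality[OF group_SU2, of "inverse q" q] by (simp add: norm_inverse)
qed

lemma inverse_unit_quat: "norm q = 1 \<Longrightarrow> inverse q = qcnj q" for q :: quat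
  by (simp add: inverse_quat_def)

lemma bounded_linear_qcnj: "bounded_linear qcnj"
  by (auto simp: linear_conv_bounded_linear[symmetric] quat_eq_iff intro!: linearI)

lemma
  assumes "\<rho> \<in> hom pi1F SU2"
  shows SU2_hom_mult: "\<rho> (\<gamma> \<cdot> \<mu>) = \<rho> \<gamma> * \<rho> \<mu>"
    and SU2_hom_norm: "norm (\<rho> \<gamma>) = 1"
    and SU2_hom_nonzero: "\<rho> \<gamma> \<noteq> 0"
    and SU2_hom_one: "\<rho> pi1_one = 1"
    and SU2_hom_inv: "\<rho> (pi1_inv \<gamma>) = inverse (\<rho> \<gamma>)"
proof -
  interpret group_hom pi1F SU2 \<rho>
    using assms group_pi1F group_SU2 by (simp add: group_hom_def group_hom_axioms_def)
  show "\<rho> (\<gamma> \<cdot> \<mu>) = \<rho> \<gamma> * \<rho> \<mu>" "\<rho> pi1_one = 1"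
    using hom_mult hom_one by simp_all
  show n: "norm (\<rho> \<gamma>) = 1" using hom_closed[of \<gamma>] by simp
  then show "\<rho> \<gamma> \<noteq> 0" by auto
  show "\<rho> (pi1_inv \<gamma>) = inverse (\<rho> \<gamma>)" using n inv_SU2 by simp
qed

lemma SU2_hom_Bd:
  "\<rho> \<in> hom pi1F SU2 \<Longrightarrow> \<rho> (loop Bd) = inverse (\<rho> (loop Ba) * \<rho> (loop Bb) * \<rho> (loop Bc))"
  by (simp add: loop_Bd SU2_hom_inv SU2_hom_mult)

lemma SU2_hom_eqI:
  assumes "\<rho> \<in> hom pi1F SU2" "\<sigma> \<in> hom pi1F SU2" "\<And>s. s \<noteq> Bd \<Longrightarrow> \<rho> (loop s) = \<sigma> (loop s)"
  shows "\<rho> = \<sigma>"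
proof
  fix \<gamma>
  show "\<rho> \<gamma> = \<sigma> \<gamma>"
    using assms
    by (induction \<gamma> rule: pi1F_induct) (simp_all add: SU2_hom_one SU2_hom_mult SU2_hom_inv)
qed

abbreviation generator_values :: "(surface_group \<Rightarrow> quat) \<Rightarrow> quat \<times> quat \<times> quat" where
  "generator_values \<rho> \<equiv> (\<rho> (loop Ba), \<rho> (loop Bb), \<rho> (loop Bc))"

text \<open>The image of a word is a product of generator values and inverses. Writing the inverse
  of a unit quaternion as its conjugate makes the formula polynomial, hence smooth on the whole
  ambient space.\<close>

lemma evaluation_smooth:
  obtains F where "smooth_on UNIV F" "\<And>\<rho>. \<rho> \<in> hom pi1F SU2 \<Longrightarrow> \<rho> \<gamma> = F (generator_values \<rho>)"
proof -
  have gen: "\<exists>F. smooth_on UNIV F \<and> (\<forall>\<rho>. \<rho> (loop s) = F (generator_values \<rho>))" if "s \<noteq> Bd" for s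
  proof (cases s)
    case Ba
    then show ?thesis by (intro exI[of _ fst]) (auto intro: smooth_on_fst)
  next
    case Bb
    then show ?thesis
      by (intro exI[of _ "\<lambda>x. fst (snd x)"]) (auto intro!: smooth_on_fst smooth_on_snd)
  next
    case Bc
    then show ?thesis
      by (intro exI[of _ "\<lambda>x. snd (snd x)"]) (auto intro!: smooth_on_snd)
  qed (use that in auto)
  have "\<exists>F. smooth_on UNIV F \<and> (\<forall>\<rho>\<in>hom pi1F SU2. \<rho> \<gamma> = F (generator_values \<rho>))"
  proof (induction \<gamma> rule: pi1F_induct)
    case one
    show ?case by (intro exI[of _ "\<lambda>_. 1"]) (auto simp: SU2_hom_one)
  next
    case (mult s \<gamma>)
    obtain F where F: "smooth_on UNIV F" "\<forall>\<rho>. \<rho> (loop s) = F (generator_values \<rho>)"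
      using gen[OF mult(1)] by blast
    obtain G where G: "smooth_on UNIV G" "\<forall>\<rho>\<in>hom pi1F SU2. \<rho> \<gamma> = G (generator_values \<rho>)"
      using mult by blast
    have "smooth_on UNIV (\<lambda>x. F x * G x)"
      using F(1) G(1) by (intro smooth_on_mult) auto
    moreover have "\<forall>\<rho>\<in>hom pi1F SU2. \<rho> (loop s \<cdot> \<gamma>) = F (generator_values \<rho>) * G (generator_values \<rho>)"
      using F(2)[rule_format, symmetric] G(2) by (simp add: SU2_hom_mult)
    ultimately show ?case by blast
  next
    case (inv s \<gamma>)
    obtain F where F: "smooth_on UNIV F" "\<forall>\<rho>. \<rho> (loop s) = F (generator_values \<rho>)"
      using gen[OF inv(1)] by blast
    obtain G where G: "smooth_on UNIV G" "\<forall>\<rho>\<in>hom pi1F SU2. \<rho> \<gamma> = G (generator_values \<rho>)"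
      using inv by blast
    have "smooth_on UNIV (\<lambda>x. qcnj (F x) * G x)"
      using F(1) G(1) by (intro smooth_on_mult smooth_on_linear[OF bounded_linear_qcnj]) auto
    moreover have "\<forall>\<rho>\<in>hom pi1F SU2. \<rho> (pi1_inv (loop s) \<cdot> \<gamma>) = qcnj (F (generator_values \<rho>)) * G (generator_values \<rho>)"
      using F(2)[rule_format, symmetric] G(2) by (simp add: SU2_hom_mult SU2_hom_inv SU2_hom_norm inverse_unit_quat)
    ultimately show ?case by blast
  qed
  with that show ?thesis by blast
qed

section \<open>Cocycles twisted by the adjoint action\<close>

lemma Ad_add: "Ad \<rho> \<gamma> (v + w) = Ad \<rho> \<gamma> v + Ad \<rho> \<gamma> w"
  and Ad_diff: "Ad \<rho> \<gamma> (v - w) = Ad \<rho> \<gamma> v - Ad \<rho> \<gamma> w"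
  and Ad_minus: "Ad \<rho> \<gamma> (- v) = - Ad \<rho> \<gamma> v"
  and Ad_zero [simp]: "Ad \<rho> \<gamma> 0 = 0"
  by (simp_all add: Ad_def algebra_simps)

lemma Ad_mult: "\<rho> \<in> hom pi1F SU2 \<Longrightarrow> Ad \<rho> (\<gamma> \<cdot> \<mu>) v = Ad \<rho> \<gamma> (Ad \<rho> \<mu> v)"
  by (simp add: Ad_def SU2_hom_mult SU2_hom_nonzero nonzero_inverse_mult_distrib mult.assoc)

lemma Ad_one: "\<rho> \<in> hom pi1F SU2 \<Longrightarrow> Ad \<rho> pi1_one v = v"
  by (simp add: Ad_def SU2_hom_one)

lemma Z1_mult: "z \<in> Z1 \<rho> \<Longrightarrow> z (\<gamma> \<cdot> \<mu>) = z \<gamma> + Ad \<rho> \<gamma> (z \<mu>)"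
  by (simp add: Z1_def cobdry1_def) (metis add.commute diff_add_eq diff_eq_eq add_0)

lemma Z1_one: "\<rho> \<in> hom pi1F SU2 \<Longrightarrow> z \<in> Z1 \<rho> \<Longrightarrow> z pi1_one = 0"
  using Z1_mult[of z \<rho> pi1_one pi1_one] group.is_monoid[OF group_pi1F]
  by (simp add: Ad_one monoid.l_one)

lemma Z1_inv:
  assumes "\<rho> \<in> hom pi1F SU2" "z \<in> Z1 \<rho>"
  shows "z (pi1_inv \<gamma>) = - Ad \<rho> (pi1_inv \<gamma>) (z \<gamma>)"
proof -
  have "z (pi1_inv \<gamma>) + Ad \<rho> (pi1_inv \<gamma>) (z \<gamma>) = z (pi1_inv \<gamma> \<cdot> \<gamma>)"
    by (simp add: Z1_mult[OF assms(2)])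
  also have "\<dots> = 0"
    using Z1_one[OF assms] by (simp add: group.l_inv[OF group_pi1F])
  finally show ?thesis by (simp add: eq_neg_iff_add_eq_0)
qed

lemma Z1_su2: "z \<in> Z1 \<rho> \<Longrightarrow> z \<gamma> \<in> su2"
  by (auto simp: Z1_def)

lemma Z1_eqI:
  assumes "\<rho> \<in> hom pi1F SU2" "z \<in> Z1 \<rho>" "w \<in> Z1 \<rho>" "\<And>s. s \<noteq> Bd \<Longrightarrow> z (loop s) = w (loop s)"
  shows "z = w"
proof
  fix \<gamma>
  show "z \<gamma> = w \<gamma>"
    using assms by (induction \<gamma> rule: pi1F_induct) (simp_all add: Z1_one Z1_mult Z1_inv)
qed

lemma Ad_su2: "\<rho> \<in> hom pi1F SU2 \<Longrightarrow> v \<in> su2 \<Longrightarrow> Ad \<rho> \<gamma> v \<in> su2"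
  by (simp add: Ad_def su2_def inverse_unit_quat SU2_hom_norm) (simp add: algebra_simps)

lemma cobdry0_Z1:
  assumes "\<rho> \<in> hom pi1F SU2" "u \<in> su2"
  shows "cobdry0 \<rho> u \<in> Z1 \<rho>"
  using assms Ad_su2[OF assms]
  by (auto simp: Z1_def cobdry1_def cobdry0_def Ad_mult Ad_diff) (auto simp: su2_def)

definition velocity_cocycle :: "(real \<Rightarrow> surface_group \<Rightarrow> quat) \<Rightarrow> surface_group \<Rightarrow> quat" where
  "velocity_cocycle R = (\<lambda>\<gamma>. vector_derivative (\<lambda>t. R t \<gamma>) (at 0) * inverse (R 0 \<gamma>))"

lemma rep_curve_differentiable:
  assumes "\<And>t. R t \<in> hom pi1F SU2" "(\<lambda>t. generator_values (R t)) differentiable at t0"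
  shows "(\<lambda>t. R t \<gamma>) differentiable at t0"
proof -
  obtain F where F: "smooth_on UNIV F" "\<And>\<rho>. \<rho> \<in> hom pi1F SU2 \<Longrightarrow> \<rho> \<gamma> = F (generator_values \<rho>)"
    using evaluation_smooth by blast
  have "(F \<circ> (\<lambda>t. generator_values (R t))) differentiable at t0"
    by (rule differentiable_chain_at[OF assms(2)]) (rule smooth_on_differentiable[OF F(1)], simp)
  then show ?thesis using F(2) assms(1) by (simp add: o_def)
qed

text \<open>Differentiating the constant \<open>R t \<gamma> \<bullet> R t \<gamma>\<close> makes
  the velocity orthogonal to \<open>R 0 \<gamma>\<close>, that is, the quotient by
  \<open>R 0 \<gamma>\<close> has real part zero. Differentiating multiplicativity by the product
  rule gives the cocycle identity.\<close>

lemma velocity_cocycle_Z1: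
  assumes "\<And>t. R t \<in> hom pi1F SU2" "(\<lambda>t. generator_values (R t)) differentiable at 0"
  shows "velocity_cocycle R \<in> Z1 (R 0)"
proof -
  have d: "((\<lambda>t. R t \<gamma>) has_vector_derivative vector_derivative (\<lambda>t. R t \<gamma>) (at 0)) (at 0)" for \<gamma>
    using rep_curve_differentiable[OF assms] by (simp add: vector_derivative_works)
  have "velocity_cocycle R \<gamma> \<in> su2" for \<gamma>
  proof -
    let ?v = "vector_derivative (\<lambda>t. R t \<gamma>) (at 0)"
    have "((\<lambda>t. R t \<gamma> \<bullet> R t \<gamma>) has_derivative (\<lambda>h. R 0 \<gamma> \<bullet> (h *\<^sub>R ?v) + (h *\<^sub>R ?v) \<bullet> R 0 \<gamma>)) (at 0)"
      using d[of \<gamma>] unfolding has_vector_derivative_def by (intro has_derivative_inner)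
    moreover have "(\<lambda>t. R t \<gamma> \<bullet> R t \<gamma>) = (\<lambda>t. 1)"
      using SU2_hom_norm[OF assms(1)] by (simp add: dot_square_norm)
    ultimately have "(\<lambda>h. R 0 \<gamma> \<bullet> (h *\<^sub>R ?v) + (h *\<^sub>R ?v) \<bullet> R 0 \<gamma>) = (\<lambda>h. 0)"
      using has_derivative_unique has_derivative_const by metis
    then have "?v \<bullet> R 0 \<gamma> = 0"
      by (auto dest!: fun_cong[of _ _ 1] simp: inner_commute)
    then show ?thesis
      by (simp add: velocity_cocycle_def su2_def inverse_unit_quat SU2_hom_norm[OF assms(1)] inner_quat_def)
  qed
  moreover have "cobdry1 (R 0) (velocity_cocycle R) \<gamma> \<mu> = 0" for \<gamma> \<mu>
  proof -
    have "((\<lambda>t. R t \<gamma> * R t \<mu>) has_vector_derivative R 0 \<gamma> * vector_derivative (\<lambda>t. R t \<mu>) (at 0)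
        + vector_derivative (\<lambda>t. R t \<gamma>) (at 0) * R 0 \<mu>) (at 0)"
      by (rule has_vector_derivative_mult[OF d d])
    then have "vector_derivative (\<lambda>t. R t (\<gamma> \<cdot> \<mu>)) (at 0) = R 0 \<gamma> * vector_derivative (\<lambda>t. R t \<mu>) (at 0)
        + vector_derivative (\<lambda>t. R t \<gamma>) (at 0) * R 0 \<mu>"
      using SU2_hom_mult[OF assms(1)] by (simp add: vector_derivative_at)
    then show ?thesis
      using SU2_hom_nonzero[OF assms(1)]
      by (simp add: cobdry1_def velocity_cocycle_def Ad_def SU2_hom_mult[OF assms(1)]
          nonzero_inverse_mult_distrib algebra_simps)
        (simp add: mult.assoc[symmetric])
  qed
  ultimately show ?thesis by (auto simp: Z1_def)
qed

text \<open>Any nonzero conjugator is as good as a unit one, since its norm cancels; natural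
  conjugators can thus be used without normalising them. Representations and cocycles are
  transported by the same operation.\<close>

definition conj_by :: "quat \<Rightarrow> ('a \<Rightarrow> quat) \<Rightarrow> 'a \<Rightarrow> quat" where
  "conj_by g f = (\<lambda>x. g * f x * inverse g)"

lemma conj_by_conj_by: "g \<noteq> 0 \<Longrightarrow> k \<noteq> 0 \<Longrightarrow> conj_by g (conj_by k f) = conj_by (g * k) f"
  by (simp add: conj_by_def nonzero_inverse_mult_distrib mult.assoc)

lemma conj_by_one [simp]: "conj_by 1 f = f"
  by (simp add: conj_by_def)

lemma conj_by_inverse:
  "g \<noteq> 0 \<Longrightarrow> conj_by (inverse g) (conj_by g f) = f"
  "g \<noteq> 0 \<Longrightarrow> conj_by g (conj_by (inverse g) f) = f"
  by (simp_all add: conj_by_conj_by)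

lemma conj_by_scaleR:
  assumes "r \<noteq> 0"
  shows "conj_by (r *\<^sub>R g) f = conj_by g f"
proof -
  have "inverse (r *\<^sub>R g) = inverse r *\<^sub>R inverse g"
    using assms by (cases "g = 0") (simp_all add: nonzero_inverse_scaleR_distrib)
  then show ?thesis using assms by (simp add: conj_by_def)
qed

lemma conj_by_comp: "conj_by g f \<circ> h = conj_by g (f \<circ> h)"
  by (auto simp: conj_by_def)

lemma conj_by_hom:
  assumes "g \<noteq> 0" "\<rho> \<in> hom pi1F SU2"
  shows "conj_by g \<rho> \<in> hom pi1F SU2"
proof (rule homI)
  fix \<gamma> \<mu>
  have "inverse g * (g * q) = q" for q
    using assms(1) by (simp add: mult.assoc[symmetric])
  then show "conj_by g \<rho> (\<gamma> \<cdot> \<mu>) = conj_by g \<rho> \<gamma> \<otimes>\<^bsub>SU2\<^esub> conj_by g \<rho> \<mu>"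
    by (simp add: conj_by_def SU2_hom_mult[OF assms(2)] mult.assoc)
qed (use assms in \<open>simp add: conj_by_def norm_mult norm_inverse SU2_hom_norm\<close>)

lemma qre_conj: "g \<noteq> 0 \<Longrightarrow> qre (g * q * inverse g) = qre q"
proof -
  have comm: "qre (p * q) = qre (q * p)" for p q by (simp add: algebra_simps)
  assume "g \<noteq> 0"
  then have "inverse g * (g * q) = q" by (simp add: mult.assoc[symmetric])
  then show ?thesis by (simp only: comm[of "g * q"])
qed

lemma conj_by_traceless:
  assumes "g \<noteq> 0" "\<rho> \<in> traceless_homs"
  shows "conj_by g \<rho> \<in> traceless_homs"
  using assms conj_by_hom[of g \<rho>]
  by (auto simp: traceless_homs_def J_def conj_by_def qre_conj norm_mult norm_inverse simp del: quat_sel)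

lemma conj_class_eq: "conj_class \<rho> = {conj_by g \<rho> |g. norm g = 1}"
  by (simp add: conj_class_def conj_by_def)

lemma conj_class_self: "\<rho> \<in> conj_class \<rho>"
  unfolding conj_class_eq by (force intro: exI[of _ 1])

lemma conj_class_conj_by:
  assumes "g \<noteq> 0"
  shows "conj_class (conj_by g \<rho>) = conj_class \<rho>"
proof -
  have sub: "conj_class (conj_by g \<rho>) \<subseteq> conj_class \<rho>" if "norm g = 1" for g \<rho>
  proof
    fix \<sigma> assume "\<sigma> \<in> conj_class (conj_by g \<rho>)"
    then obtain k where "norm k = 1" "\<sigma> = conj_by k (conj_by g \<rho>)" by (auto simp: conj_class_eq)
    moreover from this that have "g \<noteq> 0" "k \<noteq> 0" by auto
    ultimately have "\<sigma> = conj_by (k * g) \<rho>" "norm (k * g) = 1"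
      using that by (simp_all add: conj_by_conj_by norm_mult)
    then show "\<sigma> \<in> conj_class \<rho>" by (auto simp: conj_class_eq)
  qed
  have eq: "conj_class (conj_by g \<rho>) = conj_class \<rho>" if "norm g = 1" for g
  proof
    have "conj_class (conj_by (inverse g) (conj_by g \<rho>)) \<subseteq> conj_class (conj_by g \<rho>)"
      by (rule sub) (simp add: norm_inverse that)
    moreover have "g \<noteq> 0" using that by auto
    ultimately show "conj_class \<rho> \<subseteq> conj_class (conj_by g \<rho>)" by (simp add: conj_by_inverse)
  qed (rule sub[OF that])
  have "conj_by g \<rho> = conj_by (inverse (norm g) *\<^sub>R g) \<rho>"
    using assms by (intro conj_by_scaleR[symmetric]) simp
  moreover have "norm (inverse (norm g) *\<^sub>R g) = 1" using assms by simp
  ultimately show ?thesis using eq by metis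
qed

lemma conj_class_eq_iff: "conj_class \<rho> = conj_class \<sigma> \<longleftrightarrow> (\<exists>g. norm g = 1 \<and> \<sigma> = conj_by g \<rho>)"
proof
  assume "conj_class \<rho> = conj_class \<sigma>"
  then have "\<sigma> \<in> conj_class \<rho>" using conj_class_self by simp
  then show "\<exists>g. norm g = 1 \<and> \<sigma> = conj_by g \<rho>" by (auto simp: conj_class_eq)
next
  assume "\<exists>g. norm g = 1 \<and> \<sigma> = conj_by g \<rho>"
  then obtain g where "norm g = 1" "\<sigma> = conj_by g \<rho>" by blast
  moreover from this have "g \<noteq> 0" by auto
  ultimately show "conj_class \<rho> = conj_class \<sigma>" by (simp add: conj_class_conj_by)
qed

lemma stabilizer_conj_by:
  assumes "g \<noteq> 0"
  shows "(\<forall>\<gamma>. k * conj_by g \<rho> \<gamma> * inverse k = conj_by g \<rho> \<gamma>) \<longleftrightarrow>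
    (\<forall>\<gamma>. (inverse g * k * g) * \<rho> \<gamma> * inverse (inverse g * k * g) = \<rho> \<gamma>)"
proof (cases "k = 0")
  case True
  then show ?thesis using assms by (auto simp: conj_by_def)
next
  case False
  have "conj_by k (conj_by g \<rho>) = conj_by g \<rho> \<longleftrightarrow>
      conj_by (inverse g) (conj_by k (conj_by g \<rho>)) = conj_by (inverse g) (conj_by g \<rho>)"
    using conj_by_inverse[OF assms] by metis
  also have "\<dots> \<longleftrightarrow> conj_by (inverse g * k * g) \<rho> = \<rho>"
    using assms False by (simp add: conj_by_conj_by mult.assoc)
  finally show ?thesis
    unfolding conj_by_def fun_eq_iff by blast
qed

lemma conj_by_traceless_star:
  assumes "g \<noteq> 0" "\<rho> \<in> traceless_homs_star"
  shows "conj_by g \<rho> \<in> traceless_homs_star"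
proof -
  have stab: "{k \<in> carrier SU2. \<forall>\<gamma>. k * \<rho> \<gamma> * inverse k = \<rho> \<gamma>} = {1, - 1}"
    and \<rho>: "\<rho> \<in> traceless_homs"
    using assms(2) by (auto simp: traceless_homs_star_def)
  have "(norm k = 1 \<and> (\<forall>\<gamma>. k * conj_by g \<rho> \<gamma> * inverse k = conj_by g \<rho> \<gamma>)) \<longleftrightarrow> k = 1 \<or> k = - 1" for k
  proof -
    have "norm (inverse g * k * g) = norm k" using assms(1) by (simp add: norm_mult norm_inverse)
    then have "(norm k = 1 \<and> (\<forall>\<gamma>. k * conj_by g \<rho> \<gamma> * inverse k = conj_by g \<rho> \<gamma>)) \<longleftrightarrow>
        inverse g * k * g \<in> {k \<in> carrier SU2. \<forall>\<gamma>. k * \<rho> \<gamma> * inverse k = \<rho> \<gamma>}"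
      by (simp add: stabilizer_conj_by[OF assms(1)])
    also have "\<dots> \<longleftrightarrow> inverse g * k * g = 1 \<or> inverse g * k * g = - 1"
      using stab by auto
    also have "\<dots> \<longleftrightarrow> g * (inverse g * k * g) * inverse g = g * 1 * inverse g
        \<or> g * (inverse g * k * g) * inverse g = g * (- 1) * inverse g"
      using assms(1) by (metis mult_cancel_left mult_cancel_right nonzero_imp_inverse_nonzero)
    also have "\<dots> \<longleftrightarrow> k = 1 \<or> k = - 1"
      using assms(1) by (simp add: mult.assoc) (simp add: mult.assoc[symmetric])
    finally show ?thesis .
  qed
  then show ?thesis
    using conj_by_traceless[OF assms(1) \<rho>] by (auto simp: traceless_homs_star_def)
qed

section \<open>The representations parametrised by the pillowcase\<close>

text \<open>This is e^{ix} j, the general point of the unit circle in the plane of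
  \<open>quat_j\<close> and \<open>quat_k\<close>.\<close>

definition ej :: "real \<Rightarrow> quat" where
  "ej x = Quat 0 0 (cos x) (sin x)"

lemma ej_sel [simp]: "qre (ej x) = 0" "qi (ej x) = 0" "qj (ej x) = cos x" "qk (ej x) = sin x"
  by (simp_all add: ej_def)

lemma ej_0: "ej 0 = quat_j"
  by (simp add: ej_def quat_j_def)

lemma norm_ej [simp]: "norm (ej x) = 1"
  by (simp add: norm_quat_def)

lemma ej_nonzero [simp]: "ej x \<noteq> 0"
  using norm_ej[of x] by (metis norm_zero zero_neq_one)

lemma quat_of_complex_cis: "quat_of_complex (cis x) * quat_j = ej x"
  by (simp add: quat_eq_iff quat_of_complex_def quat_j_def)

lemma inverse_ej [simp]: "inverse (ej x) = - ej x"
  by (simp add: inverse_unit_quat) (simp add: quat_eq_iff)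

lemma ej_mult: "ej x * ej y = Quat (- cos (x - y)) (sin (y - x)) 0 0"
  by (simp add: quat_eq_iff cos_diff sin_diff)

text \<open>Since j e^{iy} = e^{-iy} j, the angles of an odd product combine with alternating signs.
  In particular, conjugating \<open>ej y\<close> by \<open>ej x\<close> gives
  \<open>ej (2 * x - y)\<close>, and evaluating representations on words becomes arithmetic of
  angles.\<close>

lemma ej_mult3: "ej x * ej y * ej z = - ej (x - y + z)"
proof -
  have "cos (x - y + z) = cos (x - y) * cos z - sin (x - y) * sin z"
    "sin (x - y + z) = sin (x - y) * cos z + cos (x - y) * sin z"
    by (simp_all only: cos_add sin_add)
  moreover have "sin (y - x) = - sin (x - y)"
    using sin_minus[of "x - y"] by simp
  ultimately show ?thesis
    by (simp add: quat_eq_iff ej_mult)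
qed

section \<open>The torus and its symmetries in angle coordinates\<close>

lemma torus_cis: "p \<in> torus \<longleftrightarrow> (\<exists>x y. p = (cis x, cis y))"
proof
  assume "p \<in> torus"
  then obtain z w where p: "p = (z, w)" "norm z = 1" "norm w = 1" by (auto simp: torus_def)
  then have "cis (Arg z) = z" "cis (Arg w) = w"
    by (metis cis_Arg norm_eq_zero sgn_div_norm scaleR_one inverse_1 zero_neq_one)+
  with p show "\<exists>x y. p = (cis x, cis y)" by metis
qed (auto simp: torus_def)

lemma iota_cis: "iota (cis x, cis y) = (cis (- x), cis (- y))"
  by (simp add: iota_def cis_cnj)

lemma iota_iota: "iota (iota p) = p"
  by (cases p) (simp add: iota_def)

lemma iota_torus: "p \<in> torus \<Longrightarrow> iota p \<in> torus"
  by (cases p) (simp add: iota_def torus_def)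

lemma cis_eq_pm1: "cis x \<in> {1, - 1} \<longleftrightarrow> sin x = 0"
proof
  assume "sin x = 0"
  then have "cos x = 1 \<or> cos x = - 1"
    using sin_cos_squared_add[of x] by (simp add: power2_eq_1_iff)
  with \<open>sin x = 0\<close> show "cis x \<in> {1, - 1}" by (auto simp: complex_eq_iff)
qed (auto simp: complex_eq_iff)

lemma torus_star_cis: "(cis x, cis y) \<in> torus_star \<longleftrightarrow> sin x \<noteq> 0 \<or> sin y \<noteq> 0"
  by (simp only: torus_star_def Diff_iff mem_Times_iff fst_conv snd_conv cis_eq_pm1) (auto simp: torus_def)

lemma torus_star_torus: "p \<in> torus_star \<Longrightarrow> p \<in> torus"
  by (simp add: torus_star_def)

lemma iota_torus_star: "p \<in> torus_star \<Longrightarrow> iota p \<in> torus_star"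
  using torus_star_torus[of p] by (auto simp: torus_cis torus_star_cis iota_cis)

lemma SL2Z_act_cis: "SL2Z_act M (cis x, cis y) =
    (cis (of_int (M$1$1) * x + of_int (M$1$2) * y), cis (of_int (M$2$1) * x + of_int (M$2$2) * y))"
  by (simp add: SL2Z_act_def cis_power_int cis_mult)

lemma SL2Z_act_torus: "p \<in> torus \<Longrightarrow> SL2Z_act M p \<in> torus"
  by (auto simp: torus_cis SL2Z_act_cis)

lemma SL2Z_act_mult: "p \<in> torus \<Longrightarrow> SL2Z_act (M ** N) p = SL2Z_act M (SL2Z_act N p)"
  by (auto simp: torus_cis SL2Z_act_cis algebra_simps)

lemma SL2Z_act_one: "p \<in> torus \<Longrightarrow> SL2Z_act (mat 1) p = p"
  by (auto simp: torus_cis SL2Z_act_cis)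

lemma SL2Z_act_uminus: "p \<in> torus \<Longrightarrow> SL2Z_act (- M) p = iota (SL2Z_act M p)"
  by (auto simp: torus_cis SL2Z_act_cis iota_cis algebra_simps)

lemma SL2Z_act_iota: "p \<in> torus \<Longrightarrow> SL2Z_act M (iota p) = iota (SL2Z_act M p)"
  by (auto simp: torus_cis SL2Z_act_cis iota_cis algebra_simps)

lemma
  assumes "p \<in> torus"
  shows rho_hom: "rho p \<in> hom pi1F SU2"
    and rho_Ba: "rho p (loop Ba) = quat_j"
    and rho_Bb: "rho p (loop Bb) = quat_of_complex (fst p) * quat_j"
    and rho_Bc: "rho p (loop Bc) = quat_of_complex (snd p) * quat_j"
proof -
  obtain x y where p: "p = (cis x, cis y)" using assms torus_cis by blast
  have "ej 0 \<in> carrier SU2" "ej x \<in> carrier SU2" "ej y \<in> carrier SU2" by simp_all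
  from hom_of_props[OF group_SU2 this]
  show "rho p \<in> hom pi1F SU2" "rho p (loop Ba) = quat_j"
    "rho p (loop Bb) = quat_of_complex (fst p) * quat_j"
    "rho p (loop Bc) = quat_of_complex (snd p) * quat_j"
    by (simp_all add: rho_def p quat_of_complex_cis ej_0)
qed

lemma cis_pair_torus [simp]: "(cis x, cis y) \<in> torus"
  by (auto simp: torus_cis)

lemma rho_cis:
  "rho (cis x, cis y) (loop Ba) = ej 0" "rho (cis x, cis y) (loop Bb) = ej x"
  "rho (cis x, cis y) (loop Bc) = ej y" "rho (cis x, cis y) (loop Bd) = ej (y - x)"
proof -
  show *: "rho (cis x, cis y) (loop Ba) = ej 0" "rho (cis x, cis y) (loop Bb) = ej x"
    "rho (cis x, cis y) (loop Bc) = ej y"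
    by (simp_all add: rho_Ba rho_Bb rho_Bc quat_of_complex_cis ej_0)
  show "rho (cis x, cis y) (loop Bd) = ej (y - x)"
    by (simp add: SU2_hom_Bd[OF rho_hom] * ej_mult3)
qed

lemma rho_traceless: "p \<in> torus \<Longrightarrow> rho p \<in> traceless_homs"
proof -
  assume "p \<in> torus"
  then obtain x y where p: "p = (cis x, cis y)" using torus_cis by blast
  have "rho p (loop s) \<in> J" for s by (cases s) (simp_all add: p rho_cis J_def)
  then show ?thesis by (simp add: traceless_homs_def rho_hom \<open>p \<in> torus\<close>)
qed

text \<open>Equality of the representations themselves is what allows composites and derivatives
  along families to be computed. Only a homomorphism is asked for: where an inverse is wanted, a
  realisation of the inverse matrix serves.\<close>

definition realizes :: "(surface_group \<Rightarrow> surface_group) \<Rightarrow> int^2^2 \<Rightarrow> bool" where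
  "realizes h M \<longleftrightarrow> h \<in> hom pi1F pi1F \<and> (\<forall>p\<in>torus. rho p \<circ> h = rho (SL2Z_act M p))"

lemma realizesI:
  assumes "h \<in> hom pi1F pi1F"
    and "\<And>x y s. s \<noteq> Bd \<Longrightarrow> rho (cis x, cis y) (h (loop s)) = rho (SL2Z_act M (cis x, cis y)) (loop s)"
  shows "realizes h M"
  unfolding realizes_def
proof (intro conjI ballI assms(1))
  fix p assume "p \<in> torus"
  then obtain x y where p: "p = (cis x, cis y)" using torus_cis by blast
  have "rho p \<circ> h \<in> hom pi1F SU2"
    using assms(1) rho_hom[OF \<open>p \<in> torus\<close>] by (auto simp: hom_def)
  then show "rho p \<circ> h = rho (SL2Z_act M p)"
    by (rule SU2_hom_eqI) (use assms(2) in \<open>auto simp: p rho_hom SL2Z_act_torus\<close>)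
qed

lemma realizes_hom_of:
  assumes "\<And>x y. rho (cis x, cis y) \<beta> = rho (SL2Z_act M (cis x, cis y)) (loop Bb)"
    and "\<And>x y. rho (cis x, cis y) \<gamma> = rho (SL2Z_act M (cis x, cis y)) (loop Bc)"
  shows "realizes (hom_of pi1F (loop Ba) \<beta> \<gamma>) M"
proof (rule realizesI)
  note h = hom_of_props[OF group_pi1F, of "loop Ba" \<beta> \<gamma>, simplified]
  show "hom_of pi1F (loop Ba) \<beta> \<gamma> \<in> hom pi1F pi1F" by (rule h)
  fix x y s assume "s \<noteq> Bd"
  then show "rho (cis x, cis y) (hom_of pi1F (loop Ba) \<beta> \<gamma> (loop s)) = rho (SL2Z_act M (cis x, cis y)) (loop s)"
    using assms by (cases s) (simp_all add: h rho_Ba SL2Z_act_torus)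
qed

lemma half_twist1_realizes: "realizes half_twist1 SL2Z_gen1"
  unfolding half_twist1_def
  by (rule realizes_hom_of) (simp_all add: SL2Z_act_cis SL2Z_gen1_def rho_cis)

lemma half_twist2_realizes: "realizes half_twist2 SL2Z_gen2"
  unfolding half_twist2_def
  by (rule realizes_hom_of)
    (simp_all add: SL2Z_act_cis SL2Z_gen2_def rho_cis SU2_hom_mult[OF rho_hom]
      SU2_hom_inv[OF rho_hom] ej_mult3)

text \<open>Composition reverses the order: if \<open>h\<close> and \<open>k\<close> realise
  \<open>M\<close> and \<open>N\<close>, then \<open>k \<circ> h\<close> realises
  \<open>M ** N\<close>. The half twists, together with realisations of their inverse matrices,
  therefore cover everything they generate.\<close>

lemma realizes_exists:
  assumes "M \<in> carrier SL2Z"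
  obtains h where "realizes h M"
proof -
  from assms have "M \<in> generate SL2Z {SL2Z_gen1, SL2Z_gen2}" by (simp add: SL2Z_generated)
  then have "\<exists>h. realizes h M"
  proof induction
    case one
    have "realizes (\<lambda>\<gamma>. \<gamma>) (mat 1)"
      by (auto simp: realizes_def hom_def SL2Z_act_one)
    then show ?case by auto
  next
    case (incl M)
    then show ?case using half_twist1_realizes half_twist2_realizes by auto
  next
    case (inv M)
    \<comment> \<open>The images of \<open>c d c^-1\<close> and \<open>a^-1 d a\<close> have angles
      \<open>x + y\<close> and \<open>x - y\<close>, as the inverse matrices require.\<close>
    have "realizes (hom_of pi1F (loop Ba) (loop Bb) (loop Bc \<cdot> loop Bd \<cdot> pi1_inv (loop Bc)))
        (mat2_adj SL2Z_gen1)"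
      by (rule realizes_hom_of)
        (simp_all add: SL2Z_act_cis mat2_adj_def SL2Z_gen1_def rho_cis SU2_hom_mult[OF rho_hom]
          SU2_hom_inv[OF rho_hom] ej_mult3)
    moreover have "realizes (hom_of pi1F (loop Ba) (pi1_inv (loop Ba) \<cdot> loop Bd \<cdot> loop Ba) (loop Bc))
        (mat2_adj SL2Z_gen2)"
      by (rule realizes_hom_of)
        (simp_all add: SL2Z_act_cis mat2_adj_def SL2Z_gen2_def rho_cis SU2_hom_mult[OF rho_hom]
          SU2_hom_inv[OF rho_hom] ej_mult3)
    moreover have "inv\<^bsub>SL2Z\<^esub> M = mat2_adj M"
      using inv SL2Z_gens by (intro inv_SL2Z) auto
    ultimately show ?case using inv by auto
  next
    case (eng M N)
    then obtain h k where "realizes h M" "realizes k N" by blast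
    then have "realizes (k \<circ> h) (M ** N)"
      by (simp add: realizes_def SL2Z_act_mult SL2Z_act_torus hom_def o_assoc)
    then show ?case by auto
  qed
  with that show ?thesis by blast
qed

text \<open>Conjugation by \<open>quat_j\<close> fixes j and negates i, so it takes e^{ix} j to
  e^{-ix} j and reverses all angles at once.\<close>

lemma rho_iota: "p \<in> torus \<Longrightarrow> rho (iota p) = conj_by quat_j (rho p)"
proof (rule SU2_hom_eqI)
  assume p: "p \<in> torus"
  show "rho (iota p) \<in> hom pi1F SU2" using p by (intro rho_hom iota_torus)
  have "quat_j \<noteq> 0" by (metis ej_0 ej_nonzero)
  then show "conj_by quat_j (rho p) \<in> hom pi1F SU2" using p by (intro conj_by_hom rho_hom)
  fix s :: bdry assume "s \<noteq> Bd"
  with p show "rho (iota p) (loop s) = conj_by quat_j (rho p) (loop s)"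
    by (cases s) (auto simp: torus_cis iota_cis rho_cis conj_by_def ej_0[symmetric] ej_mult3)
qed

lemma conj_class_rho_iota: "p \<in> torus \<Longrightarrow> conj_class (rho (iota p)) = conj_class (rho p)"
  by (simp add: rho_iota) (metis conj_class_conj_by ej_0 ej_nonzero)

lemma rho_hat_iota_orbit: "p \<in> torus \<Longrightarrow> rho_hat (iota_orbit p) = conj_class (rho p)"
  by (simp add: rho_hat_def iota_orbit_def conj_class_rho_iota)

lemma iota_orbit_iota: "iota_orbit (iota p) = iota_orbit p"
  by (auto simp: iota_orbit_def iota_iota)

text \<open>The cosines of \<open>x\<close>, \<open>y\<close> and \<open>x - y\<close> are, up to sign, the traces of the images of \<open>ab\<close>, \<open>ac\<close>
  and \<open>bc\<close>, and determine \<open>(x, y)\<close> up to a simultaneous change of sign.\<close>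

lemma conj_class_rho_inj:
  assumes "p \<in> torus" "q \<in> torus" "conj_class (rho p) = conj_class (rho q)"
  shows "iota_orbit p = iota_orbit q"
proof -
  obtain x y where p: "p = (cis x, cis y)" using assms torus_cis by blast
  obtain x' y' where q: "q = (cis x', cis y')" using assms torus_cis by blast
  obtain g where g: "norm g = 1" "rho q = conj_by g (rho p)"
    using assms(3) by (auto simp: conj_class_eq_iff)
  have "g \<noteq> 0" using g by auto
  have tr: "qre (rho q \<gamma>) = qre (rho p \<gamma>)" for \<gamma>
    using qre_conj[OF \<open>g \<noteq> 0\<close>] by (simp add: g(2) conj_by_def del: quat_sel)
  have "cos x' = cos x" "cos y' = cos y" "cos (x' - y') = cos (x - y)"
    using tr[of "loop Ba \<cdot> loop Bb"] tr[of "loop Ba \<cdot> loop Bc"] tr[of "loop Bb \<cdot> loop Bc"]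
    by (simp_all add: p q SU2_hom_mult[OF rho_hom] rho_cis cos_diff)
  moreover from this have "(sin x')\<^sup>2 = (sin x)\<^sup>2" "(sin y')\<^sup>2 = (sin y)\<^sup>2" "sin x' * sin y' = sin x * sin y"
    by (simp_all add: sin_squared_eq cos_diff)
  \<comment> \<open>The squares leave two independent signs; the equality of the products ties them
    together.\<close>
  moreover from this have "sin x' = sin x \<and> sin y' = sin y \<or> sin x' = - sin x \<and> sin y' = - sin y"
    by (auto simp: power2_eq_iff)
  ultimately have "q = p \<or> q = iota p"
    by (auto simp: p q iota_cis complex_eq_iff)
  then show ?thesis by (auto simp: iota_orbit_iota)
qed

text \<open>As \<open>A\<close> and j both square to -1,
  \<open>(j + A) A = j A - 1 = j (j + A)\<close>: the bisector \<open>j + A\<close> conjugates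
  \<open>A\<close> to j. It vanishes only for \<open>A = - j\<close>, where i does the job.\<close>

lemma conj_to_quat_j:
  assumes "A \<in> J"
  obtains g where "g \<noteq> 0" "g * A * inverse g = quat_j"
proof -
  have A: "qre A = 0" and n: "norm A = 1" using assms by (auto simp: J_def)
  have "(qi A)\<^sup>2 + (qj A)\<^sup>2 + (qk A)\<^sup>2 = 1"
    using n A by (simp add: norm_quat_def)
  then have sq: "A * A = - 1"
    using A by (simp add: quat_eq_iff power2_eq_square)
  show ?thesis
  proof (cases "A = - quat_j")
    case True
    have i: "quat_i \<noteq> 0" by (simp add: quat_eq_iff quat_i_def)
    have "quat_i * A = quat_j * quat_i"
      by (simp add: True quat_eq_iff quat_i_def quat_j_def)
    then have "quat_i * A * inverse quat_i = quat_j" using i by (simp add: mult.assoc)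
    with i that show ?thesis by blast
  next
    case False
    then have nz: "quat_j + A \<noteq> 0" by (metis add.commute eq_neg_iff_add_eq_0)
    have "quat_j * quat_j = - 1" by (simp add: quat_eq_iff quat_j_def)
    then have "(quat_j + A) * A = quat_j * (quat_j + A)" by (simp add: sq algebra_simps)
    then have "(quat_j + A) * A * inverse (quat_j + A) = quat_j" using nz by (simp add: mult.assoc)
    with nz that show ?thesis by blast
  qed
qed

text \<open>Two linear equations with vanishing determinant have a common nonzero solution, read off
  from a nonzero pair of coefficients. The sign \<open>\<alpha> \<ge> 0\<close> keeps
  \<open>1 + \<alpha>\<close> from vanishing in the conjugator built from it.\<close>

lemma unit_normal_exists:
  fixes b1 b3 c1 c3 :: real
  assumes "b1 * c3 = b3 * c1"
  obtains \<alpha> \<beta> where "\<alpha>\<^sup>2 + \<beta>\<^sup>2 = 1" "\<alpha> \<ge> 0" "\<alpha> * b1 + \<beta> * b3 = 0" "\<alpha> * c1 + \<beta> * c3 = 0"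
proof -
  have "\<exists>u v. u\<^sup>2 + v\<^sup>2 \<noteq> 0 \<and> u * b1 + v * b3 = 0 \<and> u * c1 + v * c3 = 0"
  proof (cases "b1 = 0 \<and> b3 = 0")
    case True
    show ?thesis
    proof (cases "c1 = 0 \<and> c3 = 0")
      case False
      then show ?thesis using True by (intro exI[of _ c3] exI[of _ "- c1"]) auto
    qed (use True in \<open>auto intro!: exI[of _ 1]\<close>)
  next
    case False
    then show ?thesis using assms by (intro exI[of _ b3] exI[of _ "- b1"]) auto
  qed
  then obtain u v where uv: "u\<^sup>2 + v\<^sup>2 \<noteq> 0" "u * b1 + v * b3 = 0" "u * c1 + v * c3 = 0"
    by blast
  define r where "r = (if u \<ge> 0 then 1 else - 1) / sqrt (u\<^sup>2 + v\<^sup>2)"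
  have "u\<^sup>2 + v\<^sup>2 \<ge> 0" by simp
  then have "r\<^sup>2 * (u\<^sup>2 + v\<^sup>2) = 1" using uv(1) by (simp add: r_def power_divide)
  then have "(r * u)\<^sup>2 + (r * v)\<^sup>2 = 1" by (simp add: power_mult_distrib algebra_simps)
  moreover have "r * u \<ge> 0" by (auto simp: r_def intro!: divide_nonpos_nonneg)
  moreover have "(r * u) * b1 + (r * v) * b3 = r * (u * b1 + v * b3)"
    "(r * u) * c1 + (r * v) * c3 = r * (u * c1 + v * c3)" by (simp_all add: algebra_simps)
  ultimately show ?thesis using that uv by simp
qed

text \<open>Tracelessness of the image of \<open>d\<close> makes those of \<open>a\<close>, \<open>b\<close>, \<open>c\<close> coplanar. After moving the first to
  \<open>j\<close>, a rotation about \<open>j\<close> takes that plane to the span of \<open>j\<close> and \<open>k\<close>.\<close>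

lemma traceless_conj_rho:
  assumes "\<rho> \<in> traceless_homs"
  obtains p where "p \<in> torus" "conj_class \<rho> = conj_class (rho p)"
proof -
  have "\<rho> (loop Ba) \<in> J" using assms by (simp add: traceless_homs_def)
  then obtain g where g: "g \<noteq> 0" "g * \<rho> (loop Ba) * inverse g = quat_j"
    by (rule conj_to_quat_j)
  define \<sigma> where "\<sigma> = conj_by g \<rho>"
  have \<sigma>: "\<sigma> \<in> traceless_homs" unfolding \<sigma>_def by (rule conj_by_traceless[OF g(1) assms])
  have \<sigma>_hom: "\<sigma> \<in> hom pi1F SU2" and \<sigma>_J: "\<And>s. \<sigma> (loop s) \<in> J"
    using \<sigma> by (auto simp: traceless_homs_def)
  define B C where "B = \<sigma> (loop Bb)" and "C = \<sigma> (loop Bc)"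
  have a: "\<sigma> (loop Ba) = quat_j" by (simp add: \<sigma>_def conj_by_def g(2))
  have BC: "qre B = 0" "qre C = 0" using \<sigma>_J by (auto simp: B_def C_def J_def)
  have "norm (quat_j * B * C) = 1"
    using \<sigma>_J[of Ba] \<sigma>_J[of Bb] \<sigma>_J[of Bc] by (simp add: norm_mult a J_def B_def C_def)
  then have "qre (quat_j * B * C) = 0"
    using \<sigma>_J[of Bd] by (simp add: SU2_hom_Bd[OF \<sigma>_hom] a B_def[symmetric] C_def[symmetric] J_def
        inverse_unit_quat del: quat_sel)
  \<comment> \<open>The real part of a product of three imaginary quaternions is minus their triple
    product.\<close>
  then have "qi B * qk C = qk B * qi C"
    using BC by (simp add: quat_j_def algebra_simps)
  then obtain \<alpha> \<beta> where \<alpha>: "\<alpha>\<^sup>2 + \<beta>\<^sup>2 = 1" "\<alpha> \<ge> 0"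
    "\<alpha> * qi B + \<beta> * qk B = 0" "\<alpha> * qi C + \<beta> * qk C = 0"
    by (rule unit_normal_exists)
  \<comment> \<open>With \<open>\<alpha> = cos \<theta>\<close> and
    \<open>\<beta> = sin \<theta>\<close> this is a multiple of
    \<open>cos (\<theta>/2) + sin (\<theta>/2) j\<close>: the rotation about j that takes the normal
    \<open>\<alpha> quat_i + \<beta> quat_k\<close> to \<open>quat_i\<close>.\<close>
  define k where "k = Quat (1 + \<alpha>) 0 \<beta> 0"
  have k: "k \<noteq> 0" using \<alpha>(2) by (auto simp: k_def quat_eq_iff)
  have conj_k: "k * q * inverse k = (k * q * qcnj k) /\<^sub>R (norm k)\<^sup>2" for q
    by (simp add: inverse_quat_def)
  have qi0: "qi (k * q * inverse k) = 0" if "qre q = 0" "\<alpha> * qi q + \<beta> * qk q = 0" for q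
  proof -
    have "qi (k * q * qcnj k) = ((1 + \<alpha>)\<^sup>2 - \<beta>\<^sup>2) * qi q + 2 * (1 + \<alpha>) * \<beta> * qk q"
      using that(1) by (simp add: k_def power2_eq_square algebra_simps)
    also have "(1 + \<alpha>)\<^sup>2 - \<beta>\<^sup>2 = 2 * (1 + \<alpha>) * \<alpha>"
      using \<alpha>(1) by (simp add: power2_eq_square algebra_simps)
    also have "2 * (1 + \<alpha>) * \<alpha> * qi q + 2 * (1 + \<alpha>) * \<beta> * qk q = 2 * (1 + \<alpha>) * (\<alpha> * qi q + \<beta> * qk q)"
      by (simp add: algebra_simps)
    finally show ?thesis using that(2) unfolding conj_k quat_sel(20) by simp
  qed
  define \<tau> where "\<tau> = conj_by k \<sigma>"
  have \<tau>: "\<tau> \<in> traceless_homs" unfolding \<tau>_def by (rule conj_by_traceless[OF k \<sigma>])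
  have "k * quat_j = quat_j * k" by (simp add: quat_eq_iff k_def quat_j_def)
  then have \<tau>a: "\<tau> (loop Ba) = ej 0" using k by (simp add: \<tau>_def conj_by_def a ej_0) (simp add: mult.assoc)
  have ex: "\<exists>x. \<tau> (loop s) = ej x" if "s = Bb \<or> s = Bc" for s
  proof -
    have "\<tau> (loop s) \<in> J" using \<tau> by (auto simp: traceless_homs_def)
    then have J: "qre (\<tau> (loop s)) = 0" "norm (\<tau> (loop s)) = 1" by (auto simp: J_def)
    have i: "qi (\<tau> (loop s)) = 0"
      using that qi0[of B] qi0[of C] BC \<alpha> unfolding \<tau>_def conj_by_def B_def C_def by blast
    then have "(qj (\<tau> (loop s)))\<^sup>2 + (qk (\<tau> (loop s)))\<^sup>2 = 1"
      using J by (simp add: norm_quat_def)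
    then obtain x where "qj (\<tau> (loop s)) = cos x" "qk (\<tau> (loop s)) = sin x"
      using sincos_total_2pi by metis
    then show ?thesis using i J by (auto simp: quat_eq_iff)
  qed
  obtain x y where xy: "\<tau> (loop Bb) = ej x" "\<tau> (loop Bc) = ej y" using ex by blast
  have "\<tau> = rho (cis x, cis y)"
  proof (rule SU2_hom_eqI)
    show "\<tau> \<in> hom pi1F SU2" using \<tau> by (auto simp: traceless_homs_def)
    fix s assume "s \<noteq> Bd"
    then show "\<tau> (loop s) = rho (cis x, cis y) (loop s)"
      by (cases s) (simp_all add: rho_cis \<tau>a xy)
  qed (simp add: rho_hom)
  moreover have "conj_class \<tau> = conj_class \<rho>"
    by (simp add: \<tau>_def \<sigma>_def conj_class_conj_by g(1) k)
  ultimately show ?thesis using that cis_pair_torus by metis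
qed

text \<open>A quaternion commuting with j and with a vector of the plane not parallel to j is real,
  which leaves 1 and -1. At the four corners \<open>iota\<close> fixes \<open>p\<close>, and
  \<open>rho_iota\<close> then puts j into the stabiliser.\<close>

lemma rho_star_iff: "p \<in> torus \<Longrightarrow> rho p \<in> traceless_homs_star \<longleftrightarrow> p \<in> torus_star"
proof -
  assume "p \<in> torus"
  then obtain x y where p: "p = (cis x, cis y)" using torus_cis by blast
  let ?S = "{k \<in> carrier SU2. \<forall>\<gamma>. k * rho p \<gamma> * inverse k = rho p \<gamma>}"
  have pm: "{1, - 1} \<subseteq> ?S" by auto
  have "?S = {1, - 1}" if s: "sin x \<noteq> 0 \<or> sin y \<noteq> 0"
  proof
    show "?S \<subseteq> {1, - 1}"
    proof
      fix k assume k: "k \<in> ?S"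
      then have n: "norm k = 1" and "k \<noteq> 0" by auto
      have comm: "k * rho p \<gamma> = rho p \<gamma> * k" for \<gamma>
      proof -
        have "k * rho p \<gamma> = (k * rho p \<gamma> * inverse k) * k" using \<open>k \<noteq> 0\<close> by (simp add: mult.assoc)
        also have "\<dots> = rho p \<gamma> * k" using k by simp
        finally show ?thesis .
      qed
      have k13: "qi k = 0" "qk k = 0"
        using comm[of "loop Ba"] by (simp_all add: p rho_cis quat_eq_iff)
      have "qj k * sin x = 0" "qj k * sin y = 0"
        using comm[of "loop Bb"] comm[of "loop Bc"] k13 by (simp_all add: p rho_cis quat_eq_iff)
      with s have "qj k = 0" by auto
      with k13 n have "\<bar>qre k\<bar> = 1" by (simp add: norm_quat_def)
      then have "qre k = 1 \<or> qre k = - 1" by linarith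
      then show "k \<in> {1, - 1}" using k13 \<open>qj k = 0\<close> by (auto simp: quat_eq_iff)
    qed
  qed (rule pm)
  moreover have "?S \<noteq> {1, - 1}" if s: "sin x = 0" "sin y = 0"
  proof -
    have "iota p = p" using s by (simp add: p iota_cis complex_eq_iff)
    then have "conj_by quat_j (rho p) = rho p" using rho_iota[OF \<open>p \<in> torus\<close>] by simp
    moreover have "norm quat_j = 1" by (metis ej_0 norm_ej)
    ultimately have "quat_j \<in> ?S" by (auto simp: conj_by_def fun_eq_iff)
    moreover have "quat_j \<notin> {1, - 1}" by (simp add: quat_eq_iff quat_j_def)
    ultimately show ?thesis by blast
  qed
  ultimately show ?thesis
    using rho_traceless[OF \<open>p \<in> torus\<close>] unfolding traceless_homs_star_def
    by (auto simp: p torus_star_cis)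
qed

lemma traceless_star_conj_rho:
  assumes "\<rho> \<in> traceless_homs_star"
  obtains p where "p \<in> torus_star" "conj_class \<rho> = conj_class (rho p)"
proof -
  have "\<rho> \<in> traceless_homs" using assms by (simp add: traceless_homs_star_def)
  then obtain p where p: "p \<in> torus" "conj_class \<rho> = conj_class (rho p)"
    by (rule traceless_conj_rho)
  then obtain g where g: "norm g = 1" "rho p = conj_by g \<rho>" by (auto simp: conj_class_eq_iff)
  then have "g \<noteq> 0" by auto
  then have "rho p \<in> traceless_homs_star" using g assms conj_by_traceless_star by simp
  then show ?thesis using that p rho_star_iff by blast
qed

section \<open>Parabolic cohomology\<close>

lemma su2_pair_simps:
  "su2_pair (u + v) w = su2_pair u w + su2_pair v w"
  "su2_pair u (v + w) = su2_pair u v + su2_pair u w"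
  "su2_pair (u - v) w = su2_pair u w - su2_pair v w"
  "su2_pair u (v - w) = su2_pair u v - su2_pair u w"
  "su2_pair (- u) v = - su2_pair u v" "su2_pair u (- v) = - su2_pair u v"
  "su2_pair (r *\<^sub>R u) v = r * su2_pair u v" "su2_pair u (r *\<^sub>R v) = r * su2_pair u v"
  "su2_pair 0 v = 0" "su2_pair u 0 = 0"
  by (simp_all add: su2_pair_def algebra_simps)

lemma su2_pair_conj: "g \<noteq> 0 \<Longrightarrow> su2_pair (g * v * inverse g) (g * w * inverse g) = su2_pair v w"
proof -
  assume "g \<noteq> 0"
  then have "(g * v * inverse g) * (g * w * inverse g) = g * (v * w) * inverse g"
    by (simp add: mult.assoc) (simp add: mult.assoc[symmetric])
  then show ?thesis
    using qre_conj[OF \<open>g \<noteq> 0\<close>, of "v * w"] by (simp only: su2_pair_def)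
qed

lemma su2_pair_Ad: "\<rho> \<in> hom pi1F SU2 \<Longrightarrow> su2_pair (Ad \<rho> \<gamma> v) (Ad \<rho> \<gamma> w) = su2_pair v w"
  by (simp add: Ad_def su2_pair_conj SU2_hom_nonzero)

text \<open>Conjugation by an imaginary unit quaternion is the half turn about it.\<close>

lemma J_reflection:
  assumes "q \<in> J" "v \<in> su2" "su2_pair v q = 0"
  shows "q * v * inverse q = - v"
proof -
  have "q * v = - v * q"
    using assms by (simp add: J_def su2_def su2_pair_def quat_eq_iff algebra_simps)
  moreover have "q \<noteq> 0" using assms(1) by (auto simp: J_def)
  ultimately show ?thesis by (simp add: mult.assoc)
qed

text \<open>The half turn fixes its axis \<open>q\<close>, so \<open>v\<close> and its image have
  the same component along \<open>q\<close>.\<close>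

lemma J_coboundary_orthogonal: "q \<in> J \<Longrightarrow> su2_pair (q * v * inverse q - v) q = 0"
proof -
  assume "q \<in> J"
  then have "q \<noteq> 0" by (auto simp: J_def)
  then have "su2_pair (q * v * inverse q) q = su2_pair (q * v * inverse q) (q * q * inverse q)"
    by (simp add: mult.assoc)
  then show ?thesis using su2_pair_conj[OF \<open>q \<noteq> 0\<close>, of v q] by (simp add: su2_pair_simps)
qed

lemma J_pair_conj:
  assumes "q \<in> J" "w \<in> su2" "su2_pair w q = 0"
  shows "su2_pair (q * v * inverse q) w = - su2_pair v w" "su2_pair w (q * v * inverse q) = - su2_pair w v"
proof -
  have "q \<noteq> 0" using assms(1) by (auto simp: J_def)
  have "q * (- w) * inverse q = w" using J_reflection[OF assms] by simp
  then show "su2_pair (q * v * inverse q) w = - su2_pair v w" "su2_pair w (q * v * inverse q) = - su2_pair w v"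
    using su2_pair_conj[OF \<open>q \<noteq> 0\<close>, of v "- w"] su2_pair_conj[OF \<open>q \<noteq> 0\<close>, of "- w" v]
    by (simp_all add: su2_pair_simps)
qed

lemma traceless_hom: "\<rho> \<in> traceless_homs \<Longrightarrow> \<rho> \<in> hom pi1F SU2"
  and traceless_J: "\<rho> \<in> traceless_homs \<Longrightarrow> \<rho> (loop s) \<in> J"
  by (auto simp: traceless_homs_def)

text \<open>These are the parabolic cocycles, whose restrictions to the boundary circles are
  coboundaries: for the half turn about \<open>\<rho> (loop s)\<close>, the image of
  \<open>Ad - 1\<close> on \<open>su2\<close> is the plane orthogonal to the axis. In this form the
  condition is linear and free of primitives.\<close>

definition Z1_par :: "(surface_group \<Rightarrow> quat) \<Rightarrow> (surface_group \<Rightarrow> quat) set" where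
  "Z1_par \<rho> = {z \<in> Z1 \<rho>. \<forall>s. su2_pair (z (loop s)) (\<rho> (loop s)) = 0}"

definition par_form ::
    "(surface_group \<Rightarrow> quat) \<Rightarrow> (surface_group \<Rightarrow> quat) \<Rightarrow> (surface_group \<Rightarrow> quat) \<Rightarrow> real" where
  "par_form \<rho> z w = (\<Sum>x\<leftarrow>fundamental_chain. cup \<rho> z w x)
     + (\<Sum>s\<in>UNIV. su2_pair (z (loop s)) (w (loop s))) / 2"

lemma sum_bdry: "(\<Sum>s\<in>UNIV. f s) = f Ba + f Bb + f Bc + f Bd" for f :: "bdry \<Rightarrow> real"
proof -
  have U: "(UNIV :: bdry set) = {Ba, Bb, Bc, Bd}" using bdry.exhaust by blast
  show ?thesis unfolding U by simp
qed

lemma Z1_par_Z1: "z \<in> Z1_par \<rho> \<Longrightarrow> z \<in> Z1 \<rho>"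
  by (simp add: Z1_par_def)

lemma Z1_par_Ad:
  assumes "\<rho> \<in> traceless_homs" "z \<in> Z1_par \<rho>"
  shows "Ad \<rho> (loop s) (z (loop s)) = - z (loop s)"
    and "su2_pair (Ad \<rho> (loop s) v) (z (loop s)) = - su2_pair v (z (loop s))"
    and "su2_pair (z (loop s)) (Ad \<rho> (loop s) v) = - su2_pair (z (loop s)) v"
  using assms traceless_J[OF assms(1), of s] Z1_su2[OF Z1_par_Z1[OF assms(2)]]
  unfolding Ad_def by (simp_all add: Z1_par_def J_reflection J_pair_conj)

lemma cobdry0_Z1_par:
  "\<rho> \<in> traceless_homs \<Longrightarrow> u \<in> su2 \<Longrightarrow> cobdry0 \<rho> u \<in> Z1_par \<rho>"
  using cobdry0_Z1[OF traceless_hom] J_coboundary_orthogonal[OF traceless_J]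
  by (simp add: Z1_par_def cobdry0_def Ad_def)

lemma Z1_diff: "z \<in> Z1 \<rho> \<Longrightarrow> w \<in> Z1 \<rho> \<Longrightarrow> (\<lambda>\<gamma>. z \<gamma> - w \<gamma>) \<in> Z1 \<rho>"
  by (auto simp: Z1_def cobdry1_def Ad_diff su2_def image_subset_iff algebra_simps)

lemma Z1_par_diff: "z \<in> Z1_par \<rho> \<Longrightarrow> w \<in> Z1_par \<rho> \<Longrightarrow> (\<lambda>\<gamma>. z \<gamma> - w \<gamma>) \<in> Z1_par \<rho>"
  using Z1_diff by (auto simp: Z1_par_def su2_pair_simps)

lemma Z1_rel_par:
  assumes "\<rho> \<in> traceless_homs" "(z, v) \<in> Z1_rel \<rho>"
  shows "z \<in> Z1_par \<rho>" "z (loop s) = cobdry0 \<rho> (v s) (loop s)" "v s \<in> su2"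
proof -
  show z: "z (loop s) = cobdry0 \<rho> (v s) (loop s)" "v s \<in> su2" for s
    using assms(2) generate.incl[of "loop s" "{loop s}" pi1F] by (auto simp: Z1_rel_def)
  show "z \<in> Z1_par \<rho>"
    using assms(2) J_coboundary_orthogonal[OF traceless_J[OF assms(1)]]
    by (auto simp: Z1_par_def Z1_rel_def z(1) cobdry0_def Ad_def)
qed

lemma Z1_par_rel:
  assumes "\<rho> \<in> traceless_homs" "z \<in> Z1_par \<rho>"
  shows "(z, \<lambda>s. - ((1 / 2) *\<^sub>R z (loop s))) \<in> Z1_rel \<rho>"
proof -
  have z: "z \<in> Z1 \<rho>" by (rule Z1_par_Z1[OF assms(2)])
  note hom = traceless_hom[OF assms(1)]
  have v: "- ((1 / 2) *\<^sub>R z (loop s)) \<in> su2" for s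
    using Z1_su2[OF z, of "loop s"] by (simp add: su2_def)
  have "z \<gamma> = cobdry0 \<rho> (- ((1 / 2) *\<^sub>R z (loop s))) \<gamma>" if "\<gamma> \<in> generate pi1F {loop s}" for \<gamma> s
  proof -
    define w where "w = cobdry0 \<rho> (- ((1 / 2) *\<^sub>R z (loop s)))"
    have w: "w \<in> Z1 \<rho>" unfolding w_def by (rule cobdry0_Z1[OF hom v])
    have "Ad \<rho> (loop s) ((1 / 2) *\<^sub>R z (loop s)) = (1 / 2) *\<^sub>R Ad \<rho> (loop s) (z (loop s))"
      by (simp add: Ad_def)
    then have s: "z (loop s) = w (loop s)"
      by (simp add: w_def cobdry0_def Ad_minus Z1_par_Ad(1)[OF assms] scaleR_left.add[symmetric])
    \<comment> \<open>Two cocycles that agree on \<open>loop s\<close> agree on the cyclic subgroup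
      it generates.\<close>
    from that have "z \<gamma> = w \<gamma>"
      by induction (use s in \<open>simp_all add: Z1_one[OF hom z] Z1_one[OF hom w] Z1_inv[OF hom z]
          Z1_inv[OF hom w] Z1_mult[OF z] Z1_mult[OF w]\<close>)
    then show ?thesis by (simp add: w_def)
  qed
  then show ?thesis using z v by (simp add: Z1_rel_def)
qed

text \<open>A primitive \<open>v s\<close> is unique up to multiples of
  \<open>\<rho> (loop s)\<close>, to which \<open>w (loop s)\<close> is orthogonal, so its choice
  does not matter. As the half turn negates \<open>w (loop s)\<close>, pairing
  \<open>Ad v - v\<close> with it gives \<open>- 2\<close> times the pairing with
  \<open>v\<close>.\<close>

lemma rel_form_eq:
  assumes "\<rho> \<in> traceless_homs" "(z, v) \<in> Z1_rel \<rho>" "(w, v') \<in> Z1_rel \<rho>"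
  shows "rel_form \<rho> (z, v) (w, v') = par_form \<rho> z w"
proof -
  have w: "w \<in> Z1_par \<rho>" by (rule Z1_rel_par(1)[OF assms(1,3)])
  have "su2_pair (z (loop s)) (w (loop s)) = - 2 * su2_pair (v s) (w (loop s))" for s
    by (simp add: Z1_rel_par(2)[OF assms(1,2)] cobdry0_def su2_pair_simps Z1_par_Ad[OF assms(1) w])
  then show ?thesis
    by (simp add: rel_form_def par_form_def sum_bdry)
qed

text \<open>The boundary of the fundamental chain, tested on a real 1-cochain; it turns chain sums
  of coboundaries into boundary terms.\<close>

lemma chain_boundary:
  "(\<Sum>x\<leftarrow>fundamental_chain. f (snd x) - f (fst x \<cdot> snd x) + f (fst x)) =
    f (loop Ba) + f (loop Bb) + f (loop Bc) + f (loop Bd)" for f :: "surface_group \<Rightarrow> real"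
  using loop_relation by (simp add: fundamental_chain_def monoid.l_one[OF group.is_monoid[OF group_pi1F]])

text \<open>The cup product of the coboundary of \<open>u\<close> with \<open>w\<close> is the
  coboundary of the real cochain \<open>?f\<close>, so the chain sum is the sum of
  \<open>su2_pair u (w (loop s))\<close>. The pairing at each boundary loop is \<open>- 2\<close>
  times that term, and the factor 1/2 in \<open>par_form\<close> makes the two cancel.\<close>

lemma par_form_cobdry_left:
  assumes "\<rho> \<in> traceless_homs" "w \<in> Z1_par \<rho>"
  shows "par_form \<rho> (cobdry0 \<rho> u) w = 0"
proof -
  let ?f = "\<lambda>\<gamma>. su2_pair u (w \<gamma>)"
  have "cup \<rho> (cobdry0 \<rho> u) w x = ?f (snd x) - ?f (fst x \<cdot> snd x) + ?f (fst x)" for x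
    by (simp add: cup_def cobdry0_def su2_pair_simps su2_pair_Ad[OF traceless_hom[OF assms(1)]]
        Z1_mult[OF Z1_par_Z1[OF assms(2)]] split: prod.split)
  then show ?thesis
    using chain_boundary[of ?f]
    by (simp add: par_form_def sum_bdry cobdry0_def su2_pair_simps Z1_par_Ad[OF assms] diff_divide_distrib)
qed

lemma par_form_cobdry_right:
  assumes "\<rho> \<in> traceless_homs" "z \<in> Z1_par \<rho>"
  shows "par_form \<rho> z (cobdry0 \<rho> u) = 0"
proof -
  note hom = traceless_hom[OF assms(1)]
  let ?f = "\<lambda>\<gamma>. - su2_pair (z \<gamma>) (Ad \<rho> \<gamma> u)"
  have "cup \<rho> z (cobdry0 \<rho> u) x = ?f (snd x) - ?f (fst x \<cdot> snd x) + ?f (fst x)" for x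
    by (simp add: cup_def cobdry0_def su2_pair_simps su2_pair_Ad[OF hom] Ad_diff Ad_mult[OF hom]
        Z1_mult[OF Z1_par_Z1[OF assms(2)]] split: prod.split)
  then show ?thesis
    using chain_boundary[of ?f]
    by (simp add: par_form_def sum_bdry cobdry0_def su2_pair_simps Z1_par_Ad[OF assms] diff_divide_distrib)
qed

lemma par_form_diff_left:
  "par_form \<rho> (\<lambda>\<gamma>. z \<gamma> - z' \<gamma>) w = par_form \<rho> z w - par_form \<rho> z' w"
  and par_form_diff_right:
  "par_form \<rho> z (\<lambda>\<gamma>. w \<gamma> - w' \<gamma>) = par_form \<rho> z w - par_form \<rho> z w'"
  by (simp_all add: par_form_def cup_def su2_pair_simps Ad_diff fundamental_chain_def sum_bdry field_simps)

section \<open>Cohomology classes and the form on them\<close>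

lemma equiv_cohomologous: "equiv (Z1 \<rho>) (cohomologous \<rho>)"
proof (rule equivI)
  have "0 \<in> su2" by (simp add: su2_def)
  then show "refl_on (Z1 \<rho>) (cohomologous \<rho>)"
    by (auto simp: refl_on_def cohomologous_def cobdry0_def intro!: bexI[of _ 0])
  have "\<exists>u\<in>su2. \<forall>\<gamma>. z \<gamma> - z' \<gamma> = cobdry0 \<rho> u \<gamma>"
    if "u \<in> su2" "\<forall>\<gamma>. z' \<gamma> - z \<gamma> = cobdry0 \<rho> u \<gamma>" for z z' u
    using that by (intro bexI[of _ "- u"]) (auto simp: su2_def cobdry0_def Ad_minus algebra_simps)
  then show "sym (cohomologous \<rho>)"
    by (auto simp: sym_def cohomologous_def)
  have "\<exists>u\<in>su2. \<forall>\<gamma>. z'' \<gamma> - z \<gamma> = cobdry0 \<rho> u \<gamma>"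
    if "u \<in> su2" "\<forall>\<gamma>. z' \<gamma> - z \<gamma> = cobdry0 \<rho> u \<gamma>" "v \<in> su2" "\<forall>\<gamma>. z'' \<gamma> - z' \<gamma> = cobdry0 \<rho> v \<gamma>"
    for z z' z'' u v
  proof (intro bexI[of _ "u + v"] allI)
    fix \<gamma>
    have "z'' \<gamma> - z \<gamma> = (z'' \<gamma> - z' \<gamma>) + (z' \<gamma> - z \<gamma>)" by simp
    also have "\<dots> = cobdry0 \<rho> (u + v) \<gamma>"
      using that by (simp only:) (simp add: cobdry0_def Ad_add)
    finally show "z'' \<gamma> - z \<gamma> = cobdry0 \<rho> (u + v) \<gamma>" .
  qed (use that in \<open>simp add: su2_def\<close>)
  then show "trans (cohomologous \<rho>)"
    by (auto simp: trans_def cohomologous_def)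
qed (auto simp: cohomologous_def)

lemma H1_class_eq_iff:
  "z \<in> Z1 \<rho> \<Longrightarrow> z' \<in> Z1 \<rho> \<Longrightarrow> H1_class \<rho> z = H1_class \<rho> z' \<longleftrightarrow> (z, z') \<in> cohomologous \<rho>"
  unfolding H1_class_def by (rule eq_equiv_class_iff[OF equiv_cohomologous])

lemma H1_class_eqI:
  assumes "z \<in> Z1 \<rho>" "z' \<in> Z1 \<rho>" "u \<in> su2" "\<And>\<gamma>. z' \<gamma> - z \<gamma> = cobdry0 \<rho> u \<gamma>"
  shows "H1_class \<rho> z = H1_class \<rho> z'"
  using assms by (auto simp: H1_class_eq_iff cohomologous_def)

lemma H1_class_cohomologous_rel:
  assumes "((z, v), (z', v')) \<in> cohomologous_rel \<rho>"
  shows "H1_class \<rho> z = H1_class \<rho> z'"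
proof -
  have "(z, z') \<in> cohomologous \<rho>"
    using assms unfolding cohomologous_rel_def cohomologous_def Z1_rel_def by blast
  moreover from this have "z \<in> Z1 \<rho>" "z' \<in> Z1 \<rho>" by (auto simp: cohomologous_def)
  ultimately show ?thesis by (simp add: H1_class_eq_iff)
qed

lemma rel_to_abs_class:
  assumes "(z, v) \<in> Z1_rel \<rho>"
  shows "rel_to_abs \<rho> (cohomologous_rel \<rho> `` {(z, v)}) = H1_class \<rho> z"
proof -
  have "0 \<in> su2" by (simp add: su2_def)
  then have "(z, v) \<in> cohomologous_rel \<rho> `` {(z, v)}"
    using assms by (auto simp: cohomologous_rel_def cobdry0_def)
  moreover have "H1_class \<rho> z' = H1_class \<rho> z" if "(z', v') \<in> cohomologous_rel \<rho> `` {(z, v)}" for z' v'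
    using H1_class_cohomologous_rel[of z v z' v'] that by simp
  ultimately show ?thesis unfolding rel_to_abs_def by fast
qed

lemma H1_rel_memD:
  assumes "X \<in> H1_rel \<rho>" "(z, v) \<in> X"
  shows "(z, v) \<in> Z1_rel \<rho>" "rel_to_abs \<rho> X = H1_class \<rho> z"
proof -
  obtain z0 v0 where X: "(z0, v0) \<in> Z1_rel \<rho>" "X = cohomologous_rel \<rho> `` {(z0, v0)}"
    using assms(1) by (auto simp: H1_rel_def quotient_def)
  then show "(z, v) \<in> Z1_rel \<rho>" using assms(2) by (auto simp: cohomologous_rel_def)
  have "H1_class \<rho> z0 = H1_class \<rho> z"
    using H1_class_cohomologous_rel[of z0 v0 z v] assms(2) X(2) by simp
  then show "rel_to_abs \<rho> X = H1_class \<rho> z" using rel_to_abs_class[OF X(1)] X(2) by simp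
qed

lemma H1_hat_eq:
  assumes "\<rho> \<in> traceless_homs"
  shows "H1_hat \<rho> = H1_class \<rho> ` Z1_par \<rho>"
proof
  show "H1_hat \<rho> \<subseteq> H1_class \<rho> ` Z1_par \<rho>"
    using Z1_rel_par(1)[OF assms] rel_to_abs_class
    by (fastforce simp: H1_hat_def H1_rel_def quotient_def)
  show "H1_class \<rho> ` Z1_par \<rho> \<subseteq> H1_hat \<rho>"
    using Z1_par_rel[OF assms] rel_to_abs_class
    by (fastforce simp: H1_hat_def H1_rel_def intro: quotientI image_eqI)
qed

text \<open>Two facts make the description in \<open>omega_hat\<close> definite: \<open>inv\<close>,
  that all choices of representatives give the same number, and \<open>ex\<close>, that there are
  representatives at all, without which every \<open>r\<close> would qualify.\<close>

lemma omega_hat_eq: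
  assumes "\<rho> \<in> traceless_homs" "z \<in> Z1_par \<rho>" "w \<in> Z1_par \<rho>"
  shows "omega_hat \<rho> (H1_class \<rho> z) (H1_class \<rho> w) = par_form \<rho> z w"
proof -
  have inv: "rel_form \<rho> x y = par_form \<rho> z w"
    if "X \<in> H1_rel \<rho>" "Y \<in> H1_rel \<rho>" "rel_to_abs \<rho> X = H1_class \<rho> z" "rel_to_abs \<rho> Y = H1_class \<rho> w"
      "x \<in> X" "y \<in> Y" for X Y x y
  proof -
    obtain z1 v1 w1 v2 where xy: "x = (z1, v1)" "y = (w1, v2)" by fastforce
    have zr: "(z1, v1) \<in> Z1_rel \<rho>" and wr: "(w1, v2) \<in> Z1_rel \<rho>"
      and "H1_class \<rho> z1 = H1_class \<rho> z" "H1_class \<rho> w1 = H1_class \<rho> w"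
      using H1_rel_memD[OF that(1), of z1 v1] H1_rel_memD[OF that(2), of w1 v2] that xy by auto
    moreover note z1 = Z1_rel_par(1)[OF assms(1) zr] and w1 = Z1_rel_par(1)[OF assms(1) wr]
    ultimately have "(z1, z) \<in> cohomologous \<rho>" "(w1, w) \<in> cohomologous \<rho>"
      using assms Z1_par_Z1 H1_class_eq_iff by blast+
    then obtain u u' where "\<And>\<gamma>. z \<gamma> - z1 \<gamma> = cobdry0 \<rho> u \<gamma>" "\<And>\<gamma>. w \<gamma> - w1 \<gamma> = cobdry0 \<rho> u' \<gamma>"
      by (auto simp: cohomologous_def)
    then have u: "(\<lambda>\<gamma>. z \<gamma> - z1 \<gamma>) = cobdry0 \<rho> u" "(\<lambda>\<gamma>. w \<gamma> - w1 \<gamma>) = cobdry0 \<rho> u'"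
      by auto
    have "par_form \<rho> z w - par_form \<rho> z1 w = 0"
      unfolding par_form_diff_left[symmetric] u by (rule par_form_cobdry_left[OF assms(1,3)])
    moreover have "par_form \<rho> z1 w - par_form \<rho> z1 w1 = 0"
      unfolding par_form_diff_right[symmetric] u by (rule par_form_cobdry_right[OF assms(1) z1])
    ultimately show ?thesis using rel_form_eq[OF assms(1) zr wr] xy by simp
  qed
  have ex: "\<exists>X x. X \<in> H1_rel \<rho> \<and> rel_to_abs \<rho> X = H1_class \<rho> z \<and> x \<in> X" if "z \<in> Z1_par \<rho>" for z
  proof -
    let ?x = "(z, \<lambda>s. - ((1 / 2) *\<^sub>R z (loop s)))"
    have "?x \<in> Z1_rel \<rho>" by (rule Z1_par_rel[OF assms(1) that])
    moreover have "0 \<in> su2" by (simp add: su2_def)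
    ultimately have "?x \<in> cohomologous_rel \<rho> `` {?x}"
      by (auto simp: cohomologous_rel_def cobdry0_def)
    moreover have "cohomologous_rel \<rho> `` {?x} \<in> H1_rel \<rho>"
      unfolding H1_rel_def by (rule quotientI) fact
    ultimately show ?thesis
      using rel_to_abs_class[OF \<open>?x \<in> Z1_rel \<rho>\<close>] by blast
  qed
  show ?thesis
    unfolding omega_hat_def
  proof (rule the_equality)
    fix r
    assume "\<forall>X'\<in>H1_rel \<rho>. \<forall>Y'\<in>H1_rel \<rho>. rel_to_abs \<rho> X' = H1_class \<rho> z \<and> rel_to_abs \<rho> Y' = H1_class \<rho> w
      \<longrightarrow> (\<forall>x\<in>X'. \<forall>y\<in>Y'. rel_form \<rho> x y = r)"
    with ex[OF assms(2)] ex[OF assms(3)] inv show "r = par_form \<rho> z w"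
      by metis
  qed (use inv in blast)
qed

section \<open>Transport of cocycles and of the form within a conjugacy class\<close>

lemma Ad_conj_by:
  "g \<noteq> 0 \<Longrightarrow> \<rho> \<in> hom pi1F SU2 \<Longrightarrow> Ad (conj_by g \<rho>) \<gamma> (g * v * inverse g) = g * Ad \<rho> \<gamma> v * inverse g"
proof -
  assume g: "g \<noteq> 0" and "\<rho> \<in> hom pi1F SU2"
  then have "\<rho> \<gamma> \<noteq> 0" by (simp add: SU2_hom_nonzero)
  moreover have "inverse g * (g * q) = q" for q using g by (simp add: mult.assoc[symmetric])
  ultimately show ?thesis
    using g by (simp add: Ad_def conj_by_def nonzero_inverse_mult_distrib mult.assoc)
qed

lemma conj_by_cobdry0:
  "g \<noteq> 0 \<Longrightarrow> \<rho> \<in> hom pi1F SU2 \<Longrightarrow> conj_by g (cobdry0 \<rho> u) = cobdry0 (conj_by g \<rho>) (g * u * inverse g)"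
  by (rule ext) (simp add: cobdry0_def Ad_conj_by, simp add: conj_by_def cobdry0_def algebra_simps)

lemma conj_by_su2: "g \<noteq> 0 \<Longrightarrow> v \<in> su2 \<Longrightarrow> g * v * inverse g \<in> su2"
  by (simp add: su2_def qre_conj del: quat_sel)

lemma conj_by_Z1:
  assumes "g \<noteq> 0" "\<rho> \<in> hom pi1F SU2" "z \<in> Z1 \<rho>"
  shows "conj_by g z \<in> Z1 (conj_by g \<rho>)"
proof -
  have "conj_by g z \<gamma> \<in> su2" for \<gamma>
    using conj_by_su2[OF assms(1) Z1_su2[OF assms(3)]] by (simp add: conj_by_def)
  moreover have "cobdry1 (conj_by g \<rho>) (conj_by g z) \<gamma> \<mu> = g * cobdry1 \<rho> z \<gamma> \<mu> * inverse g" for \<gamma> \<mu>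
    using Ad_conj_by[OF assms(1,2)] by (simp add: cobdry1_def conj_by_def algebra_simps)
  ultimately show ?thesis using assms(3) by (auto simp: Z1_def)
qed

lemma conj_by_Z1_par:
  assumes "g \<noteq> 0" "\<rho> \<in> hom pi1F SU2" "z \<in> Z1_par \<rho>"
  shows "conj_by g z \<in> Z1_par (conj_by g \<rho>)"
  using conj_by_Z1[OF assms(1,2) Z1_par_Z1[OF assms(3)]] assms su2_pair_conj[OF assms(1)]
  by (simp add: Z1_par_def) (simp add: conj_by_def)

lemma par_form_conj_by:
  assumes "g \<noteq> 0" "\<rho> \<in> hom pi1F SU2"
  shows "par_form (conj_by g \<rho>) (conj_by g z) (conj_by g w) = par_form \<rho> z w"
proof -
  have "cup (conj_by g \<rho>) (conj_by g z) (conj_by g w) x = cup \<rho> z w x" for x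
    using Ad_conj_by[OF assms] su2_pair_conj[OF assms(1)]
    by (simp add: cup_def split: prod.split) (simp add: conj_by_def)
  moreover have "su2_pair (conj_by g z \<gamma>) (conj_by g w \<gamma>) = su2_pair (z \<gamma>) (w \<gamma>)" for \<gamma>
    using su2_pair_conj[OF assms(1)] by (simp add: conj_by_def)
  ultimately show ?thesis by (simp add: par_form_def)
qed

section \<open>Tangent spaces along the pillowcase\<close>

definition line_rep :: "real \<Rightarrow> real \<Rightarrow> real \<times> real \<Rightarrow> real \<Rightarrow> surface_group \<Rightarrow> quat" where
  "line_rep x y u = (\<lambda>t. rho (cis (x + t * fst u), cis (y + t * snd u)))"

text \<open>The derivative of \<open>rho\<close> at angles \<open>(x, y)\<close> in direction
  \<open>u\<close>, kept as a cocycle so that it can be evaluated on loops.\<close>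

definition line_cocycle :: "real \<Rightarrow> real \<Rightarrow> real \<times> real \<Rightarrow> surface_group \<Rightarrow> quat" where
  "line_cocycle x y u = velocity_cocycle (line_rep x y u)"

lemma line_rep_hom: "line_rep x y u t \<in> hom pi1F SU2"
  by (simp add: line_rep_def rho_hom)

lemma line_rep_0: "line_rep x y u 0 = rho (cis x, cis y)"
  by (simp add: line_rep_def)

lemma ej_decomp: "ej x = cos x *\<^sub>R quat_j + sin x *\<^sub>R quat_k"
  by (simp add: quat_eq_iff quat_j_def quat_k_def)

lemma ej_has_vector_derivative:
  "((\<lambda>t. ej (x + t * r)) has_vector_derivative r *\<^sub>R (- sin x *\<^sub>R quat_j + cos x *\<^sub>R quat_k)) (at 0)"
proof -
  have "((\<lambda>t. cos (x + t * r) *\<^sub>R quat_j + sin (x + t * r) *\<^sub>R quat_k) has_vector_derivative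
      (- sin x * r) *\<^sub>R quat_j + (cos x * r) *\<^sub>R quat_k) (at 0)"
    by (auto intro!: derivative_eq_intros simp: has_real_derivative_iff_has_vector_derivative[symmetric])
  then show ?thesis by (simp add: ej_decomp scaleR_diff_right mult.commute)
qed

text \<open>The shape \<open>0 + t * 0\<close> and the grouping at \<open>Bd\<close> make all four
  loops instances of one derivative formula, that of \<open>ej (x + t * r)\<close>.\<close>

lemma line_rep_loops:
  "line_rep x y u t (loop Ba) = ej (0 + t * 0)"
  "line_rep x y u t (loop Bb) = ej (x + t * fst u)"
  "line_rep x y u t (loop Bc) = ej (y + t * snd u)"
  "line_rep x y u t (loop Bd) = ej ((y - x) + t * (snd u - fst u))"
  by (simp_all add: line_rep_def rho_cis algebra_simps)

text \<open>The factor j cancels in the quotient and leaves the logarithmic derivative of e^{i(x +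
  tr)}, which is independent of \<open>x\<close>.\<close>

lemma ej_logarithmic_derivative:
  "vector_derivative (\<lambda>t. ej (x + t * r)) (at 0) * inverse (ej x) = r *\<^sub>R quat_i"
proof -
  have "r * (cos x * cos x) + r * (sin x * sin x) = r"
    by (metis distrib_left mult.right_neutral power2_eq_square sin_cos_squared_add2)
  then show ?thesis
    unfolding vector_derivative_at[OF ej_has_vector_derivative]
    by (simp add: quat_eq_iff quat_i_def quat_j_def quat_k_def algebra_simps)
qed

lemma line_cocycle_loops:
  "line_cocycle x y u (loop Ba) = 0"
  "line_cocycle x y u (loop Bb) = fst u *\<^sub>R quat_i"
  "line_cocycle x y u (loop Bc) = snd u *\<^sub>R quat_i"
  "line_cocycle x y u (loop Bd) = (snd u - fst u) *\<^sub>R quat_i"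
  using ej_logarithmic_derivative[of 0 0] ej_logarithmic_derivative[of x "fst u"]
    ej_logarithmic_derivative[of y "snd u"] ej_logarithmic_derivative[of "y - x" "snd u - fst u"]
  by (simp_all only: line_cocycle_def velocity_cocycle_def line_rep_loops line_rep_0 rho_cis scaleR_zero_left)

lemma line_rep_differentiable: "(\<lambda>t. generator_values (line_rep x y u t)) differentiable at 0"
proof -
  have "(\<lambda>t. ej (x + t * r)) differentiable at 0" for x r
    using ej_has_vector_derivative by (rule differentiableI_vector)
  then show ?thesis unfolding line_rep_loops by (intro differentiable_Pair)
qed

lemma line_cocycle_Z1_par: "line_cocycle x y u \<in> Z1_par (rho (cis x, cis y))"
proof -
  have "line_cocycle x y u \<in> Z1 (rho (cis x, cis y))"
    using velocity_cocycle_Z1[OF line_rep_hom line_rep_differentiable, of x y u]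
    by (simp add: line_cocycle_def line_rep_0)
  moreover have "su2_pair (line_cocycle x y u (loop s)) (rho (cis x, cis y) (loop s)) = 0" for s
    by (cases s) (simp_all add: line_cocycle_loops rho_cis su2_pair_def quat_i_def)
  ultimately show ?thesis by (simp add: Z1_par_def)
qed

lemma Ad_ej: "ej x * (r *\<^sub>R quat_i) * inverse (ej x) = - (r *\<^sub>R quat_i)"
  by (rule J_reflection) (simp_all add: J_def su2_def su2_pair_def quat_i_def)

lemma par_form_line_cocycle:
  "par_form (rho (cis x, cis y)) (line_cocycle x y u) (line_cocycle x y v) =
    - (1 / 2) * (fst u * snd v - snd u * fst v)"
proof -
  let ?r = "rho (cis x, cis y)" and ?z = "line_cocycle x y"
  note hom = rho_hom[OF cis_pair_torus, of x y]
  note Z1 = Z1_par_Z1[OF line_cocycle_Z1_par, of x y]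
  have Ad: "Ad ?r (loop s) (r *\<^sub>R quat_i) = - (r *\<^sub>R quat_i)" for s r
    unfolding Ad_def by (cases s) (simp_all only: rho_cis Ad_ej)
  have ab: "?z u (loop Ba \<cdot> loop Bb) = - (fst u *\<^sub>R quat_i)"
    by (simp add: Z1_mult[OF Z1] line_cocycle_loops Ad)
  have abc: "?z u (loop Ba \<cdot> loop Bb \<cdot> loop Bc) = (snd u - fst u) *\<^sub>R quat_i"
    by (simp add: Z1_mult[OF Z1, of _ _ "loop Bc"] ab line_cocycle_loops Ad_mult[OF hom] Ad Ad_minus
        scaleR_left_diff_distrib)
  have ii: "su2_pair quat_i quat_i = 1" by (simp add: su2_pair_def quat_i_def)
  have one: "?z u pi1_one = 0" by (rule Z1_one[OF hom Z1])
  \<comment> \<open>The pair (a, b) gives nothing, as the cocycle vanishes on a. Every loop negates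
    multiples of i, so \<open>Ad\<close> of ab is the identity on them and \<open>Ad\<close> of abc
    is -1; hence the terms from (ab, c) and (abc, d). The fraction is the boundary
    correction.\<close>
  have "par_form ?r (?z u) (?z v) = - (fst u * snd v) - (snd u - fst u) * (snd v - fst v)
      + (fst u * fst v + snd u * snd v + (snd u - fst u) * (snd v - fst v)) / 2"
    by (simp only: par_form_def fundamental_chain_def cup_def list.map sum_list.Cons sum_list.Nil
        prod.case sum_bdry ab abc one line_cocycle_loops Ad_mult[OF hom] Ad Ad_minus Ad_zero
        su2_pair_simps ii) (simp add: algebra_simps)
  then show ?thesis by (simp add: algebra_simps add_divide_distrib diff_divide_distrib)
qed

lemma Ad_scaleR: "Ad \<rho> \<gamma> (r *\<^sub>R v) = r *\<^sub>R Ad \<rho> \<gamma> v"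
  by (simp add: Ad_def)

lemma ej_quarter: "ej (x + pi / 2) = Quat 0 0 (- sin x) (cos x)"
  by (simp add: ej_def cos_add sin_add)

text \<open>The half turn about \<open>ej x\<close> takes \<open>ej 0\<close> to
  \<open>ej (2 * x)\<close>; the chord between them is orthogonal to \<open>ej x\<close>, of signed
  length \<open>2 * sin x\<close>.\<close>

lemma Ad_ej_perp: "ej x * (r *\<^sub>R ej 0) * inverse (ej x) - r *\<^sub>R ej 0
    = (2 * r * sin x) *\<^sub>R ej (x + pi / 2)"
proof -
  have "ej x * (r *\<^sub>R ej 0) * inverse (ej x) = r *\<^sub>R ej (2 * x)"
    by (simp add: ej_mult3)
  then show ?thesis
    unfolding ej_quarter by (simp add: quat_eq_iff cos_double_sin sin_double power2_eq_square)
      (simp add: algebra_simps)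
qed

text \<open>Modulo coboundaries one may assume that \<open>z\<close> vanishes on \<open>a\<close>. Then \<open>z\<close> has components along \<open>i\<close>,
  and components along \<open>i \<rho>(b)\<close>, \<open>i \<rho>(c)\<close> which the condition at \<open>d\<close> forces to be proportional to
  \<open>sin x\<close>, \<open>sin y\<close>; the coboundary of a multiple of \<open>j\<close> removes the latter.\<close>

lemma line_cocycle_surj:
  assumes s: "sin x \<noteq> 0 \<or> sin y \<noteq> 0" and z: "z \<in> Z1_par (rho (cis x, cis y))"
  obtains u v where "v \<in> su2" "\<And>\<gamma>. z \<gamma> - line_cocycle x y u \<gamma> = cobdry0 (rho (cis x, cis y)) v \<gamma>"
proof -
  let ?r = "rho (cis x, cis y)"
  note hom = rho_hom[OF cis_pair_torus, of x y]
  have tr: "?r \<in> traceless_homs" by (rule rho_traceless) simp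
  \<comment> \<open>\<open>Ad\<close> of a negates the value of \<open>z\<close> on a, so the
    coboundary of minus half that value agrees with \<open>z\<close> on a.\<close>
  define v0 where "v0 = - ((1 / 2) *\<^sub>R z (loop Ba))"
  have v0: "v0 \<in> su2"
    using Z1_su2[OF Z1_par_Z1[OF z], of "loop Ba"] by (simp add: v0_def su2_def)
  define w where "w = (\<lambda>\<gamma>. z \<gamma> - cobdry0 ?r v0 \<gamma>)"
  have w: "w \<in> Z1_par ?r"
    unfolding w_def by (rule Z1_par_diff[OF z cobdry0_Z1_par[OF tr v0]])
  note w1 = Z1_par_Z1[OF w]
  have "Ad ?r (loop Ba) ((1 / 2) *\<^sub>R z (loop Ba)) = (1 / 2) *\<^sub>R Ad ?r (loop Ba) (z (loop Ba))"
    by (simp add: Ad_def)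
  then have wa: "w (loop Ba) = 0"
    by (simp add: w_def v0_def cobdry0_def Ad_minus Z1_par_Ad(1)[OF tr z] scaleR_left.add[symmetric])
  let ?n = "\<lambda>x. ej (x + pi / 2)"
  \<comment> \<open>\<open>quat_i\<close> and \<open>?n t\<close> are an orthonormal basis of the
    plane orthogonal to \<open>ej t\<close> in \<open>su2\<close>.\<close>
  have decomp: "q = qi q *\<^sub>R quat_i + (cos t * qk q - sin t * qj q) *\<^sub>R ?n t"
    if "q \<in> su2" "su2_pair q (ej t) = 0" for q t
  proof -
    have e: "qj q * cos t + qk q * sin t = 0" and "qre q = 0"
      using that by (simp_all add: su2_def su2_pair_def)
    have "qj q = (sin t * qj q - cos t * qk q) * sin t + (qj q * cos t + qk q * sin t) * cos t"
      using sin_cos_squared_add3[of t] by algebra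
    moreover have "qk q = (cos t * qk q - sin t * qj q) * cos t + (qj q * cos t + qk q * sin t) * sin t"
      using sin_cos_squared_add3[of t] by algebra
    ultimately show ?thesis
      using e \<open>qre q = 0\<close> unfolding ej_quarter by (simp add: quat_eq_iff quat_i_def algebra_simps)
  qed
  define u where "u = (qi (w (loop Bb)), qi (w (loop Bc)))"
  have perp: "su2_pair (w (loop s)) (?r (loop s)) = 0" for s
    using w by (simp add: Z1_par_def)
  obtain \<beta> where wb: "w (loop Bb) = fst u *\<^sub>R quat_i + \<beta> *\<^sub>R ?n x"
    using decomp[of "w (loop Bb)" x] perp[of Bb] Z1_su2[OF w1] by (auto simp: u_def rho_cis)
  obtain \<gamma> where wc: "w (loop Bc) = snd u *\<^sub>R quat_i + \<gamma> *\<^sub>R ?n y"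
    using decomp[of "w (loop Bc)" y] perp[of Bc] Z1_su2[OF w1] by (auto simp: u_def rho_cis)
  \<comment> \<open>Because abcd = 1, the value of \<open>w\<close> on abc is minus
    \<open>Ad\<close> of abc applied to its value on d, and \<open>Ad\<close> of abc fixes the image
    of d. The parabolic condition at d thus becomes a condition on abc, hence on the values on b and
    c.\<close>
  have proportional: "\<gamma> * sin x = \<beta> * sin y"
  proof -
    have "Ad ?r (loop Ba \<cdot> loop Bb \<cdot> loop Bc) (w (loop Bd)) = - w (loop Ba \<cdot> loop Bb \<cdot> loop Bc)"
      using Z1_mult[OF w1, of "loop Ba \<cdot> loop Bb \<cdot> loop Bc" "loop Bd"] Z1_one[OF hom w1]
      by (simp add: loop_relation eq_neg_iff_add_eq_0 add.commute)
    moreover have "Ad ?r (loop Ba \<cdot> loop Bb \<cdot> loop Bc) (?r (loop Bd)) = ?r (loop Bd)"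
      using SU2_hom_nonzero[OF hom] by (simp add: Ad_def SU2_hom_mult[OF hom] rho_cis ej_mult3)
    ultimately have "su2_pair (w (loop Ba \<cdot> loop Bb \<cdot> loop Bc)) (?r (loop Bd)) = 0"
      using su2_pair_Ad[OF hom, of "loop Ba \<cdot> loop Bb \<cdot> loop Bc" "w (loop Bd)" "?r (loop Bd)"] w
      by (simp add: Z1_par_def su2_pair_simps)
    moreover have "w (loop Ba \<cdot> loop Bb \<cdot> loop Bc) =
        (snd u - fst u) *\<^sub>R quat_i + \<beta> *\<^sub>R ej (- x - pi / 2) + \<gamma> *\<^sub>R ej (y - 2 * x + pi / 2)"
    proof -
      have Ad_i: "Ad ?r (loop s) quat_i = - quat_i" for s
        using Ad_ej[of _ 1] unfolding Ad_def by (cases s) (simp_all only: rho_cis scaleR_one)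
      have Ad_a: "Ad ?r (loop Ba) (ej t) = ej (- t)" and Ad_b: "Ad ?r (loop Bb) (ej t) = ej (2 * x - t)" for t
        by (simp_all add: Ad_def rho_cis ej_mult3)
      have "w (loop Ba \<cdot> loop Bb \<cdot> loop Bc) =
          Ad ?r (loop Ba) (w (loop Bb)) + Ad ?r (loop Ba) (Ad ?r (loop Bb) (w (loop Bc)))"
        by (simp add: Z1_mult[OF w1] wa Ad_mult[OF hom])
      also have "Ad ?r (loop Ba) (w (loop Bb)) = - (fst u *\<^sub>R quat_i) + \<beta> *\<^sub>R ej (- x - pi / 2)"
        unfolding wb by (simp add: Ad_add Ad_scaleR Ad_i Ad_a)
      also have "Ad ?r (loop Ba) (Ad ?r (loop Bb) (w (loop Bc))) = snd u *\<^sub>R quat_i + \<gamma> *\<^sub>R ej (y - 2 * x + pi / 2)"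
        unfolding wc by (simp add: Ad_add Ad_diff Ad_scaleR Ad_i Ad_minus Ad_a Ad_b algebra_simps)
      finally show ?thesis by (simp add: algebra_simps)
    qed
    moreover have "su2_pair quat_i (ej t) = 0" "su2_pair (ej s) (ej t) = cos (s - t)" for s t
      by (simp_all add: su2_pair_def quat_i_def cos_diff)
    moreover have "cos (- x - pi / 2 - (y - x)) = - sin y" "cos (y - 2 * x + pi / 2 - (y - x)) = sin x"
      by (simp_all add: cos_diff cos_add sin_add)
    ultimately show ?thesis by (simp add: su2_pair_simps rho_cis)
  qed
  \<comment> \<open>Away from the corners one of the sines is nonzero and determines
    \<open>t\<close>; proportionality then yields the other equation.\<close>
  obtain t where t: "2 * t * sin x = \<beta>" "2 * t * sin y = \<gamma>"
  proof (cases "sin x = 0")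
    case True
    with s proportional that[of "\<gamma> / (2 * sin y)"] show ?thesis by simp
  next
    case False
    with proportional that[of "\<beta> / (2 * sin x)"] show ?thesis by (simp add: field_simps)
  qed
  define v where "v = v0 + t *\<^sub>R ej 0"
  have v: "v \<in> su2" using v0 by (simp add: v_def su2_def)
  have "(\<lambda>\<gamma>. z \<gamma> - cobdry0 ?r v \<gamma>) = line_cocycle x y u"
  proof (rule Z1_eqI[OF hom])
    show "(\<lambda>\<gamma>. z \<gamma> - cobdry0 ?r v \<gamma>) \<in> Z1 ?r"
      by (rule Z1_diff[OF Z1_par_Z1[OF z] cobdry0_Z1[OF hom v]])
    show "line_cocycle x y u \<in> Z1 ?r" by (rule Z1_par_Z1[OF line_cocycle_Z1_par])
    have "z \<gamma> - cobdry0 ?r v \<gamma> = w \<gamma> - cobdry0 ?r (t *\<^sub>R ej 0) \<gamma>" for \<gamma>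
      by (simp add: w_def v_def cobdry0_def Ad_add algebra_simps)
    moreover have "cobdry0 ?r (t *\<^sub>R ej 0) (loop Ba) = 0"
      "cobdry0 ?r (t *\<^sub>R ej 0) (loop Bb) = \<beta> *\<^sub>R ?n x"
      "cobdry0 ?r (t *\<^sub>R ej 0) (loop Bc) = \<gamma> *\<^sub>R ?n y"
      unfolding cobdry0_def Ad_def rho_cis Ad_ej_perp t by simp_all
    ultimately show "z (loop s) - cobdry0 ?r v (loop s) = line_cocycle x y u (loop s)" if "s \<noteq> Bd" for s
      using that by (cases s) (simp_all add: wa wb wc line_cocycle_loops)
  qed
  then have "z \<gamma> - line_cocycle x y u \<gamma> = cobdry0 ?r v \<gamma>" for \<gamma>
    by (metis diff_diff_eq2 add_diff_cancel_left' add.commute)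
  with that v show ?thesis by blast
qed

text \<open>The candidate for the differential of \<open>rho_hat\<close>, read in the lift
  conjugated by \<open>g\<close>; \<open>symplectomorphism\<close> quantifies over all lifts, so
  \<open>g\<close> stays arbitrary.\<close>

definition tangent_map :: "quat \<Rightarrow> real \<Rightarrow> real \<Rightarrow> real \<times> real \<Rightarrow> (surface_group \<Rightarrow> quat) set" where
  "tangent_map g x y u = H1_class (conj_by g (rho (cis x, cis y))) (conj_by g (line_cocycle x y u))"

lemma omega_hat_tangent_map:
  assumes "g \<noteq> 0"
  shows "omega_hat (conj_by g (rho (cis x, cis y))) (tangent_map g x y u) (tangent_map g x y v)
    = - (1 / 2) * (fst u * snd v - snd u * fst v)"
proof -
  note hom = rho_hom[OF cis_pair_torus, of x y]
  show ?thesis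
    unfolding tangent_map_def
    by (subst omega_hat_eq)
      (simp_all add: conj_by_traceless rho_traceless conj_by_Z1_par assms hom line_cocycle_Z1_par
        par_form_conj_by par_form_line_cocycle)
qed

text \<open>Equal images have equal pairings with every other image; testing the area form against
  \<open>(1, 0)\<close> and \<open>(0, 1)\<close> recovers both coordinates, which gives
  injectivity. Surjectivity is \<open>line_cocycle_surj\<close> after undoing the
  conjugation.\<close>

lemma tangent_map_bij:
  assumes g: "g \<noteq> 0" and s: "sin x \<noteq> 0 \<or> sin y \<noteq> 0"
  shows "bij_betw (tangent_map g x y) UNIV (H1_hat (conj_by g (rho (cis x, cis y))))"
  unfolding bij_betw_def
proof
  let ?r = "rho (cis x, cis y)"
  note hom = rho_hom[OF cis_pair_torus, of x y]
  have tr: "conj_by g ?r \<in> traceless_homs" by (simp add: conj_by_traceless rho_traceless g)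
  show "inj (tangent_map g x y)"
  proof (rule injI)
    fix u v assume "tangent_map g x y u = tangent_map g x y v"
    then have "fst u * snd w - snd u * fst w = fst v * snd w - snd v * fst w" for w
      using omega_hat_tangent_map[OF g, of x y u w] omega_hat_tangent_map[OF g, of x y v w] by simp
    from this[of "(1, 0)"] this[of "(0, 1)"] show "u = v" by (simp add: prod_eq_iff)
  qed
  show "range (tangent_map g x y) = H1_hat (conj_by g ?r)"
  proof
    show "range (tangent_map g x y) \<subseteq> H1_hat (conj_by g ?r)"
      unfolding H1_hat_eq[OF tr] tangent_map_def
      using conj_by_Z1_par[OF g hom line_cocycle_Z1_par] by blast
    show "H1_hat (conj_by g ?r) \<subseteq> range (tangent_map g x y)"
    proof
      fix X assume "X \<in> H1_hat (conj_by g ?r)"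
      then obtain z where z: "z \<in> Z1_par (conj_by g ?r)" "X = H1_class (conj_by g ?r) z"
        by (auto simp: H1_hat_eq[OF tr])
      define z0 where "z0 = conj_by (inverse g) z"
      have "z0 \<in> Z1_par (conj_by (inverse g) (conj_by g ?r))"
        unfolding z0_def by (rule conj_by_Z1_par) (use g z tr traceless_hom in auto)
      then have "z0 \<in> Z1_par ?r" by (simp add: conj_by_inverse g)
      then obtain u v where uv: "v \<in> su2" "\<And>\<gamma>. z0 \<gamma> - line_cocycle x y u \<gamma> = cobdry0 ?r v \<gamma>"
        using line_cocycle_surj[OF s] by metis
      have "H1_class (conj_by g ?r) (conj_by g (line_cocycle x y u)) = H1_class (conj_by g ?r) z"
      proof (rule H1_class_eqI)
        show "conj_by g (line_cocycle x y u) \<in> Z1 (conj_by g ?r)"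
          by (rule conj_by_Z1[OF g hom Z1_par_Z1[OF line_cocycle_Z1_par]])
        show "z \<in> Z1 (conj_by g ?r)" by (rule Z1_par_Z1[OF z(1)])
        show "g * v * inverse g \<in> su2" by (rule conj_by_su2[OF g uv(1)])
        have "conj_by g z0 = z" by (simp add: z0_def conj_by_inverse g)
        then show "z \<gamma> - conj_by g (line_cocycle x y u) \<gamma>
            = cobdry0 (conj_by g ?r) (g * v * inverse g) \<gamma>" for \<gamma>
          using uv(2)[of \<gamma>] unfolding conj_by_cobdry0[OF g hom, symmetric]
          by (simp add: conj_by_def fun_eq_iff) (metis left_diff_distrib right_diff_distrib)
      qed
      then show "X \<in> range (tangent_map g x y)" by (auto simp: z(2) tangent_map_def)
    qed
  qed
qed

section \<open>The action of the modular group on the character variety\<close>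

lemma chi_rho: "chi = (\<lambda>p. conj_class (rho p)) ` torus"
proof
  show "chi \<subseteq> (\<lambda>p. conj_class (rho p)) ` torus"
  proof
    fix X assume "X \<in> chi"
    then obtain \<rho> where "\<rho> \<in> traceless_homs" "X = conj_class \<rho>" by (auto simp: chi_def)
    then show "X \<in> (\<lambda>p. conj_class (rho p)) ` torus" using traceless_conj_rho by blast
  qed
qed (auto simp: chi_def rho_traceless)

lemma chi_member:
  assumes "X \<in> chi" "\<rho> \<in> X"
  shows "\<rho> \<in> traceless_homs" "X = conj_class \<rho>"
proof -
  obtain \<sigma> where \<sigma>: "\<sigma> \<in> traceless_homs" "X = conj_class \<sigma>" using assms(1) by (auto simp: chi_def)
  then obtain g where g: "norm g = 1" "\<rho> = conj_by g \<sigma>" using assms(2) by (auto simp: conj_class_eq)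
  then have "g \<noteq> 0" by auto
  with g \<sigma> show "\<rho> \<in> traceless_homs" "X = conj_class \<rho>"
    by (simp_all add: conj_by_traceless conj_class_conj_by)
qed

lemma Union_chi: "\<Union>chi = traceless_homs"
proof
  show "\<Union>chi \<subseteq> traceless_homs" using chi_member(1) by blast
  show "traceless_homs \<subseteq> \<Union>chi" unfolding chi_def using conj_class_self by blast
qed

lemma rho_fibre:
  assumes "p \<in> torus"
  shows "{q \<in> torus. conj_class (rho q) = conj_class (rho p)} = iota_orbit p"
proof
  show "{q \<in> torus. conj_class (rho q) = conj_class (rho p)} \<subseteq> iota_orbit p"
  proof
    fix q assume "q \<in> {q \<in> torus. conj_class (rho q) = conj_class (rho p)}"
    then have "iota_orbit q = iota_orbit p" using assms conj_class_rho_inj by blast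
    then show "q \<in> iota_orbit p" by (auto simp: iota_orbit_def)
  qed
  show "iota_orbit p \<subseteq> {q \<in> torus. conj_class (rho q) = conj_class (rho p)}"
    using assms conj_class_rho_iota iota_torus by (auto simp: iota_orbit_def)
qed

text \<open>Transport along \<open>rho_hat\<close>: the whole set of torus points above
  \<open>X\<close> is moved and mapped back, so no lift is chosen. The restriction to
  \<open>chi\<close> is there because members of \<open>BijGroup chi\<close> are
  extensional.\<close>

definition psl_action :: "(int^2^2) set \<Rightarrow> (surface_group \<Rightarrow> quat) set \<Rightarrow> (surface_group \<Rightarrow> quat) set" where
  "psl_action g = (\<lambda>X\<in>chi. rho_hat (PSL2Z_act g {p \<in> torus. conj_class (rho p) = X}))"

lemma PSL2Z_act_iota_orbit:
  assumes "p \<in> torus"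
  shows "PSL2Z_act (psl M) (iota_orbit p) = iota_orbit (SL2Z_act M p)"
proof -
  have "PSL2Z_act (psl M) (iota_orbit p) =
      {SL2Z_act M p, SL2Z_act M (iota p), SL2Z_act (- M) p, SL2Z_act (- M) (iota p)}"
    unfolding PSL2Z_act_def psl_def iota_orbit_def by blast
  then show ?thesis
    using assms by (auto simp: iota_orbit_def SL2Z_act_uminus SL2Z_act_iota iota_torus iota_iota)
qed

lemma psl_action_rho:
  assumes "p \<in> torus"
  shows "psl_action (psl M) (conj_class (rho p)) = conj_class (rho (SL2Z_act M p))"
proof -
  have "conj_class (rho p) \<in> chi" using assms by (auto simp: chi_rho)
  then show ?thesis
    using assms by (simp add: psl_action_def rho_fibre PSL2Z_act_iota_orbit rho_hat_iota_orbit SL2Z_act_torus)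
qed

lemma psl_action_equivariant:
  "p \<in> torus \<Longrightarrow> rho_hat (PSL2Z_act (psl M) (iota_orbit p)) = psl_action (psl M) (rho_hat (iota_orbit p))"
  by (simp add: PSL2Z_act_iota_orbit rho_hat_iota_orbit SL2Z_act_torus psl_action_rho)

lemma psl_action_mult:
  assumes "X \<in> chi"
  shows "psl_action (psl (M ** N)) X = psl_action (psl M) (psl_action (psl N) X)"
  using assms by (auto simp: chi_rho psl_action_rho SL2Z_act_torus SL2Z_act_mult)

lemma psl_action_one: "X \<in> chi \<Longrightarrow> psl_action (psl (mat 1)) X = X"
  by (auto simp: chi_rho psl_action_rho SL2Z_act_one)

lemma psl_action_closed: "X \<in> chi \<Longrightarrow> psl_action (psl M) X \<in> chi"
  by (auto simp: chi_rho psl_action_rho SL2Z_act_torus)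

lemma psl_action_inverse:
  assumes "M \<in> carrier SL2Z" "X \<in> chi"
  shows "psl_action (psl (mat2_adj M)) (psl_action (psl M) X) = X"
    and "psl_action (psl M) (psl_action (psl (mat2_adj M)) X) = X"
  using assms psl_action_one by (simp_all add: psl_action_mult[symmetric] mat2_adj)

lemma psl_action_hom: "psl_action \<in> hom PSL2Z (BijGroup chi)"
proof -
  have Bij: "psl_action (psl M) \<in> Bij chi" if "M \<in> carrier SL2Z" for M
  proof -
    have "bij_betw (psl_action (psl M)) chi chi"
      by (rule bij_betw_byWitness[where f' = "psl_action (psl (mat2_adj M))"])
        (use that psl_action_inverse psl_action_closed in auto)
    then show ?thesis by (simp add: Bij_def psl_action_def)
  qed
  show ?thesis
  proof (rule homI)
    fix g assume "g \<in> carrier PSL2Z"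
    then show "psl_action g \<in> carrier (BijGroup chi)"
      using Bij by (auto simp: PSL2Z_carrier BijGroup_def)
  next
    fix g k assume "g \<in> carrier PSL2Z" "k \<in> carrier PSL2Z"
    then obtain M N where MN: "M \<in> carrier SL2Z" "N \<in> carrier SL2Z" "g = psl M" "k = psl N"
      by (auto simp: PSL2Z_carrier)
    have "psl_action (psl (M ** N)) = compose chi (psl_action (psl M)) (psl_action (psl N))"
    proof
      fix X
      show "psl_action (psl (M ** N)) X = compose chi (psl_action (psl M)) (psl_action (psl N)) X"
        by (cases "X \<in> chi") (simp_all add: psl_action_mult compose_def, simp add: psl_action_def)
    qed
    then show "psl_action (g \<otimes>\<^bsub>PSL2Z\<^esub> k) = psl_action g \<otimes>\<^bsub>BijGroup chi\<^esub> psl_action k"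
      using Bij MN by (simp add: PSL2Z_mult BijGroup_def)
  qed
qed

lemma psl_group_hom: "group_hom PSL2Z (BijGroup chi) psl_action"
  by (simp add: group_hom_def group_hom_axioms_def group_PSL2Z group_BijGroup psl_action_hom)

lemma realizes_traceless:
  assumes h: "realizes h M" and \<rho>: "\<rho> \<in> traceless_homs"
  obtains g p where "g \<noteq> 0" "p \<in> torus" "\<rho> = conj_by g (rho p)" "\<rho> \<circ> h = conj_by g (rho (SL2Z_act M p))"
proof -
  obtain p where p: "p \<in> torus" "conj_class \<rho> = conj_class (rho p)" using traceless_conj_rho[OF \<rho>] .
  from p(2) obtain g where g: "norm g = 1" "\<rho> = conj_by g (rho p)" by (metis conj_class_eq_iff)
  have "g \<noteq> 0" using g by auto
  moreover have "\<rho> \<circ> h = conj_by g (rho (SL2Z_act M p))"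
    using h p g(2) by (simp add: conj_by_comp realizes_def)
  ultimately show ?thesis using that p g by blast
qed

lemma realizes_traceless_homs:
  "realizes h M \<Longrightarrow> \<rho> \<in> traceless_homs \<Longrightarrow> \<rho> \<circ> h \<in> traceless_homs"
  by (erule (1) realizes_traceless) (simp add: conj_by_traceless rho_traceless SL2Z_act_torus)

lemma psl_action_realizes:
  assumes "realizes h M" "\<rho> \<in> traceless_homs"
  shows "psl_action (psl M) (conj_class \<rho>) = conj_class (\<rho> \<circ> h)"
  using assms by (rule realizes_traceless) (simp add: conj_class_conj_by psl_action_rho)

text \<open>Conjugation commutes with precomposition, so \<open>h\<close> acts on classes, and on
  that of \<open>rho p\<close> it acts as \<open>M\<close>. For the half twists this identifies the
  transported action with the geometric one.\<close>

lemma psl_action_eq_pullback: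
  assumes "realizes h M"
  shows "psl_action (psl M) = pullback h"
proof
  fix X
  show "psl_action (psl M) X = pullback h X"
  proof (cases "X \<in> chi")
    case True
    then obtain \<rho> where \<rho>: "\<rho> \<in> traceless_homs" "X = conj_class \<rho>" by (auto simp: chi_def)
    have "(\<lambda>\<sigma>. \<sigma> \<circ> h) ` conj_class \<rho> = conj_class (\<rho> \<circ> h)"
      by (auto simp: conj_class_eq conj_by_comp image_def)
    then show ?thesis using True \<rho> psl_action_realizes[OF assms] by (simp add: pullback_def)
  qed (simp add: psl_action_def pullback_def)
qed

lemma psl_action_generated:
  "psl_action ` carrier PSL2Z = generate (BijGroup chi) {pullback half_twist1, pullback half_twist2}"
proof -
  have "(\<lambda>M. psl_action (psl M)) \<in> hom SL2Z (BijGroup chi)"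
    using psl_action_hom PSL2Z_mult by (auto simp: hom_def PSL2Z_carrier Pi_def)
  then have "group_hom SL2Z (BijGroup chi) (\<lambda>M. psl_action (psl M))"
    by (simp add: group_hom_def group_hom_axioms_def group_SL2Z group_BijGroup)
  from group_hom.generate_img[OF this SL2Z_gens] show ?thesis
    by (simp add: SL2Z_generated PSL2Z_carrier image_image
        psl_action_eq_pullback[OF half_twist1_realizes] psl_action_eq_pullback[OF half_twist2_realizes])
qed

subsection \<open>Continuity\<close>

lemma openin_chi_top: "openin chi_top U \<longleftrightarrow> U \<subseteq> chi \<and> openin (top_of_set traceless_homs) (\<Union>U)"
proof -
  have "istopology (\<lambda>U. U \<subseteq> chi \<and> openin (top_of_set traceless_homs) (\<Union>U))"
  proof -
    \<comment> \<open>Classes are disjoint, so a point of both unions lies in a common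
      class.\<close>
    have "\<Union>(S \<inter> T) = \<Union>S \<inter> \<Union>T" if "S \<subseteq> chi" "T \<subseteq> chi" for S T
      using that chi_member(2) by (auto; blast)
    moreover have "\<Union>(\<Union>\<K>) = \<Union>(Union ` \<K>)" for \<K> :: "(surface_group \<Rightarrow> quat) set set set" by auto
    moreover have "openin (top_of_set traceless_homs) (\<Union>(Union ` \<K>))"
      if "\<forall>K\<in>\<K>. K \<subseteq> chi \<and> openin (top_of_set traceless_homs) (\<Union>K)" for \<K>
      using that by (intro openin_Union) auto
    ultimately show ?thesis
      by (auto simp: istopology_def intro: openin_Int)
  qed
  then show ?thesis by (simp add: chi_top_def)
qed

lemma topspace_chi_top: "topspace chi_top = chi"
proof -
  have "openin chi_top chi" by (simp add: openin_chi_top Union_chi)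
  then show ?thesis by (auto simp: topspace_def openin_chi_top)
qed

text \<open>The action is covered by composition with a realising \<open>h\<close>, which is
  continuous for pointwise convergence, and the preimage of a saturated open set is again saturated
  and open.\<close>

lemma psl_action_continuous:
  assumes "M \<in> carrier SL2Z"
  shows "continuous_map chi_top chi_top (psl_action (psl M))"
proof -
  obtain h where h: "realizes h M" using realizes_exists[OF assms] .
  have cont: "continuous_on traceless_homs (\<lambda>\<rho>. \<rho> \<circ> h)"
    unfolding o_def
    by (intro continuous_on_coordinatewise_then_product continuous_on_subset[OF continuous_on_product_coordinates]) simp
  have "openin chi_top {X \<in> chi. psl_action (psl M) X \<in> U}" if U: "openin chi_top U" for U
  proof -
    have "\<Union>{X \<in> chi. psl_action (psl M) X \<in> U} = {\<rho> \<in> traceless_homs. \<rho> \<circ> h \<in> \<Union>U}"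
    proof (intro equalityI subsetI)
      fix \<rho> assume "\<rho> \<in> \<Union>{X \<in> chi. psl_action (psl M) X \<in> U}"
      then obtain X where X: "X \<in> chi" "\<rho> \<in> X" "psl_action (psl M) X \<in> U" by blast
      from chi_member[OF X(1,2)] X show "\<rho> \<in> {\<rho> \<in> traceless_homs. \<rho> \<circ> h \<in> \<Union>U}"
        using psl_action_realizes[OF h] conj_class_self by auto
    next
      fix \<rho> assume "\<rho> \<in> {\<rho> \<in> traceless_homs. \<rho> \<circ> h \<in> \<Union>U}"
      then obtain Y where Y: "\<rho> \<in> traceless_homs" "Y \<in> U" "\<rho> \<circ> h \<in> Y" by blast
      have "Y \<in> chi" using U Y by (auto simp: openin_chi_top)
      then have "Y = conj_class (\<rho> \<circ> h)" using Y chi_member by blast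
      then have "psl_action (psl M) (conj_class \<rho>) \<in> U" using Y psl_action_realizes[OF h] by simp
      then show "\<rho> \<in> \<Union>{X \<in> chi. psl_action (psl M) X \<in> U}"
        using Y conj_class_self by (auto simp: chi_def)
    qed
    moreover have "openin (top_of_set traceless_homs) (traceless_homs \<inter> (\<lambda>\<rho>. \<rho> \<circ> h) -` \<Union>U)"
      using U realizes_traceless_homs[OF h]
      by (intro continuous_openin_preimage[OF cont, of traceless_homs]) (auto simp: openin_chi_top)
    ultimately show ?thesis by (auto simp: openin_chi_top vimage_def Int_def)
  qed
  then show ?thesis
    using psl_action_closed by (auto simp: continuous_map_def topspace_chi_top)
qed

lemma psl_action_homeomorphic:
  assumes "M \<in> carrier SL2Z"
  shows "homeomorphic_map chi_top chi_top (psl_action (psl M))"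
proof (rule homeomorphic_maps_imp_map)
  show "homeomorphic_maps chi_top chi_top (psl_action (psl M)) (psl_action (psl (mat2_adj M)))"
    using assms mat2_adj(1)[OF assms] psl_action_inverse[OF assms]
    by (simp add: homeomorphic_maps_def psl_action_continuous topspace_chi_top)
qed

section \<open>The pillowcase chart\<close>

lemma points_pillowcase: "points (pillowcase_star c) = iota_orbit ` torus_star"
  by (simp add: points_def pillowcase_star_def)

lemma chi_star_rho: "conj_class ` traceless_homs_star = (\<lambda>p. conj_class (rho p)) ` torus_star"
proof (intro equalityI subsetI)
  fix X assume "X \<in> conj_class ` traceless_homs_star"
  then obtain \<rho> where "\<rho> \<in> traceless_homs_star" "X = conj_class \<rho>" by blast
  then show "X \<in> (\<lambda>p. conj_class (rho p)) ` torus_star" using traceless_star_conj_rho by blast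
qed (auto simp: rho_star_iff torus_star_torus)

lemma points_chi_star: "points chi_star = (\<lambda>p. conj_class (rho p)) ` torus_star"
  using chi_star_rho by (simp add: points_def chi_star_def)

lemma rho_hat_bij: "bij_betw rho_hat (points (pillowcase_star c)) (points chi_star)"
proof (rule bij_betw_imageI)
  show "inj_on rho_hat (points (pillowcase_star c))"
    using conj_class_rho_inj torus_star_torus
    by (auto simp: inj_on_def points_pillowcase rho_hat_iota_orbit)
  show "rho_hat ` points (pillowcase_star c) = points chi_star"
    using torus_star_torus
    by (simp add: points_pillowcase points_chi_star rho_hat_iota_orbit image_image cong: image_cong)
qed

section \<open>Smoothness of the parametrisation and of its inverse\<close>

lemma bounded_linear_quat_of_complex: "bounded_linear quat_of_complex"
  by (auto simp: linear_conv_bounded_linear[symmetric] quat_of_complex_def quat_eq_iff intro!: linearI)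

lemma bounded_linear_conj: "bounded_linear (\<lambda>q::quat. g * q * inverse g)"
  by (auto simp: linear_conv_bounded_linear[symmetric] algebra_simps intro!: linearI)

lemma smooth_on_rho_coords:
  "open U \<Longrightarrow> smooth_on U f \<Longrightarrow> smooth_on U (\<lambda>x. quat_of_complex (f x) * quat_j)"
  by (intro smooth_on_mult smooth_on_linear[OF bounded_linear_quat_of_complex]) auto

lemma smooth_map_rho_hat: "smooth_map (pillowcase_star c) chi_star rho_hat"
  unfolding smooth_map_def
proof
  fix s assume "s \<in> lifts (pillowcase_star c)"
  let ?h = "\<lambda>p::complex \<times> complex.
    (quat_j, quat_of_complex (fst p) * quat_j, quat_of_complex (snd p) * quat_j)"
  have "smooth_on UNIV ?h"
    by (intro smooth_on_Pair smooth_on_rho_coords smooth_on_fst smooth_on_snd smooth_on_id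
        smooth_on_const open_UNIV)
  then show "\<exists>W h. open W \<and> coords (pillowcase_star c) s \<in> W \<and> smooth_on W h \<and>
      (\<forall>r\<in>lifts (pillowcase_star c). coords (pillowcase_star c) r \<in> W \<longrightarrow>
        (\<exists>r'\<in>lifts chi_star. coords chi_star r' = h (coords (pillowcase_star c) r) \<and>
           proj chi_star r' = rho_hat (proj (pillowcase_star c) r)))"
    by (intro exI[of _ UNIV] exI[of _ ?h])
      (auto simp: pillowcase_star_def chi_star_def rho_star_iff torus_star_torus rho_Ba rho_Bb rho_Bc
        rho_hat_iota_orbit intro!: bexI[of _ "rho _"])
qed

text \<open>On imaginary quaternions this is the cross product. The real part is written as an inner
  product with 1, so that smoothness of linear maps applies.\<close>

definition qcross :: "quat \<Rightarrow> quat \<Rightarrow> quat" where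
  "qcross p q = p * q - ((p * q) \<bullet> 1) *\<^sub>R 1"

lemma qcross_conj:
  assumes "g \<noteq> 0"
  shows "qcross (g * p * inverse g) (g * q * inverse g) = g * qcross p q * inverse g"
proof -
  have re: "x \<bullet> 1 = qre x" for x by (simp add: inner_quat_def)
  have m: "(g * p * inverse g) * (g * q * inverse g) = g * (p * q) * inverse g"
    using assms by (simp add: mult.assoc) (simp add: mult.assoc[symmetric])
  show ?thesis
    unfolding qcross_def m re qre_conj[OF assms] using assms by (simp add: algebra_simps)
qed

text \<open>If \<open>A\<close>, \<open>B\<close>, \<open>C\<close> are coplanar unit vectors, with \<open>B\<close> not a multiple of \<open>A\<close>, then these are the unit
  complex numbers of the angles from \<open>A\<close> to \<open>B\<close> and to \<open>C\<close>, with respect to the unit normal along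
  \<open>A \<times> B\<close>.\<close>

definition angle_chart :: "quat \<Rightarrow> quat \<Rightarrow> quat \<Rightarrow> complex \<times> complex" where
  "angle_chart A B C = (let N = su2_pair (qcross A B) (qcross A B) in
     (su2_pair A B *\<^sub>R 1 + N powr (1 / 2) *\<^sub>R \<i>,
      su2_pair A C *\<^sub>R 1 + (su2_pair (qcross A C) (qcross A B) * N powr (- 1 / 2)) *\<^sub>R \<i>))"

lemma smooth_on_su2_pair:
  assumes "open U" "smooth_on U f" "smooth_on U g"
  shows "smooth_on U (\<lambda>x. su2_pair (f x) (g x))"
proof -
  have "su2_pair v w = - ((v * w) \<bullet> 1)" for v w by (simp add: su2_pair_def inner_quat_def)
  then show ?thesis
    using smooth_on_linear[OF bounded_linear_minus[OF bounded_linear_inner_left] assms(1)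
        smooth_on_mult[OF assms]] by simp
qed

lemma smooth_on_qcross:
  assumes "open U" "smooth_on U f" "smooth_on U g"
  shows "smooth_on U (\<lambda>x. qcross (f x) (g x))"
  unfolding qcross_def
  by (intro smooth_on_diff smooth_on_mult[OF assms] assms(1)
      smooth_on_linear[OF bounded_linear_scaleR_left] smooth_on_linear[OF bounded_linear_inner_left])

lemma smooth_on_angle_chart:
  assumes "open U" "smooth_on U A" "smooth_on U B" "smooth_on U C"
    and "\<And>x. x \<in> U \<Longrightarrow> su2_pair (qcross (A x) (B x)) (qcross (A x) (B x)) > 0"
  shows "smooth_on U (\<lambda>x. angle_chart (A x) (B x) (C x))"
  unfolding angle_chart_def Let_def
  by (intro smooth_on_Pair smooth_on_add smooth_on_linear[OF bounded_linear_scaleR_left] smooth_on_mult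
      smooth_on_powr smooth_on_su2_pair smooth_on_qcross assms)

lemma qcross_ej: "qcross (ej 0) (ej x) = sin x *\<^sub>R quat_i"
  by (simp add: qcross_def inner_quat_def quat_eq_iff quat_i_def)

lemma su2_pair_qcross_ej: "su2_pair (qcross (ej 0) (ej x)) (qcross (ej 0) (ej y)) = sin x * sin y"
  by (simp add: qcross_ej su2_pair_def quat_i_def)

lemma angle_chart_conj:
  "g \<noteq> 0 \<Longrightarrow> angle_chart (g * A * inverse g) (g * B * inverse g) (g * C * inverse g) = angle_chart A B C"
  by (simp add: angle_chart_def qcross_conj su2_pair_conj)

text \<open>The normal along the cross product of the first two vectors is reversed when
  \<open>sin x < 0\<close>; then both measured angles change sign together, and the result is the
  other point of the same orbit.\<close>

lemma angle_chart_ej: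
  assumes "sin x \<noteq> 0"
  shows "angle_chart (ej 0) (ej x) (ej y) \<in> iota_orbit (cis x, cis y)"
proof -
  have N: "su2_pair (qcross (ej 0) (ej x)) (qcross (ej 0) (ej x)) = \<bar>sin x\<bar> powr 2"
    using assms by (simp add: su2_pair_qcross_ej power2_eq_square[symmetric] powr_numeral)
  have half: "(\<bar>sin x\<bar> powr 2) powr (1 / 2) = \<bar>sin x\<bar>" "(\<bar>sin x\<bar> powr 2) powr (- 1 / 2) = 1 / \<bar>sin x\<bar>"
    using assms by (simp_all add: powr_powr powr_minus_divide)
  have "su2_pair (ej 0) (ej t) = cos t" for t by (simp add: su2_pair_def)
  then have eq: "angle_chart (ej 0) (ej x) (ej y) =
      (cos x *\<^sub>R 1 + \<bar>sin x\<bar> *\<^sub>R \<i>, cos y *\<^sub>R 1 + (sin y * sin x / \<bar>sin x\<bar>) *\<^sub>R \<i>)"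
    unfolding angle_chart_def Let_def N half by (simp add: su2_pair_qcross_ej)
  show ?thesis
  proof (cases "sin x > 0")
    case True
    then show ?thesis by (simp add: eq iota_orbit_def complex_eq_iff)
  next
    case False
    then show ?thesis using assms by (simp add: eq iota_orbit_def iota_cis complex_eq_iff)
  qed
qed

lemma inv_rho_hat:
  "p \<in> torus_star \<Longrightarrow> inv_into (points (pillowcase_star c)) rho_hat (conj_class (rho p)) = iota_orbit p"
  using bij_betw_inv_into_left[OF rho_hat_bij, of "iota_orbit p" c] torus_star_torus
  by (simp add: points_pillowcase rho_hat_iota_orbit)

text \<open>Away from the corners \<open>sin x\<close> or \<open>sin y\<close> is nonzero, and the
  chart built on the corresponding pair of vectors is defined nearby. Its conjugation invariance
  gives the correct orbit for every lift in the domain.\<close>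

lemma smooth_map_inv_rho_hat:
  "smooth_map chi_star (pillowcase_star c) (inv_into (points (pillowcase_star c)) rho_hat)"
  unfolding smooth_map_def
proof
  let ?f = "inv_into (points (pillowcase_star c)) rho_hat"
  define N where "N = (\<lambda>A B. su2_pair (qcross A B) (qcross A B))"
  fix s assume "s \<in> lifts chi_star"
  then have s: "s \<in> traceless_homs_star" by (simp add: chi_star_def)
  have rep: "\<exists>g x y. g \<noteq> 0 \<and> (cis x, cis y) \<in> torus_star \<and> r = conj_by g (rho (cis x, cis y))"
    if r: "r \<in> traceless_homs_star" for r
  proof -
    obtain p where p: "p \<in> torus_star" "conj_class r = conj_class (rho p)"
      using traceless_star_conj_rho[OF r] .
    obtain g where g: "norm g = 1" "r = conj_by g (rho p)" using p(2) by (metis conj_class_eq_iff)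
    then have "g \<noteq> 0" by auto
    moreover obtain x y where "p = (cis x, cis y)" using p torus_star_torus torus_cis by blast
    ultimately show ?thesis using p(1) g(2) by blast
  qed
  \<comment> \<open>The argument common to both charts: \<open>n > 0\<close> cuts out the domain,
    and \<open>ch\<close> returns one of the two torus points above the class, whichever conjugate
    is given.\<close>
  have smooth: "\<exists>W h. open W \<and> coords chi_star s \<in> W \<and> smooth_on W h \<and>
      (\<forall>r\<in>lifts chi_star. coords chi_star r \<in> W \<longrightarrow>
        (\<exists>r'\<in>lifts (pillowcase_star c). coords (pillowcase_star c) r' = h (coords chi_star r) \<and>
           proj (pillowcase_star c) r' = ?f (proj chi_star r)))"
    if n: "smooth_on UNIV (\<lambda>v. n (fst v) (fst (snd v)) (snd (snd v)))"
      and s_in: "n (s (loop Ba)) (s (loop Bb)) (s (loop Bc)) > (0::real)"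
      and ch: "smooth_on {v. n (fst v) (fst (snd v)) (snd (snd v)) > 0} (\<lambda>v. ch (fst v) (fst (snd v)) (snd (snd v)))"
      and orb: "\<And>g x y. g \<noteq> 0 \<Longrightarrow> n (g * ej 0 * inverse g) (g * ej x * inverse g) (g * ej y * inverse g) > 0
        \<Longrightarrow> ch (g * ej 0 * inverse g) (g * ej x * inverse g) (g * ej y * inverse g) \<in> iota_orbit (cis x, cis y)"
    for n :: "quat \<Rightarrow> quat \<Rightarrow> quat \<Rightarrow> real" and ch
  proof (intro exI[of _ "{v. n (fst v) (fst (snd v)) (snd (snd v)) > 0}"]
      exI[of _ "\<lambda>v. ch (fst v) (fst (snd v)) (snd (snd v))"] conjI ballI impI)
    show "open {v. n (fst v) (fst (snd v)) (snd (snd v)) > 0}"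
      by (intro open_Collect_less continuous_on_const smooth_on_continuous_on[OF n])
    show "coords chi_star s \<in> {v. n (fst v) (fst (snd v)) (snd (snd v)) > 0}"
      using s_in by (simp add: chi_star_def)
    fix r assume "r \<in> lifts chi_star" and r_in: "coords chi_star r \<in> {v. n (fst v) (fst (snd v)) (snd (snd v)) > 0}"
    then have "r \<in> traceless_homs_star" by (simp add: chi_star_def)
    from rep[OF this] obtain g x y
      where g: "g \<noteq> 0" "(cis x, cis y) \<in> torus_star" "r = conj_by g (rho (cis x, cis y))"
      by blast
    let ?p = "ch (r (loop Ba)) (r (loop Bb)) (r (loop Bc))"
    have "?p \<in> iota_orbit (cis x, cis y)"
      using orb[OF g(1)] r_in by (simp add: chi_star_def g(3) conj_by_def rho_cis)
    then have "?p = (cis x, cis y) \<or> ?p = iota (cis x, cis y)" by (simp add: iota_orbit_def)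
    then have "?p \<in> torus_star" "iota_orbit ?p = iota_orbit (cis x, cis y)"
      using g(2) iota_torus_star iota_orbit_iota by metis+
    moreover have "?f (conj_class r) = iota_orbit (cis x, cis y)"
      using inv_rho_hat[OF g(2)] by (simp add: g conj_class_conj_by)
    ultimately show "\<exists>r'\<in>lifts (pillowcase_star c).
        coords (pillowcase_star c) r' = ch (fst (coords chi_star r)) (fst (snd (coords chi_star r))) (snd (snd (coords chi_star r))) \<and>
        proj (pillowcase_star c) r' = ?f (proj chi_star r)"
      by (intro bexI[of _ ?p]) (simp_all add: chi_star_def pillowcase_star_def)
  qed (rule ch)
  have N_smooth: "smooth_on UNIV (\<lambda>v::quat\<times>quat\<times>quat. N (fst v) (fst (snd v)))"
    "smooth_on UNIV (\<lambda>v::quat\<times>quat\<times>quat. N (fst v) (snd (snd v)))"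
    unfolding N_def
    by (intro smooth_on_su2_pair smooth_on_qcross smooth_on_fst smooth_on_snd smooth_on_id open_UNIV)+
  have N_open: "open {v::quat\<times>quat\<times>quat. N (fst v) (fst (snd v)) > 0}"
    "open {v::quat\<times>quat\<times>quat. N (fst v) (snd (snd v)) > 0}"
    by (intro open_Collect_less continuous_on_const smooth_on_continuous_on[OF N_smooth(1)]
        smooth_on_continuous_on[OF N_smooth(2)])+
  have N_ej: "N (g * ej 0 * inverse g) (g * ej x * inverse g) = sin x * sin x" if "g \<noteq> 0" for g x
    unfolding N_def qcross_conj[OF that] su2_pair_conj[OF that] by (rule su2_pair_qcross_ej)
  obtain g x y where g: "g \<noteq> 0" "(cis x, cis y) \<in> torus_star" "s = conj_by g (rho (cis x, cis y))"
    using rep[OF s] by blast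
  then have s_val: "s (loop Ba) = g * ej 0 * inverse g" "s (loop Bb) = g * ej x * inverse g"
    "s (loop Bc) = g * ej y * inverse g"
    by (simp_all add: conj_by_def rho_cis)
  have pos: "sin t * sin t > 0 \<longleftrightarrow> sin t \<noteq> 0" for t :: real
    by (simp add: zero_less_mult_iff) linarith
  consider "sin x \<noteq> 0" | "sin y \<noteq> 0" using g(2) by (auto simp: torus_star_cis)
  then show "\<exists>W h. open W \<and> coords chi_star s \<in> W \<and> smooth_on W h \<and>
      (\<forall>r\<in>lifts chi_star. coords chi_star r \<in> W \<longrightarrow>
        (\<exists>r'\<in>lifts (pillowcase_star c). coords (pillowcase_star c) r' = h (coords chi_star r) \<and>
           proj (pillowcase_star c) r' = ?f (proj chi_star r)))"
  proof cases
    case 1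
    show ?thesis
    proof (rule smooth[of "\<lambda>A B C. N A B" "\<lambda>A B C. angle_chart A B C"])
      show "smooth_on {v. N (fst v) (fst (snd v)) > 0} (\<lambda>v. angle_chart (fst v) (fst (snd v)) (snd (snd v)))"
        using N_open(1) unfolding N_def
        by (intro smooth_on_angle_chart smooth_on_fst smooth_on_snd smooth_on_id) auto
    qed (use 1 N_smooth N_ej g(1) angle_chart_ej in \<open>auto simp: s_val angle_chart_conj pos\<close>)
  next
    case 2
    \<comment> \<open>The same chart with b and c exchanged.\<close>
    show ?thesis
    proof (rule smooth[of "\<lambda>A B C. N A C" "\<lambda>A B C. prod.swap (angle_chart A C B)"])
      have "smooth_on {v. N (fst v) (snd (snd v)) > 0} (\<lambda>v. angle_chart (fst v) (snd (snd v)) (fst (snd v)))"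
        using N_open(2) unfolding N_def
        by (intro smooth_on_angle_chart smooth_on_fst smooth_on_snd smooth_on_id) auto
      then show "smooth_on {v. N (fst v) (snd (snd v)) > 0}
          (\<lambda>v. prod.swap (angle_chart (fst v) (snd (snd v)) (fst (snd v))))"
        unfolding prod.swap_def using N_open(2)
        by (intro smooth_on_Pair smooth_on_fst smooth_on_snd)
      fix g x y assume g: "g \<noteq> 0" and "0 < N (g * ej 0 * inverse g) (g * ej y * inverse g)"
      then have "sin y \<noteq> 0" by (simp add: N_ej pos)
      then show "prod.swap (angle_chart (g * ej 0 * inverse g) (g * ej y * inverse g) (g * ej x * inverse g))
          \<in> iota_orbit (cis x, cis y)"
        using angle_chart_ej[of y x] by (auto simp: angle_chart_conj g iota_orbit_def iota_cis)
    qed (use 2 N_smooth N_ej g(1) in \<open>auto simp: s_val pos\<close>)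
  qed
qed

section \<open>Symplectomorphisms\<close>

lemma
  assumes R: "smooth_curve chi_star R"
  shows smooth_curve_chi_star_mem: "R t \<in> traceless_homs_star"
    and smooth_curve_chi_star_hom: "R t \<in> hom pi1F SU2"
    and smooth_curve_chi_star_values: "smooth_on UNIV (\<lambda>t. generator_values (R t))"
    and smooth_curve_chi_star_differentiable: "(\<lambda>t. generator_values (R t)) differentiable at t0"
proof -
  show s: "smooth_on UNIV (\<lambda>t. generator_values (R t))" and m: "R t \<in> traceless_homs_star" for t
    using R by (auto simp: smooth_curve_def chi_star_def)
  show "R t \<in> hom pi1F SU2" using m[of t] by (simp add: traceless_homs_star_def traceless_homs_def)
  show "(\<lambda>t. generator_values (R t)) differentiable at t0"
    by (rule smooth_on_differentiable[OF s]) simp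
qed

lemma velocity_chi_star: "velocity chi_star R = H1_class (R 0) (velocity_cocycle R)"
  by (simp add: chi_star_def velocity_cocycle_def)

lemma unit_circle_velocity:
  fixes f :: "real \<Rightarrow> complex"
  assumes "\<And>t. norm (f t) = 1" "(f has_vector_derivative v) (at t)"
  shows "v = (\<i> * of_real (Im (v / f t))) * f t"
proof -
  have "((\<lambda>t. f t \<bullet> f t) has_derivative (\<lambda>h. f t \<bullet> (h *\<^sub>R v) + (h *\<^sub>R v) \<bullet> f t)) (at t)"
    using assms(2) unfolding has_vector_derivative_def by (intro has_derivative_inner)
  moreover have "(\<lambda>t. f t \<bullet> f t) = (\<lambda>t. 1)"
    using assms(1) by (simp add: dot_square_norm)
  ultimately have "(\<lambda>h. f t \<bullet> (h *\<^sub>R v) + (h *\<^sub>R v) \<bullet> f t) = (\<lambda>h. 0)"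
    using has_derivative_unique has_derivative_const by metis
  then have "v \<bullet> f t = 0"
    by (auto dest!: fun_cong[of _ _ 1] simp: inner_commute)
  then have "Re (v / f t) = 0"
    using assms(1)[of t] by (simp add: Re_divide inner_complex_def)
  then have "v / f t = \<i> * of_real (Im (v / f t))"
    by (simp add: complex_eq_iff)
  moreover have "f t \<noteq> 0" using assms(1)[of t] by auto
  ultimately show ?thesis by (metis nonzero_eq_divide_eq)
qed

lemma quat_circle_velocity:
  "quat_of_complex (\<i> * of_real r * cis x) * quat_j * inverse (ej x) = r *\<^sub>R quat_i"
proof -
  have "r * (cos x * cos x) + r * (sin x * sin x) = r"
    by (metis distrib_left mult.right_neutral power2_eq_square sin_cos_squared_add2)
  then show ?thesis
    by (simp add: quat_eq_iff quat_of_complex_def quat_i_def quat_j_def algebra_simps)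
qed

text \<open>A curve in the torus is lifted to \<open>conj_by g (rho (R t))\<close>. It need not be a
  line, but its velocity cocycle is determined by the values on a, b, c, which see only the velocity
  of \<open>R\<close> at 0.\<close>

lemma rho_hat_differential:
  assumes g: "g \<noteq> 0"
  shows "is_differential (pillowcase_star c) chi_star rho_hat (cis x, cis y)
    (conj_by g (rho (cis x, cis y))) (tangent_map g x y)"
  unfolding is_differential_def
proof (intro allI impI, elim conjE)
  fix R assume R: "smooth_curve (pillowcase_star c) R" and R0: "R 0 = (cis x, cis y)"
  have star: "R t \<in> torus_star" for t
    using R by (auto simp: smooth_curve_def pillowcase_star_def)
  then have tor: "R t \<in> torus" for t using torus_star_torus by blast
  have smooth_R: "smooth_on UNIV R"
    using R by (simp add: smooth_curve_def pillowcase_star_def)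
  define R' where "R' = (\<lambda>t. conj_by g (rho (R t)))"
  define u where "u = velocity (pillowcase_star c) R"
  have "smooth_on UNIV (\<lambda>t. generator_values (R' t))"
    unfolding R'_def conj_by_def rho_Ba[OF tor] rho_Bb[OF tor] rho_Bc[OF tor]
    by (intro smooth_on_Pair smooth_on_linear[OF bounded_linear_conj] smooth_on_rho_coords smooth_on_fst
        smooth_on_snd smooth_R smooth_on_const open_UNIV)
  then have R'_curve: "smooth_curve chi_star R'"
    using conj_by_traceless_star[OF g] rho_star_iff[OF tor] star
    by (auto simp: smooth_curve_def chi_star_def R'_def)
  have R'0: "R' 0 = conj_by g (rho (cis x, cis y))" by (simp add: R'_def R0)
  have cocycle: "velocity_cocycle R' = conj_by g (line_cocycle x y u)"
  proof (rule Z1_eqI)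
    note hom = rho_hom[OF cis_pair_torus, of x y]
    show "R' 0 \<in> hom pi1F SU2" by (rule smooth_curve_chi_star_hom[OF R'_curve])
    show "velocity_cocycle R' \<in> Z1 (R' 0)"
      by (rule velocity_cocycle_Z1[OF smooth_curve_chi_star_hom[OF R'_curve]
            smooth_curve_chi_star_differentiable[OF R'_curve]])
    show "conj_by g (line_cocycle x y u) \<in> Z1 (R' 0)"
      unfolding R'0 by (rule conj_by_Z1[OF g hom Z1_par_Z1[OF line_cocycle_Z1_par]])
    have circle: "vector_derivative (\<lambda>t. g * (quat_of_complex (f t) * quat_j) * inverse g) (at 0)
        * inverse (g * ej \<theta> * inverse g) = g * (Im (vector_derivative f (at 0) / f 0) *\<^sub>R quat_i) * inverse g"
      if f: "\<And>t. norm (f t) = 1" "smooth_on UNIV f" "f 0 = cis \<theta>" for f \<theta>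
    proof -
      let ?v = "vector_derivative f (at 0)"
      have d: "(f has_vector_derivative ?v) (at 0)"
        using smooth_on_differentiable[OF f(2), of 0] by (simp add: vector_derivative_works)
      have "bounded_linear (\<lambda>z. g * (quat_of_complex z * quat_j) * inverse g)"
        by (intro bounded_linear_compose[OF bounded_linear_conj] 
            bounded_linear_compose[OF bounded_linear_mult_left bounded_linear_quat_of_complex])
      from bounded_linear.has_vector_derivative[OF this d]
      have "vector_derivative (\<lambda>t. g * (quat_of_complex (f t) * quat_j) * inverse g) (at 0)
          = g * (quat_of_complex ?v * quat_j) * inverse g"
        by (rule vector_derivative_at)
      also have "\<dots> * inverse (g * ej \<theta> * inverse g) = g * (quat_of_complex ?v * quat_j * inverse (ej \<theta>)) * inverse g"
      proof -
        have "inverse g * (g * q) = q" for q using g by (simp add: mult.assoc[symmetric])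
        then show ?thesis using g by (simp add: nonzero_inverse_mult_distrib mult.assoc)
      qed
      also have "quat_of_complex ?v * quat_j * inverse (ej \<theta>) = Im (?v / f 0) *\<^sub>R quat_i"
        by (subst unit_circle_velocity[OF f(1) d]) (simp only: f(3) quat_circle_velocity)
      finally show ?thesis .
    qed
    have n: "norm (fst (R t)) = 1" "norm (snd (R t)) = 1" for t
      using tor[of t] by (auto simp: torus_def)
    have u: "fst u = Im (vector_derivative (\<lambda>t. fst (R t)) (at 0) / fst (R 0))"
      "snd u = Im (vector_derivative (\<lambda>t. snd (R t)) (at 0) / snd (R 0))"
      by (simp_all add: u_def pillowcase_star_def)
    fix s assume "s \<noteq> Bd"
    then show "velocity_cocycle R' (loop s) = conj_by g (line_cocycle x y u) (loop s)"
    proof (cases s)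
      case Ba
      then show ?thesis
        by (simp add: velocity_cocycle_def R'_def conj_by_def rho_Ba tor line_cocycle_loops)
    next
      case Bb
      show ?thesis
        using circle[OF n(1) smooth_on_fst[OF open_UNIV smooth_R], of x]
        by (simp only: Bb velocity_cocycle_def R'_def conj_by_def rho_Bb[OF tor] R0 fst_conv rho_cis simp_thms
            quat_of_complex_cis line_cocycle_loops u)
    next
      case Bc
      show ?thesis
        using circle[OF n(2) smooth_on_snd[OF open_UNIV smooth_R], of y]
        by (simp only: Bc velocity_cocycle_def R'_def conj_by_def rho_Bc[OF tor] R0 snd_conv rho_cis simp_thms
            quat_of_complex_cis line_cocycle_loops u)
    qed simp
  qed
  show "\<exists>R'. smooth_curve chi_star R' \<and> R' 0 = conj_by g (rho (cis x, cis y)) \<and>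
      (\<forall>t. proj chi_star (R' t) = rho_hat (proj (pillowcase_star c) (R t))) \<and>
      velocity chi_star R' = tangent_map g x y (velocity (pillowcase_star c) R)"
  proof (intro exI[of _ R'] conjI allI)
    show "proj chi_star (R' t) = rho_hat (proj (pillowcase_star c) (R t))" for t
      using rho_hat_iota_orbit[OF tor]
      by (simp add: chi_star_def pillowcase_star_def R'_def conj_class_conj_by g)
    show "velocity chi_star R' = tangent_map g x y (velocity (pillowcase_star c) R)"
      by (simp add: velocity_chi_star cocycle R'0 tangent_map_def u_def)
  qed (fact R'_curve R'0)+
qed

lemma rho_hat_symplectomorphism: "symplectomorphism (pillowcase_star (- 1 / 2)) chi_star rho_hat"
  unfolding symplectomorphism_def
proof (intro conjI ballI impI rho_hat_bij smooth_map_rho_hat smooth_map_inv_rho_hat)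
  let ?M = "pillowcase_star (- 1 / 2)"
  fix p \<rho> assume "p \<in> lifts ?M" and eq: "proj chi_star \<rho> = rho_hat (proj ?M p)"
  then have "p \<in> torus_star" by (simp add: pillowcase_star_def)
  then obtain x y where p: "p = (cis x, cis y)" using torus_star_torus torus_cis by blast
  have s: "sin x \<noteq> 0 \<or> sin y \<noteq> 0" using \<open>p \<in> torus_star\<close> by (simp add: p torus_star_cis)
  have "conj_class (rho p) = conj_class \<rho>"
    using eq by (simp add: pillowcase_star_def chi_star_def rho_hat_iota_orbit p)
  then obtain g where g: "norm g = 1" "\<rho> = conj_by g (rho (cis x, cis y))"
    by (auto simp: conj_class_eq_iff p)
  then have "g \<noteq> 0" by auto
  show "\<exists>L. is_differential ?M chi_star rho_hat p \<rho> L \<and> bij_betw L (tangent ?M p) (tangent chi_star \<rho>) \<and>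
      (\<forall>X\<in>tangent ?M p. \<forall>Y\<in>tangent ?M p. form chi_star \<rho> (L X) (L Y) = form ?M p X Y)"
  proof (intro exI[of _ "tangent_map g x y"] conjI ballI)
    show "is_differential ?M chi_star rho_hat p \<rho> (tangent_map g x y)"
      unfolding p g(2) by (rule rho_hat_differential[OF \<open>g \<noteq> 0\<close>])
    show "bij_betw (tangent_map g x y) (tangent ?M p) (tangent chi_star \<rho>)"
      using tangent_map_bij[OF \<open>g \<noteq> 0\<close> s] by (simp add: pillowcase_star_def chi_star_def g(2))
    show "form chi_star \<rho> (tangent_map g x y X) (tangent_map g x y Y) = form ?M p X Y" for X Y
      using omega_hat_tangent_map[OF \<open>g \<noteq> 0\<close>, of x y X Y]
      by (simp add: pillowcase_star_def chi_star_def g(2) split: prod.split)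
  qed
qed

text \<open>Corners are the points whose angles are integer multiples of \<pi>, a property kept by
  integer combinations. If \<open>M\<close> took \<open>p\<close> to a corner, the inverse matrix
  would show that \<open>p\<close> is one.\<close>

lemma SL2Z_act_torus_star:
  assumes "M \<in> carrier SL2Z" "p \<in> torus_star"
  shows "SL2Z_act M p \<in> torus_star"
proof (rule ccontr)
  assume not: "SL2Z_act M p \<notin> torus_star"
  obtain x y where p: "p = (cis x, cis y)" using assms(2) torus_star_torus torus_cis by blast
  define x' y' where "x' = of_int (M$1$1) * x + of_int (M$1$2) * y"
    and "y' = of_int (M$2$1) * x + of_int (M$2$2) * y"
  have Mp: "SL2Z_act M p = (cis x', cis y')" by (simp add: p SL2Z_act_cis x'_def y'_def)
  then have "sin x' = 0" "sin y' = 0" using not by (simp_all add: torus_star_cis)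
  then obtain i j :: int where ij: "x' = of_int i * pi" "y' = of_int j * pi"
    by (auto simp: sin_zero_iff_int2)
  have "sin (of_int m * x' + of_int n * y') = 0" for m n
  proof -
    have "of_int m * x' + of_int n * y' = of_int (m * i + n * j) * pi"
      by (simp add: ij algebra_simps)
    then show ?thesis using sin_zero_iff_int2 by blast
  qed
  then have "SL2Z_act (mat2_adj M) (cis x', cis y') \<notin> torus_star"
    unfolding SL2Z_act_cis torus_star_cis by blast
  moreover have "SL2Z_act (mat2_adj M) (SL2Z_act M p) = p"
    using SL2Z_act_mult[of p "mat2_adj M" M] mat2_adj(2)[OF assms(1)] SL2Z_act_one[of p]
    by (simp add: p)
  ultimately show False using assms(2) Mp by simp
qed

section \<open>The modular group on the smooth stratum\<close>

lemma psl_action_points: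
  assumes "M \<in> carrier SL2Z" "X \<in> points chi_star"
  shows "psl_action (psl M) X \<in> points chi_star"
  using assms SL2Z_act_torus_star torus_star_torus
  by (auto simp: points_chi_star psl_action_rho)

lemma points_chi_star_subset: "points chi_star \<subseteq> chi"
  using torus_star_torus by (auto simp: points_chi_star chi_rho)

lemma psl_action_bij_star:
  assumes "M \<in> carrier SL2Z"
  shows "bij_betw (psl_action (psl M)) (points chi_star) (points chi_star)"
  by (rule bij_betw_byWitness[where f' = "psl_action (psl (mat2_adj M))"])
    (use assms psl_action_inverse[OF assms] psl_action_points mat2_adj(1)[OF assms] points_chi_star_subset
      in \<open>auto simp: subset_iff\<close>)

text \<open>\<open>symplectomorphism\<close> speaks of an \<open>inv_into\<close>; as the action of
  another matrix it inherits smoothness from \<open>psl_action_smooth\<close>.\<close>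

lemma inv_into_psl_action:
  assumes "M \<in> carrier SL2Z" "X \<in> points chi_star"
  shows "inv_into (points chi_star) (psl_action (psl M)) X = psl_action (psl (mat2_adj M)) X"
proof (rule inv_into_f_eq)
  show "inj_on (psl_action (psl M)) (points chi_star)"
    using psl_action_bij_star[OF assms(1)] by (simp add: bij_betw_def)
  show "psl_action (psl (mat2_adj M)) X \<in> points chi_star"
    by (rule psl_action_points[OF mat2_adj(1)[OF assms(1)] assms(2)])
  show "psl_action (psl M) (psl_action (psl (mat2_adj M)) X) = X"
    using psl_action_inverse(2)[OF assms(1)] assms(2) points_chi_star_subset by blast
qed

lemma traceless_star_rep:
  assumes "\<rho> \<in> traceless_homs_star"
  obtains g x y where "g \<noteq> 0" "sin x \<noteq> 0 \<or> sin y \<noteq> 0" "\<rho> = conj_by g (rho (cis x, cis y))"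
proof -
  obtain p where p: "p \<in> torus_star" "conj_class \<rho> = conj_class (rho p)"
    using traceless_star_conj_rho[OF assms] .
  obtain g where g: "norm g = 1" "\<rho> = conj_by g (rho p)" using p(2) by (metis conj_class_eq_iff)
  then have "g \<noteq> 0" by auto
  moreover obtain x y where "p = (cis x, cis y)" using p torus_star_torus torus_cis by blast
  ultimately show ?thesis using that p(1) g(2) torus_star_cis by blast
qed

lemma realizes_traceless_star:
  assumes "realizes h M" "M \<in> carrier SL2Z" "\<rho> \<in> traceless_homs_star"
  shows "\<rho> \<circ> h \<in> traceless_homs_star"
proof -
  obtain g x y where g: "g \<noteq> 0" "sin x \<noteq> 0 \<or> sin y \<noteq> 0" "\<rho> = conj_by g (rho (cis x, cis y))"
    using traceless_star_rep[OF assms(3)] .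
  have "\<rho> \<circ> h = conj_by g (rho (SL2Z_act M (cis x, cis y)))"
    using assms(1) by (simp add: g conj_by_comp realizes_def)
  moreover have "SL2Z_act M (cis x, cis y) \<in> torus_star"
    using g(2) by (intro SL2Z_act_torus_star assms(2)) (simp add: torus_star_cis)
  ultimately show ?thesis
    using conj_by_traceless_star[OF g(1)] rho_star_iff torus_star_torus by auto
qed

lemma traceless_star_traceless: "\<rho> \<in> traceless_homs_star \<Longrightarrow> \<rho> \<in> traceless_homs"
  by (simp add: traceless_homs_star_def)

lemma psl_action_smooth:
  assumes M: "M \<in> carrier SL2Z"
  shows "smooth_map chi_star chi_star (psl_action (psl M))"
  unfolding smooth_map_def
proof
  fix s assume "s \<in> lifts chi_star"
  obtain h where h: "realizes h M" using realizes_exists[OF M] .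
  obtain Fa where Fa: "smooth_on UNIV Fa"
    "\<And>\<rho>. \<rho> \<in> hom pi1F SU2 \<Longrightarrow> \<rho> (h (loop Ba)) = Fa (generator_values \<rho>)"
    by (rule evaluation_smooth[of "h (loop Ba)"]) blast
  obtain Fb where Fb: "smooth_on UNIV Fb"
    "\<And>\<rho>. \<rho> \<in> hom pi1F SU2 \<Longrightarrow> \<rho> (h (loop Bb)) = Fb (generator_values \<rho>)"
    by (rule evaluation_smooth[of "h (loop Bb)"]) blast
  obtain Fc where Fc: "smooth_on UNIV Fc"
    "\<And>\<rho>. \<rho> \<in> hom pi1F SU2 \<Longrightarrow> \<rho> (h (loop Bc)) = Fc (generator_values \<rho>)"
    by (rule evaluation_smooth[of "h (loop Bc)"]) blast
  let ?F = "\<lambda>v. (Fa v, Fb v, Fc v)"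
  show "\<exists>W F. open W \<and> coords chi_star s \<in> W \<and> smooth_on W F \<and>
      (\<forall>r\<in>lifts chi_star. coords chi_star r \<in> W \<longrightarrow>
        (\<exists>r'\<in>lifts chi_star. coords chi_star r' = F (coords chi_star r) \<and>
           proj chi_star r' = psl_action (psl M) (proj chi_star r)))"
  proof (intro exI[of _ UNIV] exI[of _ ?F] conjI ballI impI)
    show "smooth_on UNIV ?F" by (intro smooth_on_Pair Fa Fb Fc open_UNIV)
    fix r assume "r \<in> lifts chi_star"
    then have r: "r \<in> traceless_homs_star" by (simp add: chi_star_def)
    then have "r \<in> traceless_homs" "r \<in> hom pi1F SU2"
      using traceless_star_traceless traceless_hom by blast+
    then show "\<exists>r'\<in>lifts chi_star. coords chi_star r' = ?F (coords chi_star r) \<and>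
        proj chi_star r' = psl_action (psl M) (proj chi_star r)"
      using realizes_traceless_star[OF h M r] psl_action_realizes[OF h] Fa(2) Fb(2) Fc(2)
      by (intro bexI[of _ "r \<circ> h"]) (simp_all add: chi_star_def)
  qed simp_all
qed

lemma smooth_map_cong:
  assumes "\<And>X. X \<in> points M \<Longrightarrow> f X = f' X" "smooth_map M N f"
  shows "smooth_map M N f'"
proof -
  have "f (proj M r) = f' (proj M r)" if "r \<in> lifts M" for r
    using assms(1) that by (simp add: points_def)
  then show ?thesis using assms(2) unfolding smooth_map_def by metis
qed

text \<open>The map on twisted cohomology induced by \<open>h\<close>, followed by conjugation by \<open>k\<close>; all sets in the
  union are equal.\<close>

definition H1_pullback :: "(surface_group \<Rightarrow> surface_group) \<Rightarrow> quat \<Rightarrow> (surface_group \<Rightarrow> quat)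
    \<Rightarrow> (surface_group \<Rightarrow> quat) set \<Rightarrow> (surface_group \<Rightarrow> quat) set" where
  "H1_pullback h k \<sigma> X = (\<Union>z\<in>X. H1_class \<sigma> (conj_by k (z \<circ> h)))"

lemma Z1_comp: "h \<in> hom pi1F pi1F \<Longrightarrow> z \<in> Z1 \<rho> \<Longrightarrow> z \<circ> h \<in> Z1 (\<rho> \<circ> h)"
  by (auto simp: Z1_def cobdry1_def Ad_def hom_def)

lemma comp_hom: "h \<in> hom pi1F pi1F \<Longrightarrow> \<rho> \<in> hom pi1F SU2 \<Longrightarrow> \<rho> \<circ> h \<in> hom pi1F SU2"
  by (auto simp: hom_def)

lemma H1_pullback_class:
  assumes h: "h \<in> hom pi1F pi1F" and k: "k \<noteq> 0" and \<rho>: "\<rho> \<in> hom pi1F SU2" and z: "z \<in> Z1 \<rho>"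
  shows "H1_pullback h k (conj_by k (\<rho> \<circ> h)) (H1_class \<rho> z) = H1_class (conj_by k (\<rho> \<circ> h)) (conj_by k (z \<circ> h))"
proof -
  let ?\<sigma> = "conj_by k (\<rho> \<circ> h)"
  have Z1: "conj_by k (w \<circ> h) \<in> Z1 ?\<sigma>" if "w \<in> Z1 \<rho>" for w
    by (rule conj_by_Z1[OF k comp_hom[OF h \<rho>] Z1_comp[OF h that]])
  have eq: "H1_class ?\<sigma> (conj_by k (w \<circ> h)) = H1_class ?\<sigma> (conj_by k (z \<circ> h))" if "w \<in> H1_class \<rho> z" for w
  proof -
    obtain u where u: "w \<in> Z1 \<rho>" "u \<in> su2" "\<And>\<gamma>. w \<gamma> - z \<gamma> = cobdry0 \<rho> u \<gamma>"
      using \<open>w \<in> H1_class \<rho> z\<close> by (auto simp: H1_class_def cohomologous_def)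
    have "conj_by k (w \<circ> h) \<gamma> - conj_by k (z \<circ> h) \<gamma> = cobdry0 ?\<sigma> (k * u * inverse k) \<gamma>" for \<gamma>
    proof -
      have "conj_by k (w \<circ> h) \<gamma> - conj_by k (z \<circ> h) \<gamma> = k * (w (h \<gamma>) - z (h \<gamma>)) * inverse k"
        by (simp add: conj_by_def algebra_simps)
      also have "\<dots> = conj_by k (cobdry0 (\<rho> \<circ> h) u) \<gamma>"
        by (simp add: u(3) conj_by_def cobdry0_def Ad_def)
      finally show ?thesis by (simp add: conj_by_cobdry0[OF k comp_hom[OF h \<rho>]])
    qed
    then show ?thesis
      using H1_class_eqI[OF Z1[OF z] Z1[OF u(1)] conj_by_su2[OF k u(2)]] by simp
  qed
  have "z \<in> H1_class \<rho> z"
    using equiv_class_self[OF equiv_cohomologous z] by (simp add: H1_class_def)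
  with eq show ?thesis unfolding H1_pullback_def by blast
qed

text \<open>The factor \<open>k\<close> accounts for the arbitrary lift of the image point. The
  curve \<open>conj_by k (R t \<circ> h)\<close> covers the image of \<open>R\<close>, and its
  velocity cocycle is that of \<open>R\<close> composed with \<open>h\<close> and conjugated by
  \<open>k\<close>.\<close>

lemma psl_action_differential:
  assumes h: "realizes h M" and M: "M \<in> carrier SL2Z" and k: "k \<noteq> 0"
  shows "is_differential chi_star chi_star (psl_action (psl M)) \<rho> (conj_by k (\<rho> \<circ> h))
    (H1_pullback h k (conj_by k (\<rho> \<circ> h)))"
  unfolding is_differential_def
proof (intro allI impI, elim conjE)
  fix R assume R: "smooth_curve chi_star R" and R0: "R 0 = \<rho>"
  have h_hom: "h \<in> hom pi1F pi1F" using h by (simp add: realizes_def)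
  note mem = smooth_curve_chi_star_mem[OF R] and hom = smooth_curve_chi_star_hom[OF R]
  define R' where "R' = (\<lambda>t. conj_by k (R t \<circ> h))"
  have "smooth_on UNIV (\<lambda>t. R t \<gamma>)" for \<gamma>
  proof -
    obtain F where F: "smooth_on UNIV F" "\<And>\<rho>. \<rho> \<in> hom pi1F SU2 \<Longrightarrow> \<rho> \<gamma> = F (generator_values \<rho>)"
      by (rule evaluation_smooth[of \<gamma>]) blast
    show ?thesis
      unfolding F(2)[OF hom]
      by (rule smooth_on_compose[OF _ _ _ F(1) smooth_curve_chi_star_values[OF R]]) auto
  qed
  then have "smooth_on UNIV (\<lambda>t. generator_values (R' t))"
    unfolding R'_def conj_by_def o_def
    by (intro smooth_on_Pair smooth_on_linear[OF bounded_linear_conj] open_UNIV)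
  then have R'_curve: "smooth_curve chi_star R'"
    using conj_by_traceless_star[OF k realizes_traceless_star[OF h M mem]]
    by (auto simp: smooth_curve_def chi_star_def R'_def)
  have "velocity_cocycle R' \<gamma> = conj_by k (velocity_cocycle R \<circ> h) \<gamma>" for \<gamma>
  proof -
    have "((\<lambda>t. R t (h \<gamma>)) has_vector_derivative vector_derivative (\<lambda>t. R t (h \<gamma>)) (at 0)) (at 0)"
      using rep_curve_differentiable[OF hom smooth_curve_chi_star_differentiable[OF R]]
      by (simp add: vector_derivative_works)
    from bounded_linear.has_vector_derivative[OF bounded_linear_conj[of k] this]
    have "vector_derivative (\<lambda>t. R' t \<gamma>) (at 0) = k * vector_derivative (\<lambda>t. R t (h \<gamma>)) (at 0) * inverse k"
      unfolding R'_def conj_by_def o_def by (rule vector_derivative_at)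
    moreover have "inverse k * (k * q) = q" for q using k by (simp add: mult.assoc[symmetric])
    ultimately show ?thesis
      using k SU2_hom_nonzero[OF hom]
      by (simp add: velocity_cocycle_def) (simp add: R'_def conj_by_def nonzero_inverse_mult_distrib mult.assoc)
  qed
  then have cocycle: "velocity_cocycle R' = conj_by k (velocity_cocycle R \<circ> h)" by blast
  have "velocity_cocycle R \<in> Z1 (R 0)"
    by (rule velocity_cocycle_Z1[OF hom smooth_curve_chi_star_differentiable[OF R]])
  then have vel: "velocity chi_star R' = H1_pullback h k (conj_by k (\<rho> \<circ> h)) (velocity chi_star R)"
    using H1_pullback_class[OF h_hom k hom[of 0]]
    by (simp add: velocity_chi_star cocycle R0) (simp add: R'_def R0)
  show "\<exists>R'. smooth_curve chi_star R' \<and> R' 0 = conj_by k (\<rho> \<circ> h) \<and>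
      (\<forall>t. proj chi_star (R' t) = psl_action (psl M) (proj chi_star (R t))) \<and>
      velocity chi_star R' = H1_pullback h k (conj_by k (\<rho> \<circ> h)) (velocity chi_star R)"
  proof (intro exI[of _ R'] conjI allI R'_curve vel)
    show "R' 0 = conj_by k (\<rho> \<circ> h)" by (simp add: R'_def R0)
    show "proj chi_star (R' t) = psl_action (psl M) (proj chi_star (R t))" for t
      using psl_action_realizes[OF h traceless_star_traceless[OF mem]]
      by (simp add: chi_star_def R'_def conj_class_conj_by k)
  qed
qed

definition linear_act :: "int^2^2 \<Rightarrow> real \<times> real \<Rightarrow> real \<times> real" where
  "linear_act M = (\<lambda>(u1, u2). (of_int (M$1$1) * u1 + of_int (M$1$2) * u2, of_int (M$2$1) * u1 + of_int (M$2$2) * u2))"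

lemma SL2Z_det_real:
  assumes "M \<in> carrier SL2Z"
  shows "real_of_int (M$1$1) * of_int (M$2$2) - of_int (M$2$1) * of_int (M$1$2) = 1"
  using assms unfolding SL2Z_carrier by (metis of_int_1 of_int_diff of_int_mult)

lemma linear_act_bij:
  assumes "M \<in> carrier SL2Z"
  shows "bij (linear_act M)"
proof (rule bij_betw_byWitness[where f' = "linear_act (mat2_adj M)"])
  note d = SL2Z_det_real[OF assms]
  have "linear_act (mat2_adj M) (linear_act M u) = u" "linear_act M (linear_act (mat2_adj M) u) = u" for u
  proof -
    let ?p = "real_of_int (M$1$1)" and ?q = "real_of_int (M$2$1)"
      and ?r = "real_of_int (M$1$2)" and ?s = "real_of_int (M$2$2)"
    have det: "(?p * ?s - ?q * ?r) * t = t" for t using d by simp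
    show "linear_act (mat2_adj M) (linear_act M u) = u"
      using det[of "fst u"] det[of "snd u"]
      by (cases u) (simp add: linear_act_def mat2_adj_def algebra_simps)
    show "linear_act M (linear_act (mat2_adj M) u) = u"
      using det[of "fst u"] det[of "snd u"]
      by (cases u) (simp add: linear_act_def mat2_adj_def algebra_simps)
  qed
  then show "\<forall>u\<in>UNIV. linear_act (mat2_adj M) (linear_act M u) = u"
    "\<forall>u\<in>UNIV. linear_act M (linear_act (mat2_adj M) u) = u" by auto
qed auto

lemma linear_act_area:
  assumes "M \<in> carrier SL2Z"
  shows "fst (linear_act M u) * snd (linear_act M v) - snd (linear_act M u) * fst (linear_act M v)
    = fst u * snd v - snd u * fst v"
proof -
  have "fst (linear_act M u) * snd (linear_act M v) - snd (linear_act M u) * fst (linear_act M v)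
      = (of_int (M$1$1) * of_int (M$2$2) - of_int (M$2$1) * of_int (M$1$2)) * (fst u * snd v - snd u * fst v)"
    by (cases u; cases v) (simp add: linear_act_def algebra_simps)
  then show ?thesis using SL2Z_det_real[OF assms] by simp
qed

text \<open>Composition with \<open>h\<close> takes a line of representations to the line with
  transformed base point and direction, where the base angles are transformed as real
  numbers.\<close>

lemma line_cocycle_realizes:
  assumes "realizes h M" "linear_act M (x, y) = (x', y')"
  shows "line_cocycle x y u \<circ> h = line_cocycle x' y' (linear_act M u)"
proof -
  have "line_rep x y u t \<circ> h = line_rep x' y' (linear_act M u) t" for t
  proof -
    have "SL2Z_act M (cis (x + t * fst u), cis (y + t * snd u)) =
        (cis (x' + t * fst (linear_act M u)), cis (y' + t * snd (linear_act M u)))"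
      using assms(2) by (cases u) (auto simp: SL2Z_act_cis linear_act_def algebra_simps)
    then show ?thesis using assms(1) by (simp add: line_rep_def realizes_def)
  qed
  then have "line_rep x y u t (h \<gamma>) = line_rep x' y' (linear_act M u) t \<gamma>" for t \<gamma>
    by (metis comp_apply)
  then show ?thesis by (simp add: fun_eq_iff line_cocycle_def velocity_cocycle_def)
qed

lemma psl_action_symplectomorphism:
  assumes M: "M \<in> carrier SL2Z"
  shows "symplectomorphism chi_star chi_star (psl_action (psl M))"
  unfolding symplectomorphism_def
proof (intro conjI ballI impI psl_action_bij_star[OF M] psl_action_smooth[OF M])
  show "smooth_map chi_star chi_star (inv_into (points chi_star) (psl_action (psl M)))"
    by (rule smooth_map_cong[OF _ psl_action_smooth[OF mat2_adj(1)[OF M]]])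
      (simp add: inv_into_psl_action[OF M])
  fix \<rho> \<sigma> assume "\<rho> \<in> lifts chi_star"
    and eq: "proj chi_star \<sigma> = psl_action (psl M) (proj chi_star \<rho>)"
  then have \<rho>: "\<rho> \<in> traceless_homs_star" by (simp add: chi_star_def)
  obtain h where h: "realizes h M" using realizes_exists[OF M] .
  have h_hom: "h \<in> hom pi1F pi1F" using h by (simp add: realizes_def)
  have "conj_class (\<rho> \<circ> h) = conj_class \<sigma>"
    using eq psl_action_realizes[OF h traceless_star_traceless[OF \<rho>]] by (simp add: chi_star_def)
  then obtain k where "norm k = 1" and \<sigma>: "\<sigma> = conj_by k (\<rho> \<circ> h)" by (auto simp: conj_class_eq_iff)
  then have k: "k \<noteq> 0" by auto
  obtain g x y where g: "g \<noteq> 0" and s: "sin x \<noteq> 0 \<or> sin y \<noteq> 0" and \<rho>_eq: "\<rho> = conj_by g (rho (cis x, cis y))"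
    using traceless_star_rep[OF \<rho>] .
  obtain x' y' where xy': "linear_act M (x, y) = (x', y')" by fastforce
  have Mp: "SL2Z_act M (cis x, cis y) = (cis x', cis y')"
    using xy' by (auto simp: SL2Z_act_cis linear_act_def)
  have "(cis x', cis y') \<in> torus_star"
    using SL2Z_act_torus_star[OF M, of "(cis x, cis y)"] s by (simp add: Mp[symmetric] torus_star_cis)
  then have s': "sin x' \<noteq> 0 \<or> sin y' \<noteq> 0" by (simp add: torus_star_cis)
  have kg: "k * g \<noteq> 0" using k g by simp
  have \<sigma>_eq: "\<sigma> = conj_by (k * g) (rho (cis x', cis y'))"
    using h by (simp add: \<sigma> \<rho>_eq conj_by_comp realizes_def Mp conj_by_conj_by k g)
  let ?L = "H1_pullback h k \<sigma>"
  \<comment> \<open>The square of \<open>?L\<close>, \<open>linear_act M\<close> and the two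
    parametrisations of tangent spaces commutes, which reduces bijectivity and invariance of the
    form to a matrix of determinant one.\<close>
  have L: "?L (tangent_map g x y u) = tangent_map (k * g) x' y' (linear_act M u)" for u
  proof -
    note hom = rho_hom[OF cis_pair_torus, of x y]
    have "?L (tangent_map g x y u) = H1_class \<sigma> (conj_by k (conj_by g (line_cocycle x y u) \<circ> h))"
      unfolding tangent_map_def \<sigma> \<rho>_eq
      by (rule H1_pullback_class[OF h_hom k conj_by_hom[OF g hom] conj_by_Z1[OF g hom Z1_par_Z1[OF line_cocycle_Z1_par]]])
    also have "conj_by k (conj_by g (line_cocycle x y u) \<circ> h) = conj_by (k * g) (line_cocycle x' y' (linear_act M u))"
      by (simp add: conj_by_comp conj_by_conj_by k g line_cocycle_realizes[OF h xy'])
    finally show ?thesis by (simp add: tangent_map_def \<sigma>_eq)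
  qed
  have T: "bij_betw (tangent_map g x y) UNIV (tangent chi_star \<rho>)"
    using tangent_map_bij[OF g s] by (simp add: chi_star_def \<rho>_eq)
  have T': "bij_betw (tangent_map (k * g) x' y') UNIV (tangent chi_star \<sigma>)"
    using tangent_map_bij[OF kg s'] by (simp add: chi_star_def \<sigma>_eq)
  show "\<exists>L. is_differential chi_star chi_star (psl_action (psl M)) \<rho> \<sigma> L \<and>
      bij_betw L (tangent chi_star \<rho>) (tangent chi_star \<sigma>) \<and>
      (\<forall>X\<in>tangent chi_star \<rho>. \<forall>Y\<in>tangent chi_star \<rho>.
        form chi_star \<sigma> (L X) (L Y) = form chi_star \<rho> X Y)"
  proof (intro exI[of _ ?L] conjI ballI)
    show "is_differential chi_star chi_star (psl_action (psl M)) \<rho> \<sigma> ?L"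
      unfolding \<sigma> by (rule psl_action_differential[OF h M k])
    have "bij_betw (tangent_map (k * g) x' y' \<circ> linear_act M) UNIV (tangent chi_star \<sigma>)"
      by (rule bij_betw_trans[OF linear_act_bij[OF M] T'])
    also have "tangent_map (k * g) x' y' \<circ> linear_act M = ?L \<circ> tangent_map g x y"
      using L by auto
    finally show "bij_betw ?L (tangent chi_star \<rho>) (tangent chi_star \<sigma>)"
      using bij_betw_comp_iff[OF T] by blast
    fix X Y assume "X \<in> tangent chi_star \<rho>" "Y \<in> tangent chi_star \<rho>"
    then have "X \<in> range (tangent_map g x y)" "Y \<in> range (tangent_map g x y)"
      using T by (simp_all add: bij_betw_def)
    then obtain u v where uv: "X = tangent_map g x y u" "Y = tangent_map g x y v" by blast
    show "form chi_star \<sigma> (?L X) (?L Y) = form chi_star \<rho> X Y"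
      using omega_hat_tangent_map[OF g, of x y u v] linear_act_area[OF M, of u v]
        omega_hat_tangent_map[OF kg, of x' y' "linear_act M u" "linear_act M v"]
      by (simp add: uv L) (simp add: chi_star_def \<sigma>_eq \<rho>_eq)
  qed
qed

theorem theorem2:
  shows "\<exists>\<phi>. group_action PSL2Z chi \<phi> \<and>
    \<phi> ` carrier PSL2Z = generate (BijGroup chi) {pullback half_twist1, pullback half_twist2} \<and>
    (\<forall>g\<in>carrier PSL2Z. homeomorphic_map chi_top chi_top (\<phi> g)) \<and>
    (\<forall>g\<in>carrier PSL2Z. symplectomorphism chi_star chi_star (\<phi> g)) \<and>
    (\<exists>c. c \<noteq> 0 \<and> symplectomorphism (pillowcase_star c) chi_star rho_hat \<and>
      (\<forall>g\<in>carrier PSL2Z. \<forall>p\<in>points (pillowcase_star c).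
         rho_hat (PSL2Z_act g p) = \<phi> g (rho_hat p)))"
proof (intro exI[of _ psl_action] exI[of _ "- 1 / 2 :: real"] conjI ballI)
  show "group_action PSL2Z chi psl_action"
    unfolding group_action_def by (rule psl_group_hom)
  show "psl_action ` carrier PSL2Z = generate (BijGroup chi) {pullback half_twist1, pullback half_twist2}"
    by (rule psl_action_generated)
  show "symplectomorphism (pillowcase_star (- 1 / 2)) chi_star rho_hat"
    by (rule rho_hat_symplectomorphism)
  fix g assume "g \<in> carrier PSL2Z"
  then obtain M where M: "M \<in> carrier SL2Z" "g = psl M" by (auto simp: PSL2Z_carrier)
  then show "homeomorphic_map chi_top chi_top (psl_action g)" "symplectomorphism chi_star chi_star (psl_action g)"
    by (simp_all add: psl_action_homeomorphic psl_action_symplectomorphism)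
  fix p assume "p \<in> points (pillowcase_star (- 1 / 2))"
  then show "rho_hat (PSL2Z_act g p) = psl_action g (rho_hat p)"
    using psl_action_equivariant torus_star_torus by (auto simp: M points_pillowcase)
qed simp

end
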